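(* Let $0<\alpha<1$, let $f\in\mathcal{C}_\alpha$, and let $0<b<1$ be fixed. Let $k_0$ be an integer with $\sum_{k\ge k_0}m(J_k\cup J'_k)<m(J_0\cup J'_0)$, and let $H$ be the function defined from $k_0$ in the context. Then there exist $\sigma\in(0,1)$ and $\delta>0$ such that for all $n\ge1$ $$m\{h_{\sigma,\delta}>n\}\le m\{H\ge n\},$$ and for every $\alpha''\in(\alpha,1)$ $$m\{H\ge n\}=O\big(n^{-1/\alpha''}\big)\quad (n\to\infty).$$ In particular, the first $(\sigma,\delta)$-hyperbolic time $h_{\sigma,\delta}$ for $f$ is integrable with respect to Lebesgue measure.
   Context: $m$ denotes Lebesgue measure on $[0,1]$. The class $\mathcal{C}_\alpha$. Let $\phi:[0,1]\to[0,1]$ be continuous and decreasing, $C^1$ on $(0,1)$, such that: (1) there are $c_0\in(0,\infty)$ and a $C^1$ function $g_0$ on $(0,1)$ with $g_0(t)\to0$ and $g_0'(t)=o(t^{\alpha-1})$ as $t\to0^+$ and $\phi(t)=1-c_0t^\alpha+g_0(t)$ for $t$ near $0$; (2) $\phi(1)=0$ and there are $c_1\in(0,\infty)$, $\alpha'\in(0,\alpha]$ and a $C^1$ function $g_1$ on $(0,1)$ with $g_1'(s)=o(s^{\alpha'-1})$ as $s\to0^+$ and $\phi(t)=c_1(1-t)^{\alpha'}+g_1(1-t)$ for $t$ near $1$. Put $a=\int_0^1\phi(t)\,dt\in(0,1)$. The map $f:[0,1]\to[0,1]$ is defined implicitly by $$x=\int_0^{f(x)}\phi(t)\,dt\ \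 (x\le a),\qquad 1-x=\int_{f(x)}^1(1-\phi(t))\,dt\ \ (x>a).$$ $\mathcal{C}_\alpha$ is the set of all maps $f$ obtained in this way. On $(0,a)$ one has $\frac{df}{dx}=1/\phi(f(x))$ and on $(a,1)$ one has $\frac{df}{dx}=1/(1-\phi(f(x)))$. Dynamical partition. $f$ has a period-2 orbit $\{x_0,y_0\}$ with $0<x_0<a<y_0<1$. For $n\ge1$ let $x_n$ be the point of $f^{-1}(x_{n-1})\cap(0,a)$ and $y_n$ the point of $f^{-1}(y_{n-1})\cap(a,1)$. For $n\ge0$ put $J_n=(x_{n+1},x_n)$, $J'_n=(y_n,y_{n+1})$. The function $H$. Given $k_0$, let $N(x)=-1$ if $x\in J_0\cup J'_0$, $N(x)=1$ if $x\in[0,x_{k_0})\cup(y_{k_0},1]$, and $N(x)=0$ otherwise; let $H(x)=\min\{n\ge0:\sum_{k=0}^nN(f^k(x))<0\}$ ($=\infty$ if there is no such $n$). Hyperbolic times. Let $\mathcal{S}=\{0,a,1\}$. For $\delta>0$ let $\mathrm{dist}_\delta(x,\mathcal S)=\mathrm{dist}(x,\mathcal S)$ (Euclidean distance) if $\mathrm{dist}(x,\mathcal S)\le\delta$, and $\mathrm{dist}_\delta(x,\mathcal S)=1$ otherwise. For $b>0$, $\sigma\in(0,1)$, $\delta>0$, an integer $n\ge1$ is a $(\sigma,\delta)$-hyperbolic time for $x\in[0,1]\setminus\mathcal S$ if for all $1\le l\le n$ $$\prod_{j=n-l}^{n-1}\Big|\tfrac{df}{dx}(f^j(x))\Big|^{-1}\le\sigma^l\quad\text{and}\quad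 \mathrm{dist}_\delta(f^{n-l}(x),\mathcal S)\ge\sigma^{bl}.$$ $h_{\sigma,\delta}(x)$ is the smallest $(\sigma,\delta)$-hyperbolic time for $x$, and $h_{\sigma,\delta}(x)=\infty$ if there is none (the countable set of points whose orbit meets $\mathcal S$ is irrelevant). *)

theory Defs
  imports "HOL-Analysis.Analysis" "HOL-Library.Landau_Symbols"
begin

abbreviation lebesgue01 :: "real measure" where
  "lebesgue01 \<equiv> lebesgue_on {0..1}"

text \<open>``Decreasing'' is read in the weak sense; the expansions at the end points
  force \<open>0 < \<phi> t < 1\<close> for \<open>0 < t < 1\<close>.\<close>

definition cut_function :: "real \<Rightarrow> (real \<Rightarrow> real) \<Rightarrow> bool" where
  "cut_function \<alpha> \<phi> \<longleftrightarrow>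
     \<phi> \<in> {0..1} \<rightarrow> {0..1} \<and>
     continuous_on {0..1} \<phi> \<and>
     antimono_on {0..1} \<phi> \<and>
     \<phi> C1_differentiable_on {0<..<1} \<and>
     (\<exists>c\<^sub>0 g\<^sub>0. c\<^sub>0 > 0 \<and> g\<^sub>0 C1_differentiable_on {0<..<1} \<and>
        (g\<^sub>0 \<longlongrightarrow> 0) (at_right 0) \<and>
        deriv g\<^sub>0 \<in> o[at_right 0](\<lambda>t. t powr (\<alpha> - 1)) \<and>
        (\<forall>\<^sub>F t in at_right 0. \<phi> t = 1 - c\<^sub>0 * t powr \<alpha> + g\<^sub>0 t)) \<and>
     \<phi> 1 = 0 \<and>
     (\<exists>c\<^sub>1 \<alpha>' g\<^sub>1. c\<^sub>1 > 0 \<and> 0 < \<alpha>' \<and> \<alpha>' \<le> \<alpha> \<and> g\<^sub>1 C1_differentiable_on {0<..<1} \<and>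
        deriv g\<^sub>1 \<in> o[at_right 0](\<lambda>s. s powr (\<alpha>' - 1)) \<and>
        (\<forall>\<^sub>F t in at_left 1. \<phi> t = c\<^sub>1 * (1 - t) powr \<alpha>' + g\<^sub>1 (1 - t)))"

definition cut_point :: "(real \<Rightarrow> real) \<Rightarrow> real" where
  "cut_point \<phi> = integral {0..1} \<phi>"

text \<open>\<open>class_C \<alpha> \<phi> f\<close>: the map \<open>f\<close> belongs to the class \<open>C\<^sub>\<alpha>\<close> and is obtained from the
  cut function \<open>\<phi>\<close>. Only the values of \<open>f\<close> on the unit interval are constrained.\<close>

definition class_C :: "real \<Rightarrow> (real \<Rightarrow> real) \<Rightarrow> (real \<Rightarrow> real) \<Rightarrow> bool" where
  "class_C \<alpha> \<phi> f \<longleftrightarrow>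
     cut_function \<alpha> \<phi> \<and>
     f \<in> {0..1} \<rightarrow> {0..1} \<and>
     (\<forall>x\<in>{0..1}.
        (x \<le> cut_point \<phi> \<longrightarrow> x = integral {0..f x} \<phi>) \<and>
        (x > cut_point \<phi> \<longrightarrow> 1 - x = integral {f x..1} (\<lambda>t. 1 - \<phi> t)))"

definition partition_points ::
    "real \<Rightarrow> (real \<Rightarrow> real) \<Rightarrow> (nat \<Rightarrow> real) \<Rightarrow> (nat \<Rightarrow> real) \<Rightarrow> bool" where
  "partition_points a f x y \<longleftrightarrow>
     0 < x 0 \<and> x 0 < a \<and> a < y 0 \<and> y 0 < 1 \<and> f (x 0) = y 0 \<and> f (y 0) = x 0 \<and>
     (\<forall>n. x (Suc n) \<in> {0<..<a} \<and> f (x (Suc n)) = x n) \<and>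
     (\<forall>n. y (Suc n) \<in> {a<..<1} \<and> f (y (Suc n)) = y n)"

definition J_left :: "(nat \<Rightarrow> real) \<Rightarrow> nat \<Rightarrow> real set" where
  "J_left x n = {x (Suc n)<..<x n}"

definition J_right :: "(nat \<Rightarrow> real) \<Rightarrow> nat \<Rightarrow> real set" where
  "J_right y n = {y n<..<y (Suc n)}"

definition N_fun :: "(nat \<Rightarrow> real) \<Rightarrow> (nat \<Rightarrow> real) \<Rightarrow> nat \<Rightarrow> real \<Rightarrow> int" where
  "N_fun x y k\<^sub>0 t =
     (if t \<in> J_left x 0 \<union> J_right y 0 then -1
      else if t \<in> {0..<x k\<^sub>0} \<union> {y k\<^sub>0<..1} then 1
      else 0)"

text \<open>The infimum of the empty set in \<^typ>\<open>enat\<close> is \<open>\<infinity>\<close>.\<close>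

definition H_fun ::
    "(real \<Rightarrow> real) \<Rightarrow> (nat \<Rightarrow> real) \<Rightarrow> (nat \<Rightarrow> real) \<Rightarrow> nat \<Rightarrow> real \<Rightarrow> enat" where
  "H_fun f x y k\<^sub>0 t = Inf {enat n |n. (\<Sum>k\<le>n. N_fun x y k\<^sub>0 ((f ^^ k) t)) < 0}"

definition trunc_dist :: "real \<Rightarrow> real \<Rightarrow> real set \<Rightarrow> real" where
  "trunc_dist \<delta> x S = (if infdist x S \<le> \<delta> then infdist x S else 1)"

text \<open>The second condition keeps \<open>f\<^sup>j(x)\<close>, \<open>0 \<le> j < n\<close>, away from \<open>S\<close> (for \<open>\<delta> \<ge> 0\<close>), so with
  \<open>S = {0, a, 1}\<close> the derivative is only relevant where it exists.\<close>

definition hyperbolic_time ::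
    "(real \<Rightarrow> real) \<Rightarrow> real set \<Rightarrow> real \<Rightarrow> real \<Rightarrow> real \<Rightarrow> real \<Rightarrow> nat \<Rightarrow> bool" where
  "hyperbolic_time f S b \<sigma> \<delta> x n \<longleftrightarrow>
     x \<in> {0..1} - S \<and> n \<ge> 1 \<and>
     (\<forall>l\<in>{1..n}.
        (\<Prod>j=n-l..<n. inverse \<bar>deriv f ((f ^^ j) x)\<bar>) \<le> \<sigma> ^ l \<and>
        trunc_dist \<delta> ((f ^^ (n - l)) x) S \<ge> \<sigma> powr (b * real l))"

definition first_hyperbolic_time ::
    "(real \<Rightarrow> real) \<Rightarrow> real set \<Rightarrow> real \<Rightarrow> real \<Rightarrow> real \<Rightarrow> real \<Rightarrow> enat" where
  "first_hyperbolic_time f S b \<sigma> \<delta> x = Inf {enat n |n. hyperbolic_time f S b \<sigma> \<delta> x n}"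

definition enat_integrable :: "'a measure \<Rightarrow> ('a \<Rightarrow> enat) \<Rightarrow> bool" where
  "enat_integrable M h \<longleftrightarrow>
     (\<lambda>x. ennreal_of_enat (h x)) \<in> borel_measurable M \<and>
     (\<integral>\<^sup>+x. ennreal_of_enat (h x) \<partial>M) < \<infinity>"

end

theory Submission
  imports Defs
begin

text \<open>
Let \<open>F\<^sub>0\<close> and \<open>F\<^sub>1\<close> be the two inverse branches of \<open>f\<close>. Their derivatives \<open>\<phi>\<close> and \<open>1 - \<phi>\<close> add up
to one, so Lebesgue measure is invariant. A point of the middle interval \<open>\<Delta>\<close> between the two
periodic points is sent by \<open>f\<close> into one of the intervals \<open>J_left x k\<close> or \<open>J_right y k\<close>, walks down
the levels \<open>k, k - 1, \<dots>, 0\<close> and is back in \<open>\<Delta>\<close> after \<open>k + 2\<close> steps. The first return map to \<open>\<Delta>\<close> thus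
has countably many branches (\<^emph>\<open>letters\<close>), all of them onto, and over one return the function \<open>N\<close>
sums to \<open>max (k + 1 - k\<^sub>0) 0 - 1\<close>. So \<open>H\<close> is the time of first passage below zero of a walk whose
steps are read off the successive letters. The mean step for Lebesgue measure on \<open>\<Delta>\<close> is the
measure of the levels from \<open>k\<^sub>0\<close> on minus the measure of level zero, and the hypothesis on \<open>k\<^sub>0\<close> says
that it is negative (\<open>drift_imp\<close>, \<open>mean_increment_le\<close>).

The steps are not independent, and a first passage estimate needs the drift conditionally on the
past. Given a word of letters, the present position has a density whose logarithm is Lipschitz
with a constant that does not depend on the word (\<open>regular_act\<close>). The transfer operator maps
such a density to one that dominates a fixed fraction of the uniform density and leaves a remainder
of the same kind (\<open>regular_split\<close>). Hence a fixed number \<open>p\<close> of letters ahead the conditional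
mean step is negative, uniformly in the past (\<open>uniform_drift\<close>), and adding the expected values of
the letters before that as a corrector turns this into a drift for one letter. Returns have moments of
every order \<open>q < 1 / \<alpha>\<close>, conditionally on the past. The \<open>q\<close>-th power of a linear
combination of corrected height and elapsed time is then a supermartingale except during a bounded
number of letters, and Markov's inequality gives the bound \<open>O(n powr - q)\<close> for the set where \<open>H \<ge> n\<close>
(\<open>survival_bound\<close>, \<open>survivors_tail\<close>).

What is needed about \<open>\<phi>\<close> concerns one neutral fixed point at a time and is proved in the locale
\<open>neutral_branch\<close>: the decay of the points \<open>x n\<close> and of their gaps, and the distortion of the
branches of the return map. The fixed point at 1 is reduced to the one at 0 by the reflection
\<open>t \<mapsto> 1 - t\<close>.

If \<open>H = m\<close> at some point, then \<open>m + 1\<close> is a hyperbolic time. The sum of \<open>N\<close> over every window that ends at time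
\<open>m\<close> is negative, since the sums over initial segments are nonnegative; as the reciprocal of the
derivative is at most \<open>\<sigma> powr (1 - N)\<close>, its product over a window of length \<open>l\<close> is at most \<open>\<sigma> ^ l\<close>.
Moreover the orbit is in level zero at time \<open>m\<close>, and a point close to 0, \<open>a\<close> or 1 needs so many steps to
get there that its distance exceeds any given exponential of that number (\<open>distance_to_S\<close>). So
\<open>h > n\<close> implies \<open>H \<ge> n\<close> pointwise, and \<open>h\<close> is integrable because \<open>q > 1\<close> is possible.
\<close>

section \<open>Power functions along a walk with negative drift\<close>

text \<open>For small \<open>u\<close> this is differentiability of the power at 1, with the term \<open>\<eta> * \<bar>u\<bar>\<close> as error; for \<open>u\<close>
bounded away from 0 the last term dominates. An error that is linear in \<open>\<bar>u\<bar>\<close> is the price for having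
only the \<open>q\<close>-th power of \<open>\<bar>u\<bar>\<close> on the right, with exponents close to 1 included.\<close>

lemma powr_one_plus_bound:
  fixes q \<eta> :: real
  assumes "1 < q" "0 < \<eta>"
  shows "\<exists>C\<ge>1. \<forall>u\<ge>-1. (1 + u) powr q \<le> 1 + q * (u + \<eta> * \<bar>u\<bar>) + C * \<bar>u\<bar> powr q"
proof -
  have "((\<lambda>x. x powr q) has_real_derivative q * 1 powr (q - 1)) (at 1)"
    by (auto intro!: derivative_eq_intros)
  then have "((\<lambda>h. ((1 + h) powr q - 1) / h) \<longlongrightarrow> q) (at 0)"
    by (simp add: DERIV_def)
  then have "\<forall>\<^sub>F h in at 0. dist (((1 + h) powr q - 1) / h) q < q * \<eta>"
    using assms by (intro tendstoD) auto
  then obtain d where d: "d > 0"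
    and dd: "\<And>h. h \<noteq> 0 \<Longrightarrow> \<bar>h\<bar> < d \<Longrightarrow> dist (((1 + h) powr q - 1) / h) q < q * \<eta>"
    unfolding eventually_at by auto
  define C where "C = (1 / d + 1) powr q + q * d powr (1 - q) + 1"
  have C1: "1 \<le> C" using d assms by (simp add: C_def)
  have main: "(1 + u) powr q \<le> 1 + q * (u + \<eta> * \<bar>u\<bar>) + C * \<bar>u\<bar> powr q" if u: "u \<ge> -1" for u
  proof (cases "\<bar>u\<bar> < d")
    case True
    have "(1 + u) powr q \<le> 1 + q * (u + \<eta> * \<bar>u\<bar>)"
    proof (cases "u = 0")
      case False
      have "\<bar>((1 + u) powr q - 1) / u - q\<bar> \<le> q * \<eta>"
        using dd[OF False True] by (simp add: dist_real_def)
      then have "\<bar>((1 + u) powr q - 1) / u - q\<bar> * \<bar>u\<bar> \<le> q * \<eta> * \<bar>u\<bar>"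
        by (intro mult_right_mono) auto
      moreover have "\<bar>((1 + u) powr q - 1) / u - q\<bar> * \<bar>u\<bar> = \<bar>(1 + u) powr q - 1 - q * u\<bar>"
        using False by (simp add: abs_mult[symmetric] field_simps)
      ultimately show ?thesis by (simp add: algebra_simps abs_le_iff)
    qed simp
    moreover have "0 \<le> C * \<bar>u\<bar> powr q" using C1 by simp
    ultimately show ?thesis by linarith
  next
    case False
    then have ud: "\<bar>u\<bar> \<ge> d" by simp
    have u0: "\<bar>u\<bar> > 0" using ud d by linarith
    have "(1 + u) powr q \<le> ((1 / d + 1) * \<bar>u\<bar>) powr q"
    proof (rule powr_mono2)
      have "1 \<le> \<bar>u\<bar> / d" using ud d by simp
      then show "1 + u \<le> (1 / d + 1) * \<bar>u\<bar>" by (simp add: algebra_simps)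
    qed (use u assms in auto)
    also have "\<dots> = (1 / d + 1) powr q * \<bar>u\<bar> powr q" using d by (simp add: powr_mult)
    finally have 1: "(1 + u) powr q \<le> (1 / d + 1) powr q * \<bar>u\<bar> powr q" .
    have "\<bar>u\<bar> = \<bar>u\<bar> powr (1 - q) * \<bar>u\<bar> powr q" using u0 by (simp add: powr_add[symmetric])
    also have "\<dots> \<le> d powr (1 - q) * \<bar>u\<bar> powr q"
      using ud d assms by (intro mult_right_mono powr_mono2') auto
    finally have 2: "q * \<bar>u\<bar> \<le> q * d powr (1 - q) * \<bar>u\<bar> powr q"
      using assms by (simp add: mult.assoc)
    have 3: "- (q * \<bar>u\<bar>) \<le> q * (u + \<eta> * \<bar>u\<bar>)"
    proof -
      have "- \<bar>u\<bar> \<le> u + \<eta> * \<bar>u\<bar>" using assms(2) by (smt (verit) mult_nonneg_nonneg)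
      then show ?thesis using assms(1) by (metis mult_le_cancel_left_pos mult_minus_right order_less_trans zero_less_one)
    qed
    have 4: "C * \<bar>u\<bar> powr q = (1 / d + 1) powr q * \<bar>u\<bar> powr q
        + q * d powr (1 - q) * \<bar>u\<bar> powr q + \<bar>u\<bar> powr q"
      by (simp add: C_def algebra_simps)
    have 5: "0 \<le> \<bar>u\<bar> powr q" by simp
    show ?thesis using 1 2 3 5 unfolding 4 by linarith
  qed
  show ?thesis using C1 main by blast
qed

lemma powr_add_bound:
  fixes q \<eta> :: real
  assumes "1 < q" "0 < \<eta>"
  shows "\<exists>C\<ge>1. \<forall>z\<ge>0. \<forall>D\<ge>-z.
    (z + D) powr q \<le> z powr q + q * z powr (q - 1) * (D + \<eta> * \<bar>D\<bar>) + C * \<bar>D\<bar> powr q"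
proof -
  obtain C where C: "C \<ge> 1"
    and CC: "\<And>u. u \<ge> -1 \<Longrightarrow> (1 + u) powr q \<le> 1 + q * (u + \<eta> * \<bar>u\<bar>) + C * \<bar>u\<bar> powr q"
    using powr_one_plus_bound[OF assms] by blast
  have "(z + D) powr q \<le> z powr q + q * z powr (q - 1) * (D + \<eta> * \<bar>D\<bar>) + C * \<bar>D\<bar> powr q"
    if z: "z \<ge> 0" and D: "D \<ge> -z" for z D
  proof (cases "z = 0")
    case True
    then show ?thesis using C D by (simp add: mult_right_mono[of 1 C, simplified])
  next
    case False
    then have z0: "z > 0" using z by simp
    have "(z + D) powr q = (z * (1 + D / z)) powr q" using z0 by (simp add: distrib_left)
    also have "\<dots> = z powr q * (1 + D / z) powr q" 
      using z0 D by (intro powr_mult)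
    also have "\<dots> \<le> z powr q * (1 + q * (D / z + \<eta> * \<bar>D / z\<bar>) + C * \<bar>D / z\<bar> powr q)"
      using z0 D by (intro mult_left_mono CC) (auto simp: field_simps)
    also have "\<dots> = z powr q + q * (z powr q / z) * (D + \<eta> * \<bar>D\<bar>) + C * (z powr q * \<bar>D / z\<bar> powr q)"
      using z0 by (simp add: field_simps)
    also have "z powr q / z = z powr (q - 1)" using z0 by (simp add: powr_diff)
    also have "z powr q * \<bar>D / z\<bar> powr q = \<bar>D\<bar> powr q"
      using z0 by (simp add: powr_mult[symmetric])
    finally show ?thesis .
  qed
  then show ?thesis using C by blast
qed

text \<open>A step \<open>D\<close> of negative mean from height \<open>z\<close> lowers the mean of the \<open>q\<close>-th power by about
\<open>q * z powr (q - 1)\<close>, which outweighs the moment of \<open>D\<close> once \<open>z\<close> exceeds a threshold \<open>B\<close>; below \<open>B\<close> the mean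
grows by at most a constant. The weights \<open>w\<close> are left unnormalised because they will be
integrals of densities.\<close>

lemma negative_drift_power_step:
  fixes q M :: real
  assumes q: "1 < q" and M: "0 \<le> M"
  shows "\<exists>B\<ge>1. \<exists>c\<ge>0. \<forall>w D m z.
    (\<forall>i::nat. w i \<ge> 0) \<and> w sums m \<and> summable (\<lambda>i. w i * \<bar>D i\<bar> powr q) \<and>
    (\<Sum>i. w i * \<bar>D i\<bar> powr q) \<le> M * m \<and> (\<Sum>i. w i * D i) \<le> - m \<and> z \<ge> 0 \<and> (\<forall>i. z + D i \<ge> 0) \<longrightarrow>
    summable (\<lambda>i. w i * (z + D i) powr q) \<and>
    (\<Sum>i. w i * (z + D i) powr q) \<le> (z powr q + (if z < B then c else 0)) * m"
proof -
  \<comment> \<open>the weighted mean of \<open>\<bar>D\<bar>\<close> is at most \<open>1 + M\<close>, so the linear error uses up half of the drift\<close>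
  define \<eta> where "\<eta> = 1 / (2 * (1 + M))"
  have \<eta>: "\<eta> > 0" using M by (simp add: \<eta>_def)
  obtain C where C: "C \<ge> 1"
    and CC: "\<And>z D. z \<ge> 0 \<Longrightarrow> D \<ge> -z \<Longrightarrow>
      (z + D) powr q \<le> z powr q + q * z powr (q - 1) * (D + \<eta> * \<bar>D\<bar>) + C * \<bar>D\<bar> powr q"
    using powr_add_bound[OF q \<eta>] by blast
  define B where "B = max 1 ((2 * C * M / q) powr (1 / (q - 1)))"
  define c where "c = C * M"
  have B1: "B \<ge> 1" and c0: "c \<ge> 0" using C M by (auto simp: B_def c_def)
  have main: "summable (\<lambda>i. w i * (z + D i) powr q) \<and>
    (\<Sum>i. w i * (z + D i) powr q) \<le> (z powr q + (if z < B then c else 0)) * m"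
    if w: "\<And>i::nat. w i \<ge> 0" and wm: "w sums m" and sq: "summable (\<lambda>i. w i * \<bar>D i\<bar> powr q)"
      and le: "(\<Sum>i. w i * \<bar>D i\<bar> powr q) \<le> M * m"
      and dr: "(\<Sum>i. w i * D i) \<le> - m" and z: "z \<ge> 0" and zD: "\<And>i. z + D i \<ge> 0" for w D m z
  proof -
    have m0: "m \<ge> 0" using sums_le[OF w sums_zero wm] by simp
    have abs1: "\<bar>x\<bar> \<le> 1 + \<bar>x\<bar> powr q" for x :: real
    proof (cases "\<bar>x\<bar> \<le> 1")
      case False
      then have "\<bar>x\<bar> powr 1 \<le> \<bar>x\<bar> powr q" using q by (intro powr_mono) auto
      then show ?thesis using False by simp
    qed (use powr_ge_zero[of "\<bar>x\<bar>" q] in linarith)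
    have wab: "w i * \<bar>D i\<bar> \<le> w i + w i * \<bar>D i\<bar> powr q" for i
      using mult_left_mono[OF abs1[of "D i"] w[of i]] by (simp add: algebra_simps)
    have sumw: "summable w" using wm by (rule sums_summable)
    have s1: "summable (\<lambda>i. w i * \<bar>D i\<bar>)"
      by (rule summable_comparison_test'[OF summable_add[OF sumw sq], of 0]) (use wab w in auto)
    have le1: "(\<Sum>i. w i * \<bar>D i\<bar>) \<le> (1 + M) * m"
    proof -
      have "(\<Sum>i. w i * \<bar>D i\<bar>) \<le> (\<Sum>i. w i + w i * \<bar>D i\<bar> powr q)"
        by (rule suminf_le[OF wab s1 summable_add[OF sumw sq]])
      also have "\<dots> = m + (\<Sum>i. w i * \<bar>D i\<bar> powr q)"
        using suminf_add[OF sumw sq] sums_unique[OF wm] by simp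
      finally show ?thesis using le by (simp add: algebra_simps)
    qed
    have sD: "summable (\<lambda>i. w i * D i)"
      by (rule summable_comparison_test'[OF s1, of 0]) (use w in \<open>auto simp: abs_mult\<close>)
    define U where "U i = w i * z powr q + (q * z powr (q - 1) * (w i * D i)
        + (q * z powr (q - 1) * \<eta> * (w i * \<bar>D i\<bar>) + C * (w i * \<bar>D i\<bar> powr q)))" for i
    have U: "w i * (z + D i) powr q \<le> U i" for i
    proof -
      have "w i * (z + D i) powr q \<le> w i * (z powr q + q * z powr (q - 1) * (D i + \<eta> * \<bar>D i\<bar>) + C * \<bar>D i\<bar> powr q)"
        using zD[of i] by (intro mult_left_mono CC w z) auto
      then show ?thesis by (simp add: U_def algebra_simps)
    qed
    have sU: "U sums (m * z powr q + (q * z powr (q - 1) * (\<Sum>i. w i * D i)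
        + (q * z powr (q - 1) * \<eta> * (\<Sum>i. w i * \<bar>D i\<bar>) + C * (\<Sum>i. w i * \<bar>D i\<bar> powr q))))"
      unfolding U_def
      by (intro sums_add sums_mult sums_mult2 wm summable_sums sD s1 sq)
    have sm: "summable (\<lambda>i. w i * (z + D i) powr q)"
      by (rule summable_comparison_test'[OF sums_summable[OF sU], of 0]) (use U w in auto)
    have "(\<Sum>i. w i * (z + D i) powr q) \<le> (\<Sum>i. U i)"
      by (rule suminf_le[OF U sm sums_summable[OF sU]])
    also have "\<dots> = m * z powr q + (q * z powr (q - 1) * (\<Sum>i. w i * D i)
        + (q * z powr (q - 1) * \<eta> * (\<Sum>i. w i * \<bar>D i\<bar>) + C * (\<Sum>i. w i * \<bar>D i\<bar> powr q)))"
      using sums_unique[OF sU] by simp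
    also have "\<dots> \<le> m * z powr q + (q * z powr (q - 1) * (- m)
        + (q * z powr (q - 1) * \<eta> * ((1 + M) * m) + C * (M * m)))"
      using q C \<eta> by (intro add_mono mult_left_mono order_refl dr le1 le) auto
    also have "\<dots> = (z powr q + (C * M - q / 2 * z powr (q - 1))) * m"
    proof -
      have e: "\<eta> * (1 + M) = 1 / 2" using M by (simp add: \<eta>_def)
      have "q * z powr (q - 1) * \<eta> * ((1 + M) * m) = q * z powr (q - 1) * (\<eta> * (1 + M)) * m"
        by simp
      then show ?thesis unfolding e by (simp add: algebra_simps)
    qed
    also have "\<dots> \<le> (z powr q + (if z < B then c else 0)) * m"
    proof (rule mult_right_mono[OF _ m0])
      have "C * M - q / 2 * z powr (q - 1) \<le> (if z < B then c else 0)"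
      proof (cases "z < B")
        case True
        then show ?thesis using q by (simp add: c_def)
      next
        case False
        have nn: "0 \<le> 2 * C * M / q" using C M q by simp
        have "2 * C * M / q = ((2 * C * M / q) powr (1 / (q - 1))) powr (q - 1)"
          using q nn C M by (simp add: powr_powr)
        also have "\<dots> \<le> z powr (q - 1)"
          using False q by (intro powr_mono2) (auto simp: B_def)
        finally show ?thesis using False q by (simp add: field_simps)
      qed
      then show "z powr q + (C * M - q / 2 * z powr (q - 1)) \<le> z powr q + (if z < B then c else 0)"
        by simp
    qed
    finally show ?thesis using sm by blast
  qed
  show ?thesis
    using B1 c0 main by blast
qed

section \<open>Systems of full branches with bounded distortion\<close>

lemma suminf_ennreal_commute:
  fixes f :: "nat \<Rightarrow> nat \<Rightarrow> ennreal"
  shows "(\<Sum>i. \<Sum>j. f i j) = (\<Sum>j. \<Sum>i. f i j)"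
  using nn_integral_suminf[of "\<lambda>j i. f i j" "count_space UNIV"]
  by (simp add: nn_integral_count_space_nat)

text \<open>Subtracting a constant from a function with logarithmic Lipschitz constant \<open>c\<^sub>1\<close> gives one with
constant \<open>c\<^sub>2\<close>, as long as the constant takes away at most the share \<open>1 - c\<^sub>1 / c\<^sub>2\<close> of the value. The
reason is convexity of the exponential.\<close>

lemma exp_minus_const_le:
  fixes c\<^sub>1 c\<^sub>2 d v e :: real
  assumes "0 \<le> c\<^sub>1" "c\<^sub>1 \<le> c\<^sub>2" "0 < c\<^sub>2" "0 \<le> d" "e \<le> (1 - c\<^sub>1 / c\<^sub>2) * v" "0 \<le> v"
  shows "exp (c\<^sub>1 * d) * v - e \<le> exp (c\<^sub>2 * d) * (v - e)"
proof -
  define t where "t = c\<^sub>1 / c\<^sub>2"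
  have t: "0 \<le> t" "t \<le> 1" using assms by (auto simp: t_def)
  have E: "exp (c\<^sub>2 * d) - 1 \<ge> 0" using assms by simp
  from convex_onD[OF exp_convex t, of 0 "c\<^sub>2 * d"]
  have "exp (t * (c\<^sub>2 * d)) \<le> (1 - t) + t * exp (c\<^sub>2 * d)" by simp
  moreover have "t * (c\<^sub>2 * d) = c\<^sub>1 * d" using assms by (simp add: t_def)
  ultimately have "exp (c\<^sub>1 * d) \<le> (1 - t) + t * exp (c\<^sub>2 * d)" by metis
  then have ex: "exp (c\<^sub>1 * d) - 1 \<le> t * (exp (c\<^sub>2 * d) - 1)"
    by (simp add: algebra_simps)
  have "e * (exp (c\<^sub>2 * d) - 1) \<le> ((1 - t) * v) * (exp (c\<^sub>2 * d) - 1)"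
    using assms(5) E by (intro mult_right_mono) (auto simp: t_def)
  have "v * (exp (c\<^sub>1 * d) - 1) \<le> v * (t * (exp (c\<^sub>2 * d) - 1))"
    using ex assms(6) by (rule mult_left_mono)
  with \<open>e * _ \<le> _\<close> show ?thesis by (simp add: algebra_simps)
qed

text \<open>The \<open>h \<omega>\<close> are the inverse branches of a map of an interval all of whose branches are onto, and the \<open>K \<omega>\<close>
are their derivatives. The condition \<open>K_sum\<close> says that the uniform density is invariant, and
\<open>transfer\<close> is the change of variables over all branches at once.\<close>

locale full_branch_system =
  fixes M :: "real measure" and l u :: real
    and h :: "nat \<Rightarrow> real \<Rightarrow> real" and K :: "nat \<Rightarrow> real \<Rightarrow> ennreal" and \<theta> C :: real
  assumes space_M: "space M = {l<..<u}" and lu: "l < u"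
    and mass_M: "emeasure M (space M) = ennreal (u - l)"
    and \<theta>: "0 \<le> \<theta>" "\<theta> < 1" and C: "0 \<le> C"
    and h_measurable [measurable]: "\<And>\<omega>. h \<omega> \<in> M \<rightarrow>\<^sub>M M"
    and K_measurable [measurable]: "\<And>\<omega>. K \<omega> \<in> borel_measurable M"
    and h_contracts: "\<And>\<omega> y y'. y \<in> space M \<Longrightarrow> y' \<in> space M \<Longrightarrow> \<bar>h \<omega> y - h \<omega> y'\<bar> \<le> \<theta> * \<bar>y - y'\<bar>"
    and K_distortion: "\<And>\<omega> y y'. y \<in> space M \<Longrightarrow> y' \<in> space M \<Longrightarrow>
      K \<omega> y \<le> ennreal (exp (C * \<bar>y - y'\<bar>)) * K \<omega> y'"
    and K_sum: "\<And>y. y \<in> space M \<Longrightarrow> (\<Sum>\<omega>. K \<omega> y) = 1"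
    and transfer: "\<And>v. v \<in> borel_measurable M \<Longrightarrow>
      (\<integral>\<^sup>+y. v y \<partial>M) = (\<Sum>\<omega>. \<integral>\<^sup>+y. K \<omega> y * v (h \<omega> y) \<partial>M)"
begin

text \<open>Passing through a branch multiplies a logarithmic Lipschitz constant by \<open>\<theta>\<close> and adds \<open>C\<close>. This value of
\<open>R\<close> is lowered by 1 in the process, and this margin is what permits subtracting a constant
in \<open>regular_split\<close>.\<close>

definition R :: real where "R = (C + 1) / (1 - \<theta>)"

lemma R_ge_1: "1 \<le> R"
  using \<theta> C by (simp add: R_def)

lemma R_absorbs: "\<theta> * R + C = R - 1"
proof -
  have "(1 - \<theta>) * R = C + 1" using \<theta> by (simp add: R_def)
  then show ?thesis by (simp add: algebra_simps)
qed

text \<open>The densities that occur as conditional distributions of the position, given a word of letters; they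
are not normalised.\<close>

definition regular :: "real \<Rightarrow> (real \<Rightarrow> ennreal) \<Rightarrow> bool" where
  "regular c \<rho> \<longleftrightarrow> \<rho> \<in> borel_measurable M \<and>
     (\<forall>y\<in>space M. \<forall>y'\<in>space M. \<rho> y \<le> ennreal (exp (c * \<bar>y - y'\<bar>)) * \<rho> y') \<and>
     (\<integral>\<^sup>+y. \<rho> y \<partial>M) < \<infinity>"

text \<open>The density of the image of a point with density \<open>\<rho>\<close>, restricted to the event that its first letter is
\<open>\<omega>\<close>; the mass of \<open>act \<omega> \<rho>\<close> is the probability of that event.\<close>

definition act :: "nat \<Rightarrow> (real \<Rightarrow> ennreal) \<Rightarrow> real \<Rightarrow> ennreal" where
  "act \<omega> \<rho> y = K \<omega> y * \<rho> (h \<omega> y)"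

abbreviation mass :: "(real \<Rightarrow> ennreal) \<Rightarrow> ennreal" where
  "mass \<rho> \<equiv> \<integral>\<^sup>+y. \<rho> y \<partial>M"

lemma act_measurable [measurable]: "\<rho> \<in> borel_measurable M \<Longrightarrow> act \<omega> \<rho> \<in> borel_measurable M"
  unfolding act_def[abs_def]
  by (intro borel_measurable_times_ennreal K_measurable measurable_compose[OF h_measurable])

lemma regular_measurable: "regular c \<rho> \<Longrightarrow> \<rho> \<in> borel_measurable M"
  by (simp add: regular_def)

lemma mass_act_sum: "\<rho> \<in> borel_measurable M \<Longrightarrow> (\<Sum>\<omega>. mass (act \<omega> \<rho>)) = mass \<rho>"
  unfolding act_def by (rule transfer[symmetric])

lemma regular_act:
  assumes "regular R \<rho>"
  shows "regular (R - 1) (act \<omega> \<rho>)"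
proof -
  have [measurable]: "\<rho> \<in> borel_measurable M" using assms by (rule regular_measurable)
  have "act \<omega> \<rho> y \<le> ennreal (exp ((R - 1) * \<bar>y - y'\<bar>)) * act \<omega> \<rho> y'"
    if y: "y \<in> space M" "y' \<in> space M" for y y'
  proof -
    have hy: "h \<omega> y \<in> space M" "h \<omega> y' \<in> space M"
      using y measurable_space[OF h_measurable] by auto
    have "\<rho> (h \<omega> y) \<le> ennreal (exp (R * \<bar>h \<omega> y - h \<omega> y'\<bar>)) * \<rho> (h \<omega> y')"
      using assms hy by (auto simp: regular_def)
    also have "\<dots> \<le> ennreal (exp (R * (\<theta> * \<bar>y - y'\<bar>))) * \<rho> (h \<omega> y')"
      using h_contracts[OF y, of \<omega>] R_ge_1 by (intro mult_right_mono ennreal_leI) auto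
    finally have "K \<omega> y * \<rho> (h \<omega> y) \<le> (ennreal (exp (C * \<bar>y - y'\<bar>)) * K \<omega> y') *
        (ennreal (exp (R * (\<theta> * \<bar>y - y'\<bar>))) * \<rho> (h \<omega> y'))"
      using K_distortion[OF y, of \<omega>] by (intro mult_mono) auto
    also have "\<dots> = ennreal (exp (C * \<bar>y - y'\<bar>) * exp (R * (\<theta> * \<bar>y - y'\<bar>))) * (K \<omega> y' * \<rho> (h \<omega> y'))"
      by (simp add: ennreal_mult mult_ac)
    also have "exp (C * \<bar>y - y'\<bar>) * exp (R * (\<theta> * \<bar>y - y'\<bar>)) = exp ((\<theta> * R + C) * \<bar>y - y'\<bar>)"
      by (simp add: exp_add[symmetric] algebra_simps)
    finally show ?thesis by (simp add: act_def R_absorbs)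
  qed
  moreover have "mass (act \<omega> \<rho>) < \<infinity>"
  proof -
    have "mass (act \<omega> \<rho>) \<le> (\<Sum>\<omega>. mass (act \<omega> \<rho>))"
      using sum_le_suminf[of "\<lambda>\<omega>. mass (act \<omega> \<rho>)" "{\<omega>}"] by simp
    also have "\<dots> = mass \<rho>" by (rule mass_act_sum) simp
    finally show ?thesis using assms by (auto simp: regular_def)
  qed
  ultimately show ?thesis by (simp add: regular_def)
qed

lemma regular_mono:
  assumes "regular c \<rho>" "c \<le> c'"
  shows "regular c' \<rho>"
proof -
  have "\<rho> y \<le> ennreal (exp (c' * \<bar>y - y'\<bar>)) * \<rho> y'" if "y \<in> space M" "y' \<in> space M" for y y'
  proof -
    have "\<rho> y \<le> ennreal (exp (c * \<bar>y - y'\<bar>)) * \<rho> y'" using assms that by (auto simp: regular_def)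
    also have "\<dots> \<le> ennreal (exp (c' * \<bar>y - y'\<bar>)) * \<rho> y'"
      using assms(2) by (intro mult_right_mono ennreal_leI) (auto intro: mult_right_mono)
    finally show ?thesis .
  qed
  then show ?thesis using assms by (simp add: regular_def)
qed

lemma regular_const:
  assumes "c < \<infinity>"
  shows "regular R (\<lambda>_. c)"
proof -
  have "c \<le> ennreal (exp (R * \<bar>y - y'\<bar>)) * c" for y y'
  proof -
    have "ennreal 1 \<le> ennreal (exp (R * \<bar>y - y'\<bar>))" using R_ge_1 by (intro ennreal_leI) simp
    then have "1 * c \<le> ennreal (exp (R * \<bar>y - y'\<bar>)) * c" by (intro mult_right_mono) simp_all
    then show ?thesis by simp
  qed
  then show ?thesis using assms by (simp add: regular_def mass_M ennreal_mult_less_top)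
qed

lemma mass_le_pointwise:
  assumes "regular R \<rho>" "y \<in> space M"
  shows "mass \<rho> \<le> ennreal (exp (R * (u - l)) * (u - l)) * \<rho> y"
proof -
  have "mass \<rho> \<le> (\<integral>\<^sup>+y'. ennreal (exp (R * (u - l))) * \<rho> y \<partial>M)"
  proof (rule nn_integral_mono)
    fix y' assume y': "y' \<in> space M"
    have "\<rho> y' \<le> ennreal (exp (R * \<bar>y' - y\<bar>)) * \<rho> y" using assms y' by (auto simp: regular_def)
    also have "\<dots> \<le> ennreal (exp (R * (u - l))) * \<rho> y"
      using assms(2) y' R_ge_1 by (intro mult_right_mono ennreal_leI) (auto simp: space_M)
    finally show "\<rho> y' \<le> ennreal (exp (R * (u - l))) * \<rho> y" .
  qed
  also have "\<dots> = ennreal (exp (R * (u - l)) * (u - l)) * \<rho> y"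
    using lu by (simp add: mass_M ennreal_mult mult_ac)
  finally show ?thesis .
qed

lemma pointwise_le_mass:
  assumes "regular R \<rho>" "y \<in> space M"
  shows "\<rho> y \<le> ennreal (exp (R * (u - l)) / (u - l)) * mass \<rho>"
proof -
  have [measurable]: "\<rho> \<in> borel_measurable M" using assms by (simp add: regular_def)
  have "ennreal (u - l) * \<rho> y = (\<integral>\<^sup>+y'. \<rho> y \<partial>M)"
    by (simp add: mass_M mult_ac)
  also have "\<dots> \<le> (\<integral>\<^sup>+y'. ennreal (exp (R * (u - l))) * \<rho> y' \<partial>M)"
  proof (rule nn_integral_mono)
    fix y' assume y': "y' \<in> space M"
    have "\<rho> y \<le> ennreal (exp (R * \<bar>y - y'\<bar>)) * \<rho> y'" using assms y' by (auto simp: regular_def)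
    also have "\<dots> \<le> ennreal (exp (R * (u - l))) * \<rho> y'"
      using assms(2) y' R_ge_1 by (intro mult_right_mono ennreal_leI) (auto simp: space_M)
    finally show "\<rho> y \<le> ennreal (exp (R * (u - l))) * \<rho> y'" .
  qed
  also have "\<dots> = ennreal (exp (R * (u - l))) * mass \<rho>"
    by (rule nn_integral_cmult) simp
  finally have "ennreal (1 / (u - l)) * (ennreal (u - l) * \<rho> y)
      \<le> ennreal (1 / (u - l)) * (ennreal (exp (R * (u - l))) * mass \<rho>)"
    by (rule mult_left_mono) simp
  then show ?thesis
    using lu by (simp add: mult.assoc[symmetric] ennreal_mult[symmetric])
qed

lemma mass_act_le:
  assumes "regular R \<rho>"
  shows "mass (act \<omega> \<rho>) \<le> ennreal (exp (R * (u - l)) / (u - l)) * mass \<rho> * mass (K \<omega>)"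
proof -
  have "mass (act \<omega> \<rho>) \<le> (\<integral>\<^sup>+y. (ennreal (exp (R * (u - l)) / (u - l)) * mass \<rho>) * K \<omega> y \<partial>M)"
  proof (rule nn_integral_mono)
    fix y assume "y \<in> space M"
    then have "h \<omega> y \<in> space M" using measurable_space[OF h_measurable] by blast
    then have "K \<omega> y * \<rho> (h \<omega> y) \<le> K \<omega> y * (ennreal (exp (R * (u - l)) / (u - l)) * mass \<rho>)"
      by (intro mult_left_mono pointwise_le_mass assms) simp_all
    then show "act \<omega> \<rho> y \<le> ennreal (exp (R * (u - l)) / (u - l)) * mass \<rho> * K \<omega> y"
      by (simp add: act_def mult_ac)
  qed
  also have "\<dots> = (ennreal (exp (R * (u - l)) / (u - l)) * mass \<rho>) * mass (K \<omega>)"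
    by (rule nn_integral_cmult) simp
  finally show ?thesis .
qed

text \<open>By the Harnack inequality \<open>mass_le_pointwise\<close>, the height \<open>\<eta> * mass \<rho>\<close> is at most the share
\<open>1 / R\<close> of every value of \<open>\<rho>\<close>, the share allowed by \<open>exp_minus_const_le\<close>.\<close>

definition \<eta> :: real where "\<eta> = 1 / (R * (exp (R * (u - l)) * (u - l)))"

definition contr :: real where "contr = 1 - \<eta> * (u - l)"

lemma \<eta>_pos: "0 < \<eta>" using R_ge_1 lu by (simp add: \<eta>_def)

lemma contr_bounds: "0 \<le> contr" "contr < 1"
proof -
  have "1 * 1 \<le> R * exp (R * (u - l))" using R_ge_1 lu by (intro mult_mono) auto
  moreover have "\<eta> * (u - l) = 1 / (R * exp (R * (u - l)))"
    using lu by (simp add: \<eta>_def)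
  ultimately show "0 \<le> contr" by (simp add: contr_def)
  show "contr < 1" using \<eta>_pos lu by (simp add: contr_def)
qed

text \<open>A Doeblin decomposition: a fixed fraction of the mass is split off as a uniform density, and the
remainder is again regular, so that the splitting can be repeated after the next letter.\<close>

lemma regular_split:
  assumes reg: "regular (R - 1) \<rho>" and m: "mass \<rho> = ennreal m" "0 \<le> m"
  obtains \<rho>' where "regular R \<rho>'" "\<And>y. y \<in> space M \<Longrightarrow> \<rho> y = ennreal (\<eta> * m) + \<rho>' y"
    "mass \<rho>' = ennreal (contr * m)"
proof -
  have [measurable]: "\<rho> \<in> borel_measurable M" using reg by (simp add: regular_def)
  have regR: "regular R \<rho>" using reg by (rule regular_mono) simp
  define e where "e = \<eta> * m"
  have e0: "0 \<le> e" using m \<eta>_pos by (simp add: e_def)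
  define \<rho>r where "\<rho>r y = enn2real (\<rho> y)" for y
  have \<rho>r: "\<rho> y = ennreal (\<rho>r y)" "0 \<le> \<rho>r y" "e \<le> \<rho>r y / R" if y: "y \<in> space M" for y
  proof -
    have "\<rho> y < \<infinity>"
      using pointwise_le_mass[OF regR y] unfolding m(1)
      by (rule le_less_trans) (simp add: ennreal_mult_less_top)
    then show 1: "\<rho> y = ennreal (\<rho>r y)" by (simp add: \<rho>r_def less_top)
    show 0: "0 \<le> \<rho>r y" by (simp add: \<rho>r_def)
    have "ennreal m \<le> ennreal (exp (R * (u - l)) * (u - l) * \<rho>r y)"
      using mass_le_pointwise[OF regR y] lu unfolding m 1 by (simp add: ennreal_mult 0)
    then have "m \<le> exp (R * (u - l)) * (u - l) * \<rho>r y"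
      using lu 0 by (simp add: ennreal_le_iff)
    then have "m / (exp (R * (u - l)) * (u - l)) \<le> \<rho>r y"
      using lu by (simp add: pos_divide_le_eq mult.commute)
    then have "m / (exp (R * (u - l)) * (u - l)) / R \<le> \<rho>r y / R"
      using R_ge_1 by (intro divide_right_mono) auto
    then show "e \<le> \<rho>r y / R" by (simp add: e_def \<eta>_def mult_ac)
  qed
  have le: "ennreal e \<le> \<rho> y" if "y \<in> space M" for y
  proof -
    have "e \<le> \<rho>r y / R" using \<rho>r that by blast
    also have "\<dots> \<le> \<rho>r y" using R_ge_1 \<rho>r(2)[OF that] 
      by (simp add: divide_le_eq mult_left_mono[of 1 R "\<rho>r y", simplified])
    finally show ?thesis using \<rho>r that by (simp add: ennreal_leI)
  qed
  define \<rho>' where "\<rho>' y = \<rho> y - ennreal e" for y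
  have split: "\<rho> y = ennreal e + \<rho>' y" if "y \<in> space M" for y
    unfolding \<rho>'_def using diff_add_cancel_ennreal[OF le[OF that]] by (simp only: add.commute)
  have [measurable]: "\<rho>' \<in> borel_measurable M" unfolding \<rho>'_def[abs_def] by measurable
  have sum: "ennreal m = ennreal (e * (u - l)) + mass \<rho>'"
  proof -
    have "ennreal m = (\<integral>\<^sup>+y. ennreal e + \<rho>' y \<partial>M)"
      unfolding m(1)[symmetric] using split by (intro nn_integral_cong) auto
    also have "\<dots> = (\<integral>\<^sup>+y. ennreal e \<partial>M) + mass \<rho>'"
      by (rule nn_integral_add) auto
    finally show ?thesis using e0 lu by (simp add: mass_M ennreal_mult)
  qed
  have mass': "mass \<rho>' = ennreal (contr * m)"
  proof -
    have "mass \<rho>' = ennreal m - ennreal (e * (u - l))" using sum by simp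
    also have "\<dots> = ennreal (m - e * (u - l))" using e0 lu by (simp add: ennreal_minus)
    finally show ?thesis by (simp add: contr_def e_def algebra_simps)
  qed
  have "\<rho>' y \<le> ennreal (exp (R * \<bar>y - y'\<bar>)) * \<rho>' y'" if y: "y \<in> space M" "y' \<in> space M" for y y'
  proof -
    have "ennreal (\<rho>r y) \<le> ennreal (exp ((R - 1) * \<bar>y - y'\<bar>) * \<rho>r y')"
      using reg y \<rho>r by (auto simp: regular_def ennreal_mult)
    then have 1: "\<rho>r y \<le> exp ((R - 1) * \<bar>y - y'\<bar>) * \<rho>r y'"
      using \<rho>r y by (simp add: ennreal_le_iff)
    have "exp ((R - 1) * \<bar>y - y'\<bar>) * \<rho>r y' - e \<le> exp (R * \<bar>y - y'\<bar>) * (\<rho>r y' - e)"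
      using R_ge_1 \<rho>r[OF y(2)] by (intro exp_minus_const_le) (auto simp: field_simps)
    with 1 have "ennreal (\<rho>r y - e) \<le> ennreal (exp (R * \<bar>y - y'\<bar>) * (\<rho>r y' - e))"
      by (intro ennreal_leI) linarith
    then show ?thesis
      using y \<rho>r e0 by (simp add: \<rho>'_def ennreal_minus ennreal_mult')
  qed
  then have "regular R \<rho>'"
    using mass' by (simp add: regular_def)
  then show thesis using that split mass' by (simp add: e_def)
qed

text \<open>The transfer operator.\<close>

definition push :: "(real \<Rightarrow> ennreal) \<Rightarrow> real \<Rightarrow> ennreal" where
  "push \<rho> y = (\<Sum>\<omega>. act \<omega> \<rho> y)"

lemma push_one: "y \<in> space M \<Longrightarrow> push (\<lambda>_. 1) y = 1"
  by (simp add: push_def act_def K_sum)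

lemma mass_push:
  assumes [measurable]: "\<rho> \<in> borel_measurable M"
  shows "mass (push \<rho>) = mass \<rho>"
  unfolding push_def mass_act_sum[OF assms, symmetric] by (rule nn_integral_suminf) simp

lemma regular_push:
  assumes "regular R \<rho>"
  shows "regular (R - 1) (push \<rho>)"
proof -
  have [measurable]: "\<rho> \<in> borel_measurable M" using assms by (rule regular_measurable)
  have "push \<rho> y \<le> ennreal (exp ((R - 1) * \<bar>y - y'\<bar>)) * push \<rho> y'"
    if "y \<in> space M" "y' \<in> space M" for y y'
  proof -
    have "push \<rho> y \<le> (\<Sum>\<omega>. ennreal (exp ((R - 1) * \<bar>y - y'\<bar>)) * act \<omega> \<rho> y')"
      unfolding push_def using regular_act[OF assms] that
      by (intro suminf_le) (auto simp: regular_def)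
    then show ?thesis by (simp add: push_def)
  qed
  moreover have "push \<rho> \<in> borel_measurable M" unfolding push_def[abs_def] by measurable
  ultimately show ?thesis using assms mass_push[of \<rho>] by (simp add: regular_def)
qed

end

section \<open>Walks driven by a full branch system\<close>

text \<open>A letter \<open>\<omega>\<close> lasts for \<open>r \<omega>\<close> units of time and moves a walk by \<open>Y \<omega> - 1\<close>. The condition \<open>drift\<close> makes
the mean step negative, but only for the uniform density.\<close>

locale drifting_system = full_branch_system +
  fixes Y r :: "nat \<Rightarrow> nat" and q :: real
  assumes q: "1 < q"
    and Y_le_r: "\<And>\<omega>. Y \<omega> \<le> r \<omega>" and r_pos: "\<And>\<omega>. 1 \<le> r \<omega>"
    and moment: "(\<Sum>\<omega>. ennreal (real (r \<omega>) powr q) * mass (K \<omega>)) < \<infinity>"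
    and drift: "(\<Sum>\<omega>. ennreal (real (Y \<omega>)) * mass (K \<omega>)) < ennreal (u - l)"
begin

text \<open>The expectation of \<open>Y\<close> at the letter number \<open>k\<close>, counted from 0, for a start with density \<open>\<rho>\<close>, times the
mass of \<open>\<rho>\<close>. Written as an iterated sum over letters it is countably additive in \<open>\<rho>\<close>, so that one letter
can be exchanged for one application of the transfer operator (\<open>avg_push\<close>).\<close>

primrec avg :: "nat \<Rightarrow> (real \<Rightarrow> ennreal) \<Rightarrow> ennreal" where
  "avg 0 \<rho> = (\<Sum>\<omega>. ennreal (real (Y \<omega>)) * mass (act \<omega> \<rho>))"
| "avg (Suc k) \<rho> = (\<Sum>\<omega>. avg k (act \<omega> \<rho>))"

lemma act_cong:
  assumes "\<And>y. y \<in> space M \<Longrightarrow> \<rho> y = \<rho>' y" "y \<in> space M"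
  shows "act \<omega> \<rho> y = act \<omega> \<rho>' y"
  using assms measurable_space[OF h_measurable] by (simp add: act_def)

lemma avg_cong: "(\<And>y. y \<in> space M \<Longrightarrow> \<rho> y = \<rho>' y) \<Longrightarrow> avg k \<rho> = avg k \<rho>'"
proof (induction k arbitrary: \<rho> \<rho>')
  case 0
  then have "mass (act \<omega> \<rho>) = mass (act \<omega> \<rho>')" for \<omega>
    by (intro nn_integral_cong act_cong)
  then show ?case by simp
next
  case (Suc k)
  have "avg k (act \<omega> \<rho>) = avg k (act \<omega> \<rho>')" for \<omega>
    by (intro Suc.IH act_cong Suc.prems)
  then show ?case by simp
qed

lemma avg_suminf:
  "(\<And>i. \<rho> i \<in> borel_measurable M) \<Longrightarrow> avg k (\<lambda>y. \<Sum>i. \<rho> i y) = (\<Sum>i. avg k (\<rho> i))"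
proof (induction k arbitrary: \<rho>)
  case 0
  have a: "act \<omega> (\<lambda>y. \<Sum>i. \<rho> i y) = (\<lambda>y. \<Sum>i. act \<omega> (\<rho> i) y)" for \<omega>
    by (simp add: fun_eq_iff act_def)
  have "mass (act \<omega> (\<lambda>y. \<Sum>i. \<rho> i y)) = (\<Sum>i. mass (act \<omega> (\<rho> i)))" for \<omega>
    unfolding a by (rule nn_integral_suminf) (use 0 in simp)
  then have "avg 0 (\<lambda>y. \<Sum>i. \<rho> i y) = (\<Sum>\<omega>. \<Sum>i. ennreal (real (Y \<omega>)) * mass (act \<omega> (\<rho> i)))"
    by simp
  then show ?case by (subst (asm) suminf_ennreal_commute) (simp only: avg.simps)
next
  case (Suc k)
  have a: "act \<omega> (\<lambda>y. \<Sum>i. \<rho> i y) = (\<lambda>y. \<Sum>i. act \<omega> (\<rho> i) y)" for \<omega>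
    by (simp add: fun_eq_iff act_def)
  have "avg k (act \<omega> (\<lambda>y. \<Sum>i. \<rho> i y)) = (\<Sum>i. avg k (act \<omega> (\<rho> i)))" for \<omega>
    unfolding a by (rule Suc.IH) (use Suc.prems in simp)
  then show ?case by (simp add: suminf_ennreal_commute[of "\<lambda>\<omega> i. avg k (act \<omega> (\<rho> i))"])
qed

lemma avg_add:
  "\<rho> \<in> borel_measurable M \<Longrightarrow> \<rho>' \<in> borel_measurable M \<Longrightarrow>
    avg k (\<lambda>y. \<rho> y + \<rho>' y) = avg k \<rho> + avg k \<rho>'"
proof (induction k arbitrary: \<rho> \<rho>')
  case 0
  have a: "act \<omega> (\<lambda>y. \<rho> y + \<rho>' y) = (\<lambda>y. act \<omega> \<rho> y + act \<omega> \<rho>' y)" for \<omega>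
    by (simp add: fun_eq_iff act_def distrib_left)
  have "mass (act \<omega> (\<lambda>y. \<rho> y + \<rho>' y)) = mass (act \<omega> \<rho>) + mass (act \<omega> \<rho>')" for \<omega>
    unfolding a by (rule nn_integral_add) (use 0 in simp_all)
  then show ?case by (simp add: distrib_left suminf_add)
next
  case (Suc k)
  have a: "act \<omega> (\<lambda>y. \<rho> y + \<rho>' y) = (\<lambda>y. act \<omega> \<rho> y + act \<omega> \<rho>' y)" for \<omega>
    by (simp add: fun_eq_iff act_def distrib_left)
  have "avg k (act \<omega> (\<lambda>y. \<rho> y + \<rho>' y)) = avg k (act \<omega> \<rho>) + avg k (act \<omega> \<rho>')" for \<omega>
    unfolding a by (rule Suc.IH) (use Suc.prems in simp_all)
  then show ?case by (simp add: suminf_add)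
qed

lemma avg_cmult: "\<rho> \<in> borel_measurable M \<Longrightarrow> avg k (\<lambda>y. c * \<rho> y) = c * avg k \<rho>"
proof (induction k arbitrary: \<rho>)
  case 0
  have a: "act \<omega> (\<lambda>y. c * \<rho> y) = (\<lambda>y. c * act \<omega> \<rho> y)" for \<omega>
    by (simp add: fun_eq_iff act_def mult_ac)
  have "mass (act \<omega> (\<lambda>y. c * \<rho> y)) = c * mass (act \<omega> \<rho>)" for \<omega>
    unfolding a by (rule nn_integral_cmult) (use 0 in simp)
  then show ?case by (simp add: mult.left_commute)
next
  case (Suc k)
  have a: "act \<omega> (\<lambda>y. c * \<rho> y) = (\<lambda>y. c * act \<omega> \<rho> y)" for \<omega>
    by (simp add: fun_eq_iff act_def mult_ac)
  have "avg k (act \<omega> (\<lambda>y. c * \<rho> y)) = c * avg k (act \<omega> \<rho>)" for \<omega>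
    unfolding a by (rule Suc.IH) (use Suc.prems in simp)
  then show ?case by simp
qed

lemma avg_push: "\<rho> \<in> borel_measurable M \<Longrightarrow> avg k (push \<rho>) = avg (Suc k) \<rho>"
  unfolding push_def[abs_def] by (simp add: avg_suminf)

text \<open>The uniform density is a fixed point of the transfer operator.\<close>

lemma avg_one: "avg k (\<lambda>_. 1) = (\<Sum>\<omega>. ennreal (real (Y \<omega>)) * mass (K \<omega>))"
proof (induction k)
  case (Suc k)
  have "avg (Suc k) (\<lambda>_. 1) = avg k (push (\<lambda>_. 1))" by (rule avg_push[symmetric]) simp
  also have "\<dots> = avg k (\<lambda>_. 1)" by (rule avg_cong) (rule push_one)
  finally show ?case using Suc.IH by simp
qed (simp add: act_def[abs_def])

definition W :: real where
  "W = exp (R * (u - l)) / (u - l) * enn2real (\<Sum>\<omega>. ennreal (real (r \<omega>) powr q) * mass (K \<omega>))"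

lemma W_nonneg: "0 \<le> W" using lu by (simp add: W_def)

text \<open>A regular density is at most a constant times its mean, hence conditional moments are
controlled by those for the uniform density.\<close>

lemma moment_act:
  assumes "regular R \<rho>"
  shows "(\<Sum>\<omega>. ennreal (real (r \<omega>) powr q) * mass (act \<omega> \<rho>)) \<le> ennreal W * mass \<rho>"
proof -
  let ?G = "ennreal (exp (R * (u - l)) / (u - l))"
  have "(\<Sum>\<omega>. ennreal (real (r \<omega>) powr q) * mass (act \<omega> \<rho>))
      \<le> (\<Sum>\<omega>. ?G * mass \<rho> * (ennreal (real (r \<omega>) powr q) * mass (K \<omega>)))"
  proof (rule suminf_le)
    fix \<omega>
    have "ennreal (real (r \<omega>) powr q) * mass (act \<omega> \<rho>)
        \<le> ennreal (real (r \<omega>) powr q) * (?G * mass \<rho> * mass (K \<omega>))"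
      by (intro mult_left_mono mass_act_le assms) simp
    then show "ennreal (real (r \<omega>) powr q) * mass (act \<omega> \<rho>)
        \<le> ?G * mass \<rho> * (ennreal (real (r \<omega>) powr q) * mass (K \<omega>))"
      by (simp add: mult_ac)
  qed simp_all
  also have "\<dots> = ?G * mass \<rho> * (\<Sum>\<omega>. ennreal (real (r \<omega>) powr q) * mass (K \<omega>))" by simp
  also have "(\<Sum>\<omega>. ennreal (real (r \<omega>) powr q) * mass (K \<omega>))
      = ennreal (enn2real (\<Sum>\<omega>. ennreal (real (r \<omega>) powr q) * mass (K \<omega>)))"
    using moment by simp
  also have "?G * mass \<rho> * \<dots> = ennreal W * mass \<rho>"
    unfolding W_def using lu by (subst ennreal_mult) (simp_all only: mult_ac, simp_all)
  finally show ?thesis .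
qed

lemma Y_le_powr: "real (Y \<omega>) \<le> real (r \<omega>) powr q" and r_le_powr: "real (r \<omega>) \<le> real (r \<omega>) powr q"
proof -
  have "real (r \<omega>) powr 1 \<le> real (r \<omega>) powr q"
    using r_pos[of \<omega>] q by (intro powr_mono) auto
  then show "real (r \<omega>) \<le> real (r \<omega>) powr q" by simp
  then show "real (Y \<omega>) \<le> real (r \<omega>) powr q" using Y_le_r[of \<omega>] by linarith
qed

lemma regular_act_R: "regular R \<rho> \<Longrightarrow> regular R (act \<omega> \<rho>)"
  using regular_mono[OF regular_act] by simp

lemma avg_le: "regular R \<rho> \<Longrightarrow> avg k \<rho> \<le> ennreal W * mass \<rho>"
proof (induction k arbitrary: \<rho>)
  case 0
  have "avg 0 \<rho> \<le> (\<Sum>\<omega>. ennreal (real (r \<omega>) powr q) * mass (act \<omega> \<rho>))"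
    by (auto intro!: suminf_le mult_right_mono ennreal_leI Y_le_powr)
  then show ?case using moment_act[OF 0] by simp
next
  case (Suc k)
  have "avg (Suc k) \<rho> \<le> (\<Sum>\<omega>. ennreal W * mass (act \<omega> \<rho>))"
    unfolding avg.simps by (intro suminf_le Suc.IH regular_act_R Suc.prems) simp_all
  also have "\<dots> = ennreal W * mass \<rho>"
    using mass_act_sum[OF regular_measurable[OF Suc.prems]] by simp
  finally show ?case .
qed

text \<open>Each letter replaces the fraction \<open>1 - contr\<close> of the mass by the uniform density, whose mean increment
is \<open>b\<close> at all later times; what is left of the initial density decays geometrically.\<close>

lemma avg_mixing:
  assumes b: "0 \<le> b" "(\<Sum>\<omega>. ennreal (real (Y \<omega>)) * mass (K \<omega>)) = ennreal (b * (u - l))"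
  shows "regular R \<rho> \<Longrightarrow> avg k \<rho> \<le> ennreal (b + W * contr ^ k) * mass \<rho>"
proof (induction k arbitrary: \<rho>)
  case 0
  have "avg 0 \<rho> \<le> ennreal W * mass \<rho>" using 0 by (rule avg_le)
  also have "\<dots> \<le> ennreal (b + W * contr ^ 0) * mass \<rho>"
    using b by (intro mult_right_mono ennreal_leI) auto
  finally show ?case .
next
  case (Suc k)
  have [measurable]: "\<rho> \<in> borel_measurable M" using Suc.prems by (rule regular_measurable)
  obtain m where m: "0 \<le> m" "mass \<rho> = ennreal m"
    using Suc.prems by (cases "mass \<rho>") (auto simp: regular_def)
  have "mass (push \<rho>) = ennreal m" using m by (simp add: mass_push)
  from regular_split[OF regular_push[OF Suc.prems] this m(1)]
  obtain \<rho>' where reg: "regular R \<rho>'"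
    and split: "\<And>y. y \<in> space M \<Longrightarrow> push \<rho> y = ennreal (\<eta> * m) + \<rho>' y"
    and mass': "mass \<rho>' = ennreal (contr * m)" by blast
  have "avg (Suc k) \<rho> = avg k (push \<rho>)" by (rule avg_push[symmetric]) simp
  also have "\<dots> = avg k (\<lambda>y. ennreal (\<eta> * m) * 1 + \<rho>' y)"
    using split by (intro avg_cong) simp
  also have "\<dots> = avg k (\<lambda>y. ennreal (\<eta> * m) * 1) + avg k \<rho>'"
    by (rule avg_add) (use regular_measurable[OF reg] in simp_all)
  also have "avg k (\<lambda>y. ennreal (\<eta> * m) * 1) = ennreal (\<eta> * m) * avg k (\<lambda>_. 1)"
    by (rule avg_cmult) simp
  also have "\<dots> = ennreal (\<eta> * m * (b * (u - l)))"
    using b m \<eta>_pos lu by (simp add: avg_one ennreal_mult)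
  also have "avg k \<rho>' \<le> ennreal (b + W * contr ^ k) * ennreal (contr * m)"
    using Suc.IH[OF reg] by (simp add: mass')
  also have "ennreal (\<eta> * m * (b * (u - l))) + ennreal (b + W * contr ^ k) * ennreal (contr * m)
      = ennreal (\<eta> * m * (b * (u - l)) + (b + W * contr ^ k) * (contr * m))"
    using b m \<eta>_pos lu W_nonneg contr_bounds by (simp add: ennreal_mult[symmetric] ennreal_plus[symmetric] del: ennreal_plus)
  also have "\<eta> * m * (b * (u - l)) + (b + W * contr ^ k) * (contr * m) = (b + W * contr ^ Suc k) * m"
  proof -
    have "\<eta> * m * (b * (u - l)) = (1 - contr) * b * m" by (simp add: contr_def algebra_simps)
    then show ?thesis by (simp add: algebra_simps)
  qed
  finally show ?case using m b W_nonneg contr_bounds by (simp add: ennreal_mult)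
qed

lemma uniform_drift:
  "\<exists>p \<epsilon>. 0 < \<epsilon> \<and> \<epsilon> < 1 \<and> (\<forall>\<rho>. regular R \<rho> \<longrightarrow> avg p \<rho> \<le> ennreal (1 - \<epsilon>) * mass \<rho>)"
proof -
  let ?S = "\<Sum>\<omega>. ennreal (real (Y \<omega>)) * mass (K \<omega>)"
  define b where "b = enn2real ?S / (u - l)"
  have b0: "0 \<le> b" using lu by (simp add: b_def)
  have fin: "?S < \<infinity>" using drift by (rule less_trans) simp
  have bS: "?S = ennreal (b * (u - l))" using lu fin by (simp add: b_def)
  have "ennreal (b * (u - l)) < ennreal (u - l)" using drift bS by simp
  then have b1: "b < 1" using lu b0 by (simp add: ennreal_less_iff)
  have "(\<lambda>k. b + W * contr ^ k) \<longlonglongrightarrow> b + W * 0"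
    using contr_bounds by (intro tendsto_intros LIMSEQ_power_zero) simp
  then have "\<forall>\<^sub>F k in sequentially. b + W * contr ^ k < (b + 1) / 2"
    by (rule order_tendstoD) (use b1 in simp)
  then obtain p where p: "b + W * contr ^ p < (b + 1) / 2"
    by (meson eventually_sequentially order_refl)
  have "avg p \<rho> \<le> ennreal (1 - (1 - b) / 2) * mass \<rho>" if "regular R \<rho>" for \<rho>
  proof -
    have "avg p \<rho> \<le> ennreal (b + W * contr ^ p) * mass \<rho>"
      by (rule avg_mixing[OF b0 bS that])
    also have "\<dots> \<le> ennreal (1 - (1 - b) / 2) * mass \<rho>"
      using p by (intro mult_right_mono ennreal_leI) (auto simp: field_simps)
    finally show ?thesis .
  qed
  then show ?thesis using b0 b1 by (intro exI[of _ p] exI[of _ "(1 - b) / 2"]) auto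
qed

end

lemma sums_of_ennreal_suminf:
  assumes "\<And>\<omega>. f \<omega> = ennreal (g \<omega>)" "\<And>\<omega>::nat. 0 \<le> g \<omega>" "(\<Sum>\<omega>. f \<omega>) = ennreal x" "0 \<le> x"
  shows "g sums x"
proof -
  have "f sums (\<Sum>\<omega>. f \<omega>)" by (intro summable_sums summableI)
  moreover have "f = (\<lambda>\<omega>. ennreal (g \<omega>))" using assms(1) by (rule ext)
  ultimately have "(\<lambda>\<omega>. ennreal (g \<omega>)) sums ennreal x" using assms(3) by simp
  then show ?thesis using assms by (subst (asm) sums_ennreal) auto
qed

context drifting_system
begin

text \<open>The set \<open>E m \<sigma>\<close> stands for the points whose walk, started at height \<open>\<sigma>\<close>, does not reach 0 before time
\<open>m\<close>; \<open>t\<close> is the time already spent, \<open>n\<close> the total time, and \<open>\<rho>\<close> the density given the past. The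
conditional mean of the next step may be positive. The corrector \<open>\<kappa> \<rho>\<close> adds to the height the
expected increments at the next \<open>p\<close> letters, after which the corrected height moves on average by
\<open>avg p \<rho> - mass \<rho>\<close>, which is negative. For large \<open>A\<close> the quantity \<open>A * (\<sigma> + \<kappa> \<rho>) + t\<close> decreases on
average even though \<open>t\<close> grows, and its \<open>q\<close>-th power is a supermartingale above the threshold of
\<open>negative_drift_power_step\<close>. The quantity is at least \<open>t\<close>, and \<open>t\<close> grows with each letter, so only a bounded number of
letters begin below the threshold; the term \<open>c * (b - t)\<close> of the potential \<open>\<Phi>\<close> pays for them.\<close>

lemma survival_bound:
  assumes E_meas: "\<And>m \<sigma>. E m \<sigma> \<in> sets M"
    and E_0: "\<And>m. 1 \<le> m \<Longrightarrow> E m 0 = {}"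
    and E_step: "\<And>m \<sigma> \<omega> y. 1 \<le> m \<Longrightarrow> 1 \<le> \<sigma> \<Longrightarrow> y \<in> space M \<Longrightarrow> h \<omega> y \<in> E m \<sigma> \<Longrightarrow>
      y \<in> E (m - r \<omega>) (\<sigma> + Y \<omega> - 1)"
  shows "\<exists>A\<ge>0. \<forall>n m \<sigma> t \<rho>. regular R \<rho> \<longrightarrow> n \<le> m + t \<longrightarrow>
    ennreal (real n powr q) * (\<integral>\<^sup>+y. \<rho> y * indicator (E m \<sigma>) y \<partial>M)
      \<le> ennreal (A * (real \<sigma> + real t + 1) powr q) * mass \<rho>"
proof -
  obtain p \<epsilon> where \<epsilon>: "0 < \<epsilon>" "\<epsilon> < 1"
    and dr: "\<And>\<rho>. regular R \<rho> \<Longrightarrow> avg p \<rho> \<le> ennreal (1 - \<epsilon>) * mass \<rho>"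
    using uniform_drift by blast
  define G where "G \<rho> = (\<Sum>k<p. avg k \<rho>)" for \<rho>
  define \<kappa> where "\<kappa> \<rho> = enn2real (G \<rho>) / enn2real (mass \<rho>)" for \<rho>
  define X where "X = real p * W"
  have X0: "0 \<le> X" using W_nonneg by (simp add: X_def)
  have G_le: "G \<rho> \<le> ennreal X * mass \<rho>" if "regular R \<rho>" for \<rho>
  proof -
    have "G \<rho> \<le> (\<Sum>k<p. ennreal W * mass \<rho>)" unfolding G_def by (intro sum_mono avg_le that)
    then show ?thesis using W_nonneg by (simp add: X_def ennreal_mult ennreal_of_nat_eq_real_of_nat mult.assoc)
  qed
  have fin: "\<exists>m\<ge>0. mass \<rho> = ennreal m" if "regular R \<rho>" for \<rho>
    using that by (cases "mass \<rho>") (auto simp: regular_def)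
  have G_real: "0 \<le> enn2real (G \<rho>)" "G \<rho> = ennreal (enn2real (G \<rho>))" "enn2real (G \<rho>) \<le> X * m"
    if "regular R \<rho>" "mass \<rho> = ennreal m" "0 \<le> m" for \<rho> m
  proof -
    show "0 \<le> enn2real (G \<rho>)" by simp
    have *: "G \<rho> \<le> ennreal (X * m)" using G_le[OF that(1)] X0 that by (simp add: ennreal_mult)
    then have "G \<rho> < \<infinity>" by (rule le_less_trans) simp
    then show 1: "G \<rho> = ennreal (enn2real (G \<rho>))" by (simp add: less_top)
    show "enn2real (G \<rho>) \<le> X * m"
      using * X0 that by (subst (asm) 1) (simp add: ennreal_le_iff)
  qed
  have \<kappa>_bounds: "0 \<le> \<kappa> \<rho>" "\<kappa> \<rho> \<le> X" if reg: "regular R \<rho>" for \<rho>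
  proof -
    obtain m where m: "0 \<le> m" "mass \<rho> = ennreal m" using fin[OF reg] by blast
    show "0 \<le> \<kappa> \<rho>" by (simp add: \<kappa>_def)
    show "\<kappa> \<rho> \<le> X"
      using G_real(3)[OF reg m(2,1)] m X0 by (cases "m = 0") (auto simp: \<kappa>_def divide_le_eq)
  qed
  have \<kappa>_mult: "m * \<kappa> \<rho> = enn2real (G \<rho>)" if "regular R \<rho>" "mass \<rho> = ennreal m" "0 \<le> m" for \<rho> m
  proof (cases "m = 0")
    case True
    then have "enn2real (G \<rho>) = 0" using G_real(3)[OF that] by (simp add: antisym)
    then show ?thesis using True by simp
  qed (use that in \<open>simp add: \<kappa>_def\<close>)
  \<comment> \<open>the mean duration of a letter is at most \<open>W\<close>, hence time and corrected height together drift by at most \<open>-1\<close>\<close>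
  define A where "A = (W + 1) / \<epsilon>"
  have A0: "0 < A" using W_nonneg \<epsilon> by (simp add: A_def)
  define L where "L = A * (2 + X) + 1"
  have L0: "0 < L" using A0 X0 by (simp add: L_def add_pos_nonneg)
  have Lq: "0 \<le> L powr q * W" using W_nonneg by simp
  obtain B c where B: "1 \<le> B" and c: "0 \<le> c" and step:
    "\<And>w D m z. (\<And>i::nat. w i \<ge> 0) \<Longrightarrow> w sums m \<Longrightarrow> summable (\<lambda>i. w i * \<bar>D i\<bar> powr q) \<Longrightarrow>
    (\<Sum>i. w i * \<bar>D i\<bar> powr q) \<le> L powr q * W * m \<Longrightarrow> (\<Sum>i. w i * D i) \<le> - m \<Longrightarrow> z \<ge> 0 \<Longrightarrow> (\<And>i. z + D i \<ge> 0) \<Longrightarrow>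
    summable (\<lambda>i. w i * (z + D i) powr q) \<and>
    (\<Sum>i. w i * (z + D i) powr q) \<le> (z powr q + (if z < B then c else 0)) * m"
    using negative_drift_power_step[OF q Lq] by meson
  define b where "b = nat \<lceil>B\<rceil>"
  have bB: "B \<le> real b" unfolding b_def by linarith
  define \<Phi> where "\<Phi> \<sigma> \<rho> t = (A * (real \<sigma> + \<kappa> \<rho>) + real t) powr q + c * real (b - t)" for \<sigma> \<rho> t
  have one_step: "(\<Sum>\<omega>. ennreal (\<Phi> (\<sigma> + Y \<omega> - 1) (act \<omega> \<rho>) (t + r \<omega>)) * mass (act \<omega> \<rho>))
      \<le> ennreal (\<Phi> \<sigma> \<rho> t) * mass \<rho>" if reg: "regular R \<rho>" and \<sigma>: "1 \<le> \<sigma>" for \<sigma> \<rho> t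
  proof -
    have [measurable]: "\<rho> \<in> borel_measurable M" using reg by (rule regular_measurable)
    obtain m where m: "0 \<le> m" "mass \<rho> = ennreal m" using fin[OF reg] by blast
    define w where "w \<omega> = enn2real (mass (act \<omega> \<rho>))" for \<omega>
    have rega: "regular R (act \<omega> \<rho>)" for \<omega> using reg by (rule regular_act_R)
    have w: "mass (act \<omega> \<rho>) = ennreal (w \<omega>)" and w0: "0 \<le> w \<omega>" for \<omega>
      using fin[OF rega, of \<omega>] by (auto simp: w_def)
    have w_sums: "w sums m"
      by (rule sums_of_ennreal_suminf[OF w w0 _ m(1)]) (simp add: mass_act_sum m)
    have wr: "(\<Sum>\<omega>. ennreal (real (r \<omega>) powr q) * mass (act \<omega> \<rho>)) \<le> ennreal (W * m)"
      using moment_act[OF reg] m W_nonneg by (simp add: ennreal_mult)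
    obtain s where s: "0 \<le> s" "s \<le> W * m"
      "(\<Sum>\<omega>. ennreal (real (r \<omega>) powr q) * mass (act \<omega> \<rho>)) = ennreal s"
    proof -
      have "(\<Sum>\<omega>. ennreal (real (r \<omega>) powr q) * mass (act \<omega> \<rho>)) < \<infinity>"
        using wr by (rule le_less_trans) simp
      then obtain s where "0 \<le> s" "(\<Sum>\<omega>. ennreal (real (r \<omega>) powr q) * mass (act \<omega> \<rho>)) = ennreal s"
        by (cases "\<Sum>\<omega>. ennreal (real (r \<omega>) powr q) * mass (act \<omega> \<rho>)") auto
      then show ?thesis using that wr m W_nonneg by (simp add: ennreal_le_iff)
    qed
    have wrq: "(\<lambda>\<omega>. real (r \<omega>) powr q * w \<omega>) sums s"
      by (rule sums_of_ennreal_suminf[OF _ _ s(3,1)]) (simp_all add: w w0 ennreal_mult)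
    have r_le: "real (r \<omega>) * w \<omega> \<le> real (r \<omega>) powr q * w \<omega>" for \<omega>
      by (intro mult_right_mono r_le_powr w0)
    have wr_sum: "summable (\<lambda>\<omega>. real (r \<omega>) * w \<omega>)"
      by (rule summable_comparison_test'[OF sums_summable[OF wrq], of 0]) (use r_le w0 in auto)
    have wr_le: "(\<Sum>\<omega>. real (r \<omega>) * w \<omega>) \<le> W * m"
      using suminf_le[OF r_le wr_sum sums_summable[OF wrq]] sums_unique[OF wrq] s by simp
    have finite_avg: "\<exists>x\<ge>0. avg k \<rho> = ennreal x" for k
    proof -
      have "avg k \<rho> < \<infinity>"
        using avg_le[OF reg, of k] m by (auto intro: le_less_trans simp: ennreal_mult_less_top)
      then show ?thesis by (cases "avg k \<rho>") auto
    qed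
    define v where "v k = enn2real (avg k \<rho>)" for k
    have v: "avg k \<rho> = ennreal (v k)" "0 \<le> v k" for k
      using finite_avg[of k] by (auto simp: v_def)
    have wY: "(\<lambda>\<omega>. real (Y \<omega>) * w \<omega>) sums v 0"
      by (rule sums_of_ennreal_suminf[OF _ _ _ v(2)[of 0], where f = "\<lambda>\<omega>. ennreal (real (Y \<omega>)) * mass (act \<omega> \<rho>)"])
        (simp_all add: w w0 ennreal_mult v(1)[of 0, simplified, unfolded w])
    have "(\<Sum>\<omega>. G (act \<omega> \<rho>)) = (\<Sum>k<p. avg (Suc k) \<rho>)"
      unfolding G_def by (simp add: suminf_sum)
    also have "\<dots> = ennreal (\<Sum>k<p. v (Suc k))" unfolding v(1) by (simp add: v(2))
    finally have wG: "(\<lambda>\<omega>. w \<omega> * \<kappa> (act \<omega> \<rho>)) sums (\<Sum>k<p. v (Suc k))"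
      using G_real(2)[OF rega w w0] \<kappa>_mult[OF rega w w0] \<kappa>_bounds(1)[OF rega] w0 v(2)
      by (intro sums_of_ennreal_suminf[where f = "\<lambda>\<omega>. G (act \<omega> \<rho>)"]) (simp_all add: sum_nonneg)
    have Gv: "m * \<kappa> \<rho> = (\<Sum>k<p. v k)"
    proof -
      have "G \<rho> = ennreal (\<Sum>k<p. v k)" unfolding G_def v(1) by (simp add: v(2))
      then show ?thesis using \<kappa>_mult[OF reg m(2,1)] by (simp add: sum_nonneg v(2))
    qed
    \<comment> \<open>the corrector telescopes: of all the conditional means only the last one survives\<close>
    have tele: "v 0 + (\<Sum>k<p. v (Suc k)) = (\<Sum>k<p. v k) + v p"
      using sum.lessThan_Suc_shift[of v p] by simp
    have vp: "v p \<le> (1 - \<epsilon>) * m"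
      using dr[OF reg] \<epsilon> m by (simp add: v ennreal_mult[symmetric] ennreal_le_iff)
    define D where "D \<omega> = A * (real (Y \<omega>) - 1 + \<kappa> (act \<omega> \<rho>) - \<kappa> \<rho>) + real (r \<omega>)" for \<omega>
    have wD: "(\<lambda>\<omega>. w \<omega> * D \<omega>) sums
        (A * ((v 0 + (\<Sum>k<p. v (Suc k))) - (1 + \<kappa> \<rho>) * m) + (\<Sum>\<omega>. real (r \<omega>) * w \<omega>))"
    proof -
      have "(\<lambda>\<omega>. A * ((real (Y \<omega>) * w \<omega> + w \<omega> * \<kappa> (act \<omega> \<rho>)) - (1 + \<kappa> \<rho>) * w \<omega>) + real (r \<omega>) * w \<omega>) sums
        (A * ((v 0 + (\<Sum>k<p. v (Suc k))) - (1 + \<kappa> \<rho>) * m) + (\<Sum>\<omega>. real (r \<omega>) * w \<omega>))"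
        by (intro sums_add sums_mult sums_diff wY wG w_sums summable_sums wr_sum)
      then show ?thesis by (simp add: D_def algebra_simps)
    qed
    have drift_D: "(\<Sum>\<omega>. w \<omega> * D \<omega>) \<le> - m"
    proof -
      have "(\<Sum>\<omega>. w \<omega> * D \<omega>) = A * (v p - m) + (\<Sum>\<omega>. real (r \<omega>) * w \<omega>)"
        using sums_unique[OF wD] Gv by (simp add: tele algebra_simps)
      also have "\<dots> \<le> A * (- \<epsilon> * m) + W * m"
        using vp A0 wr_le by (intro add_mono mult_left_mono) (auto simp: algebra_simps)
      also have "A * (- \<epsilon> * m) = - (A * \<epsilon>) * m" by simp
      also have "A * \<epsilon> = W + 1" using \<epsilon> by (simp add: A_def)
      finally show ?thesis by (simp add: algebra_simps)
    qed
    have D_abs: "\<bar>D \<omega>\<bar> \<le> L * real (r \<omega>)" for \<omega>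
    proof -
      have "\<bar>real (Y \<omega>) - 1 + \<kappa> (act \<omega> \<rho>) - \<kappa> \<rho>\<bar> \<le> real (r \<omega>) + 1 + X"
        using \<kappa>_bounds[OF reg] \<kappa>_bounds[OF rega, of \<omega>] Y_le_r[of \<omega>] by linarith
      also have "\<dots> \<le> (2 + X) * real (r \<omega>)"
        using mult_left_mono[of 1 "real (r \<omega>)" "1 + X"] X0 r_pos[of \<omega>] by (simp add: algebra_simps)
      finally have "A * \<bar>real (Y \<omega>) - 1 + \<kappa> (act \<omega> \<rho>) - \<kappa> \<rho>\<bar> \<le> A * ((2 + X) * real (r \<omega>))"
        using A0 by (intro mult_left_mono) auto
      moreover have "\<bar>D \<omega>\<bar> \<le> A * \<bar>real (Y \<omega>) - 1 + \<kappa> (act \<omega> \<rho>) - \<kappa> \<rho>\<bar> + real (r \<omega>)"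
        using abs_triangle_ineq[of "A * (real (Y \<omega>) - 1 + \<kappa> (act \<omega> \<rho>) - \<kappa> \<rho>)" "real (r \<omega>)"] A0
        by (simp add: D_def abs_mult)
      ultimately show ?thesis by (simp add: L_def algebra_simps)
    qed
    have D_q: "w \<omega> * \<bar>D \<omega>\<bar> powr q \<le> L powr q * (real (r \<omega>) powr q * w \<omega>)" for \<omega>
    proof -
      have "\<bar>D \<omega>\<bar> powr q \<le> (L * real (r \<omega>)) powr q" using D_abs q by (intro powr_mono2) auto
      also have "\<dots> = L powr q * real (r \<omega>) powr q" using L0 by (intro powr_mult)
      finally have "w \<omega> * \<bar>D \<omega>\<bar> powr q \<le> w \<omega> * (L powr q * real (r \<omega>) powr q)"
        by (rule mult_left_mono) (rule w0)
      then show ?thesis by (simp add: mult_ac)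
    qed
    have D_q_sums: "(\<lambda>\<omega>. L powr q * (real (r \<omega>) powr q * w \<omega>)) sums (L powr q * s)"
      by (intro sums_mult wrq)
    have D_sum: "summable (\<lambda>\<omega>. w \<omega> * \<bar>D \<omega>\<bar> powr q)"
      by (rule summable_comparison_test'[OF sums_summable[OF D_q_sums], of 0]) (use D_q w0 in auto)
    have D_le: "(\<Sum>\<omega>. w \<omega> * \<bar>D \<omega>\<bar> powr q) \<le> L powr q * W * m"
    proof -
      have "(\<Sum>\<omega>. w \<omega> * \<bar>D \<omega>\<bar> powr q) \<le> L powr q * s"
        using suminf_le[OF D_q D_sum sums_summable[OF D_q_sums]] sums_unique[OF D_q_sums] by simp
      also have "\<dots> \<le> L powr q * (W * m)" using s by (intro mult_left_mono) auto
      finally show ?thesis by (simp add: mult.assoc)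
    qed
    define z where "z = A * (real \<sigma> + \<kappa> \<rho>) + real t"
    have \<Phi>_z: "\<Phi> \<sigma> \<rho> t = z powr q + c * real (b - t)" by (simp add: \<Phi>_def z_def)
    have z0: "z \<ge> 0" and zt: "real t \<le> z" using A0 \<kappa>_bounds[OF reg] by (auto simp: z_def)
    have zD: "z + D \<omega> = A * (real (\<sigma> + Y \<omega> - 1) + \<kappa> (act \<omega> \<rho>)) + real (t + r \<omega>)" for \<omega>
      using \<sigma> by (simp add: z_def D_def algebra_simps of_nat_diff)
    have zD0: "z + D \<omega> \<ge> 0" for \<omega>
      unfolding zD using A0 \<kappa>_bounds[OF rega] by simp
    have sm: "summable (\<lambda>\<omega>. w \<omega> * (z + D \<omega>) powr q)"
      and le: "(\<Sum>\<omega>. w \<omega> * (z + D \<omega>) powr q) \<le> (z powr q + (if z < B then c else 0)) * m"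
      using step[OF w0 w_sums D_sum D_le drift_D z0 zD0] by auto
    have c2: "(\<lambda>\<omega>. c * real (b - (t + 1)) * w \<omega>) sums (c * real (b - (t + 1)) * m)"
      by (intro sums_mult w_sums)
    have summand: "ennreal (\<Phi> (\<sigma> + Y \<omega> - 1) (act \<omega> \<rho>) (t + r \<omega>)) * mass (act \<omega> \<rho>)
        \<le> ennreal (w \<omega> * (z + D \<omega>) powr q + c * real (b - (t + 1)) * w \<omega>)" for \<omega>
    proof -
      have "\<Phi> (\<sigma> + Y \<omega> - 1) (act \<omega> \<rho>) (t + r \<omega>) \<le> (z + D \<omega>) powr q + c * real (b - (t + 1))"
        unfolding \<Phi>_def zD using r_pos[of \<omega>] c by (intro add_mono mult_left_mono) auto
      moreover have "0 \<le> \<Phi> (\<sigma> + Y \<omega> - 1) (act \<omega> \<rho>) (t + r \<omega>)"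
        using c by (simp add: \<Phi>_def)
      ultimately have "\<Phi> (\<sigma> + Y \<omega> - 1) (act \<omega> \<rho>) (t + r \<omega>) * w \<omega>
          \<le> ((z + D \<omega>) powr q + c * real (b - (t + 1))) * w \<omega>"
        and nn: "0 \<le> \<Phi> (\<sigma> + Y \<omega> - 1) (act \<omega> \<rho>) (t + r \<omega>)"
        using w0[of \<omega>] by (auto intro: mult_right_mono)
      then show ?thesis
        unfolding w ennreal_mult[OF nn w0, symmetric]
        by (intro ennreal_leI) (simp add: algebra_simps)
    qed
    have "(\<Sum>\<omega>. ennreal (\<Phi> (\<sigma> + Y \<omega> - 1) (act \<omega> \<rho>) (t + r \<omega>)) * mass (act \<omega> \<rho>))
        \<le> (\<Sum>\<omega>. ennreal (w \<omega> * (z + D \<omega>) powr q + c * real (b - (t + 1)) * w \<omega>))"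
      by (intro suminf_le summand) simp_all
    also have "\<dots> = ennreal (\<Sum>\<omega>. w \<omega> * (z + D \<omega>) powr q + c * real (b - (t + 1)) * w \<omega>)"
      using w0 c by (intro suminf_ennreal2 summable_add sm sums_summable[OF c2]) simp_all
    also have "(\<Sum>\<omega>. w \<omega> * (z + D \<omega>) powr q + c * real (b - (t + 1)) * w \<omega>)
        = (\<Sum>\<omega>. w \<omega> * (z + D \<omega>) powr q) + c * real (b - (t + 1)) * m"
      using suminf_add[OF sm sums_summable[OF c2]] sums_unique[OF c2] by simp
    also have "ennreal \<dots> \<le> ennreal (\<Phi> \<sigma> \<rho> t * m)"
    proof (rule ennreal_leI)
      have "(if z < B then c else 0) + c * real (b - (t + 1)) \<le> c * real (b - t)"
      proof (cases "z < B")
        case True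
        then have "t < b" using zt bB by linarith
        then have "real (b - t) = real (b - (t + 1)) + 1" by (simp add: of_nat_diff)
        then show ?thesis using True by (simp add: algebra_simps)
      next
        case False
        then show ?thesis using c by (auto intro: mult_left_mono)
      qed
      then have "((if z < B then c else 0) + c * real (b - (t + 1))) * m \<le> c * real (b - t) * m"
        using m by (intro mult_right_mono) auto
      then show "(\<Sum>\<omega>. w \<omega> * (z + D \<omega>) powr q) + c * real (b - (t + 1)) * m \<le> \<Phi> \<sigma> \<rho> t * m"
        using le unfolding \<Phi>_z by (simp add: algebra_simps)
    qed
    also have "\<dots> = ennreal (\<Phi> \<sigma> \<rho> t) * mass \<rho>"
      using c m by (simp add: \<Phi>_def ennreal_mult)
    finally show ?thesis .
  qed
  have main: "ennreal (real n powr q) * (\<integral>\<^sup>+y. \<rho> y * indicator (E m \<sigma>) y \<partial>M)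
      \<le> ennreal (\<Phi> \<sigma> \<rho> t) * mass \<rho>" if "regular R \<rho>" "n \<le> m + t" for n m \<sigma> t \<rho>
    using that
  proof (induction m arbitrary: \<sigma> t \<rho> rule: less_induct)
    case (less m)
    have [measurable]: "\<rho> \<in> borel_measurable M" using less.prems(1) by (rule regular_measurable)
    note [measurable] = E_meas
    consider "m = 0" | "1 \<le> m" "\<sigma> = 0" | "1 \<le> m" "1 \<le> \<sigma>" by linarith
    then show ?case
    proof cases
      case 1
      have "(\<integral>\<^sup>+y. \<rho> y * indicator (E m \<sigma>) y \<partial>M) \<le> mass \<rho>"
        by (intro nn_integral_mono) (auto simp: indicator_def)
      moreover have "real n powr q \<le> \<Phi> \<sigma> \<rho> t"
      proof -
        have "real n powr q \<le> (A * (real \<sigma> + \<kappa> \<rho>) + real t) powr q"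
          using 1 less.prems A0 \<kappa>_bounds[OF less.prems(1)] q by (intro powr_mono2) (auto intro: add_increasing)
        then show ?thesis using mult_nonneg_nonneg[OF c, of "real (b - t)"] by (simp add: \<Phi>_def)
      qed
      ultimately show ?thesis by (intro mult_mono ennreal_leI) auto
    next
      case 2
      then show ?thesis by (simp add: E_0)
    next
      case 3
      let ?\<rho> = "\<lambda>\<omega>. act \<omega> \<rho>" and ?E = "\<lambda>\<omega>. E (m - r \<omega>) (\<sigma> + Y \<omega> - 1)"
      have "(\<integral>\<^sup>+y. \<rho> y * indicator (E m \<sigma>) y \<partial>M)
          = (\<Sum>\<omega>. \<integral>\<^sup>+y. K \<omega> y * (\<rho> (h \<omega> y) * indicator (E m \<sigma>) (h \<omega> y)) \<partial>M)"
        by (rule transfer) simp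
      also have "\<dots> \<le> (\<Sum>\<omega>. \<integral>\<^sup>+y. ?\<rho> \<omega> y * indicator (?E \<omega>) y \<partial>M)"
        using E_step[OF 3]
        by (intro suminf_le nn_integral_mono) (auto simp: act_def indicator_def)
      finally have "ennreal (real n powr q) * (\<integral>\<^sup>+y. \<rho> y * indicator (E m \<sigma>) y \<partial>M)
          \<le> ennreal (real n powr q) * (\<Sum>\<omega>. \<integral>\<^sup>+y. ?\<rho> \<omega> y * indicator (?E \<omega>) y \<partial>M)"
        by (rule mult_left_mono) simp
      also have "\<dots> = (\<Sum>\<omega>. ennreal (real n powr q) * (\<integral>\<^sup>+y. ?\<rho> \<omega> y * indicator (?E \<omega>) y \<partial>M))"
        by simp
      also have "\<dots> \<le> (\<Sum>\<omega>. ennreal (\<Phi> (\<sigma> + Y \<omega> - 1) (?\<rho> \<omega>) (t + r \<omega>)) * mass (?\<rho> \<omega>))"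
      proof (rule suminf_le)
        fix \<omega>
        show "ennreal (real n powr q) * (\<integral>\<^sup>+y. ?\<rho> \<omega> y * indicator (?E \<omega>) y \<partial>M)
            \<le> ennreal (\<Phi> (\<sigma> + Y \<omega> - 1) (?\<rho> \<omega>) (t + r \<omega>)) * mass (?\<rho> \<omega>)"
          using 3 r_pos[of \<omega>] less.prems by (intro less.IH regular_act_R) auto
      qed simp_all
      also have "\<dots> \<le> ennreal (\<Phi> \<sigma> \<rho> t) * mass \<rho>"
        using less.prems(1) 3 by (intro one_step)
      finally show ?thesis .
    qed
  qed
  define A' where "A' = (A * (1 + X) + 1) powr q + c * real b"
  have "0 \<le> A'" using c by (simp add: A'_def)
  moreover have "\<Phi> \<sigma> \<rho> t \<le> A' * (real \<sigma> + real t + 1) powr q" if reg: "regular R \<rho>" for \<sigma> \<rho> t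
  proof -
    let ?s = "real \<sigma> + real t + 1"
    have "real \<sigma> + \<kappa> \<rho> \<le> (1 + X) * ?s"
    proof -
      have "0 \<le> X * real \<sigma> + X * real t" using X0 by simp
      moreover have "(1 + X) * ?s = real \<sigma> + real t + 1 + X + (X * real \<sigma> + X * real t)"
        by (simp add: algebra_simps)
      ultimately show ?thesis using \<kappa>_bounds[OF reg] by linarith
    qed
    then have "A * (real \<sigma> + \<kappa> \<rho>) + real t \<le> A * ((1 + X) * ?s) + ?s"
      using A0 by (intro add_mono mult_left_mono) auto
    then have "(A * (real \<sigma> + \<kappa> \<rho>) + real t) powr q \<le> ((A * (1 + X) + 1) * ?s) powr q"
      using A0 \<kappa>_bounds[OF reg] q by (intro powr_mono2) (auto simp: algebra_simps)
    also have "\<dots> = (A * (1 + X) + 1) powr q * ?s powr q" using A0 X0 by (intro powr_mult)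
    finally have 1: "(A * (real \<sigma> + \<kappa> \<rho>) + real t) powr q \<le> (A * (1 + X) + 1) powr q * ?s powr q" .
    have "c * real (b - t) \<le> c * real b * 1" using c by (auto intro: mult_left_mono)
    also have "\<dots> \<le> c * real b * ?s powr q"
      using c q by (intro mult_left_mono ge_one_powr_ge_zero) auto
    finally show ?thesis using 1 by (simp add: \<Phi>_def A'_def algebra_simps)
  qed
  ultimately show ?thesis
    using main by (intro exI[of _ A']) (meson ennreal_leI mult_right_mono order_trans zero_le)
qed

end

section \<open>Inverse branch at a neutral fixed point\<close>

lemma le_exp_mult:
  fixes p p' e m d :: real
  assumes "\<bar>p - p'\<bar> \<le> e * d * m" "0 \<le> m" "m \<le> p'" "0 \<le> e" "0 \<le> d"
  shows "p \<le> exp (e * d) * p'"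
proof -
  have "0 \<le> e * d" using assms by simp
  then have "e * d * m \<le> e * d * p'" using assms by (intro mult_left_mono)
  then have "p \<le> (1 + e * d) * p'" using assms by (simp add: algebra_simps abs_le_iff)
  also have "\<dots> \<le> exp (e * d) * p'"
    using assms by (intro mult_right_mono exp_ge_add_one_self) simp
  finally show ?thesis .
qed

text \<open>The inverse branch \<open>y \<mapsto> integral {0..y} \<phi>\<close> near its neutral fixed point 0, with \<open>1 - \<phi> t\<close> of order
\<open>t powr \<beta>\<close>. Since it maps \<open>u\<close> to \<open>l\<close>, the interval from \<open>l\<close> to \<open>u\<close> is a fundamental domain: its
images fill up the interval from 0 to \<open>l\<close>. Smoothness of \<open>\<phi>\<close> enters through the Lipschitz bound, whose
constant blows up at 0.\<close>

locale neutral_branch =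
  fixes \<phi> :: "real \<Rightarrow> real" and \<beta> l u c B :: real
  assumes \<beta>: "0 < \<beta>" "\<beta> < 1" and lu: "0 < l" "l < u" "u < 1"
    and cont: "continuous_on {0..1} \<phi>"
    and anti: "\<And>s t. 0 \<le> s \<Longrightarrow> s \<le> t \<Longrightarrow> t \<le> 1 \<Longrightarrow> \<phi> t \<le> \<phi> s"
    and \<phi>_0: "\<phi> 0 = 1" and \<phi>_u: "0 < \<phi> u"
    and F_u: "integral {0..u} \<phi> = l"
    and c: "0 < c" and B: "0 \<le> B"
    and lower: "\<And>t. 0 < t \<Longrightarrow> t \<le> u \<Longrightarrow> c * t powr \<beta> \<le> 1 - \<phi> t"
    and upper: "\<And>t. 0 < t \<Longrightarrow> t \<le> u \<Longrightarrow> 1 - \<phi> t \<le> B * t powr \<beta>"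
    and lipschitz: "\<And>s t. 0 < s \<Longrightarrow> s \<le> t \<Longrightarrow> t \<le> u \<Longrightarrow> \<phi> s - \<phi> t \<le> B * s powr (\<beta> - 1) * (t - s)"
begin

definition F :: "real \<Rightarrow> real" where "F y = integral {0..y} \<phi>"

lemma \<phi>_integrable: "0 \<le> s \<Longrightarrow> t \<le> 1 \<Longrightarrow> \<phi> integrable_on {s..t}"
  by (rule integrable_continuous_real) (rule continuous_on_subset[OF cont], auto)

lemma F_diff:
  assumes "0 \<le> s" "s \<le> t" "t \<le> 1"
  shows "F t - F s = integral {s..t} \<phi>"
  using Henstock_Kurzweil_Integration.integral_combine[OF assms(1,2), of \<phi>] \<phi>_integrable[of 0 t] assms by (simp add: F_def)

lemma F_diff_bounds:
  assumes "0 \<le> s" "s \<le> t" "t \<le> 1"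
  shows "\<phi> t * (t - s) \<le> F t - F s" "F t - F s \<le> \<phi> s * (t - s)"
proof -
  have i: "\<phi> integrable_on {s..t}" using assms by (intro \<phi>_integrable)
  have "integral {s..t} (\<lambda>_. \<phi> t) \<le> integral {s..t} \<phi>"
    using assms by (intro integral_le i) (auto intro: anti)
  then show "\<phi> t * (t - s) \<le> F t - F s" using assms by (simp add: F_diff mult.commute)
  have "integral {s..t} \<phi> \<le> integral {s..t} (\<lambda>_. \<phi> s)"
    using assms by (intro integral_le i) (auto intro: anti)
  then show "F t - F s \<le> \<phi> s * (t - s)" using assms by (simp add: F_diff mult.commute)
qed

lemma F_0: "F 0 = 0"
  by (simp add: F_def)

lemma \<phi>_ge: "0 \<le> y \<Longrightarrow> y \<le> u \<Longrightarrow> \<phi> u \<le> \<phi> y"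
  using lu by (intro anti) auto

lemma \<phi>_pos: "0 \<le> y \<Longrightarrow> y \<le> u \<Longrightarrow> 0 < \<phi> y"
  using \<phi>_ge[of y] \<phi>_u by linarith

lemma \<phi>_le_1: "0 \<le> y \<Longrightarrow> y \<le> 1 \<Longrightarrow> \<phi> y \<le> 1"
  using anti[of 0 y] \<phi>_0 by simp

lemma F_deriv:
  assumes "0 < y" "y < 1"
  shows "(F has_real_derivative \<phi> y) (at y)"
proof -
  have "((\<lambda>y. integral {0..y} \<phi>) has_real_derivative \<phi> y) (at y within {0..1})"
    using assms by (intro integral_has_real_derivative cont) auto
  then have "(F has_real_derivative \<phi> y) (at y within {0..1})"
    by (simp add: F_def[abs_def])
  then show ?thesis using assms by (simp add: at_within_Icc_at)
qed

lemma F_ge: "0 \<le> y \<Longrightarrow> y \<le> 1 \<Longrightarrow> \<phi> y * y \<le> F y"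
  using F_diff_bounds(1)[of 0 y] by (simp add: F_0)

lemma F_le: "0 \<le> y \<Longrightarrow> y \<le> 1 \<Longrightarrow> F y \<le> y"
  using F_diff_bounds(2)[of 0 y] by (simp add: F_0 \<phi>_0)

lemma gap_lower:
  assumes "0 < y" "y \<le> u"
  shows "c / 4 * y powr (1 + \<beta>) \<le> y - F y"
proof -
  have "F (y / 2) \<le> y / 2" using assms lu by (intro F_le) auto
  moreover have "F y - F (y / 2) \<le> \<phi> (y / 2) * (y / 2)"
    using F_diff_bounds(2)[of "y / 2" y] assms lu by simp
  ultimately have "(1 - \<phi> (y / 2)) * (y / 2) \<le> y - F y" by (simp add: algebra_simps)
  moreover have "c * (y / 2) powr \<beta> * (y / 2) \<le> (1 - \<phi> (y / 2)) * (y / 2)"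
    using assms by (intro mult_right_mono lower) auto
  moreover have "c / 4 * y powr (1 + \<beta>) \<le> c * (y / 2) powr \<beta> * (y / 2)"
  proof -
    have "y powr \<beta> / 2 \<le> (y / 2) powr \<beta>"
    proof -
      have "2 powr \<beta> \<le> (2::real) powr 1" using \<beta> by (intro powr_mono) auto
      then have "y powr \<beta> / 2 \<le> y powr \<beta> / 2 powr \<beta>" by (intro divide_left_mono) auto
      then show ?thesis using assms by (simp add: powr_divide)
    qed
    then have "c * (y powr \<beta> / 2) * (y / 2) \<le> c * (y / 2) powr \<beta> * (y / 2)"
      using assms c by (intro mult_right_mono mult_left_mono) auto
    then show ?thesis using assms by (simp add: powr_add mult_ac)
  qed
  ultimately show ?thesis by linarith
qed

lemma gap_upper:
  assumes "0 < y" "y \<le> u"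
  shows "y - F y \<le> B * y powr (1 + \<beta>)"
proof -
  have "y - F y \<le> (1 - \<phi> y) * y" using F_ge[of y] assms lu by (simp add: algebra_simps)
  also have "\<dots> \<le> B * y powr \<beta> * y" using upper[OF assms] assms by (intro mult_right_mono) auto
  finally show ?thesis using assms by (simp add: powr_add mult_ac)
qed

lemma F_in: "0 < y \<Longrightarrow> y \<le> u \<Longrightarrow> 0 < F y \<and> F y \<le> u"
  using F_ge[of y] F_le[of y] mult_pos_pos[OF \<phi>_pos, of y y] lu by linarith

lemma F_mono: "0 \<le> s \<Longrightarrow> s \<le> t \<Longrightarrow> t \<le> u \<Longrightarrow> F s \<le> F t"
  using F_diff_bounds(1)[of s t] mult_nonneg_nonneg[OF less_imp_le[OF \<phi>_pos[of t]], of "t - s"] lu by auto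

lemma iter_in: "0 < y \<Longrightarrow> y \<le> u \<Longrightarrow> 0 < (F ^^ n) y \<and> (F ^^ n) y \<le> u"
  by (induction n) (auto simp: F_in)

lemma iter_mono: "0 < s \<Longrightarrow> s \<le> t \<Longrightarrow> t \<le> u \<Longrightarrow> (F ^^ n) s \<le> (F ^^ n) t"
proof (induction n)
  case (Suc n)
  then show ?case using iter_in[of s n] iter_in[of t n] by (auto intro: F_mono)
qed simp

lemma iter_strict_mono: "0 < s \<Longrightarrow> s < t \<Longrightarrow> t \<le> u \<Longrightarrow> (F ^^ n) s < (F ^^ n) t"
proof (induction n)
  case (Suc n)
  let ?s = "(F ^^ n) s" and ?t = "(F ^^ n) t"
  have st: "0 < ?s" "?s < ?t" "?t \<le> u" using Suc iter_in[of s n] iter_in[of t n] by auto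
  then have "0 < \<phi> ?t * (?t - ?s)" by (intro mult_pos_pos \<phi>_pos) auto
  also have "\<dots> \<le> F ?t - F ?s" using st lu by (intro F_diff_bounds) auto
  finally show ?case by simp
qed simp

definition x :: "nat \<Rightarrow> real" where "x n = (F ^^ Suc n) u"

lemma x_0: "x 0 = l"
  by (simp add: x_def F_def F_u)

lemma x_Suc: "x (Suc n) = F (x n)"
  by (simp add: x_def)

lemma iter_l: "(F ^^ n) l = x n"
  by (simp add: x_def funpow_swap1 F_u[folded F_def])

lemma iter_u: "(F ^^ Suc n) u = x n"
  by (simp add: x_def)

lemma x_pos: "0 < x n" and x_le_u: "x n \<le> u"
  using iter_in[of u "Suc n"] lu by (auto simp: x_def)

lemma x_decr: "x (Suc n) < x n"
proof -
  have "0 < c / 4 * x n powr (1 + \<beta>)" using c x_pos[of n] by simp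
  also have "\<dots> \<le> x n - x (Suc n)" unfolding x_Suc by (intro gap_lower x_pos x_le_u)
  finally show ?thesis by simp
qed

lemma x_antimono: "m \<le> n \<Longrightarrow> x n \<le> x m"
  by (rule decseqD[OF decseq_SucI[of x, OF less_imp_le[OF x_decr]]])

lemma iter_ge_x: "l \<le> y \<Longrightarrow> y \<le> u \<Longrightarrow> x n \<le> (F ^^ n) y"
  using iter_mono[of l y n] lu by (simp add: iter_l)

definition dF :: "nat \<Rightarrow> real \<Rightarrow> real" where
  "dF n y = (\<Prod>i<n. \<phi> ((F ^^ i) y))"

lemma dF_pos: "0 < y \<Longrightarrow> y \<le> u \<Longrightarrow> 0 < dF n y"
  unfolding dF_def using iter_in[of y] by (intro prod_pos \<phi>_pos) (auto intro: less_imp_le)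

lemma dF_Suc: "dF (Suc n) y = dF n y * \<phi> ((F ^^ n) y)"
  by (simp add: dF_def)

lemma iter_deriv:
  assumes "0 < y" "y \<le> u"
  shows "((F ^^ n) has_real_derivative dF n y) (at y)"
proof (induction n)
  case 0
  then show ?case by (simp add: dF_def id_def)
next
  case (Suc n)
  have "(F has_real_derivative \<phi> ((F ^^ n) y)) (at ((F ^^ n) y))"
    using iter_in[OF assms, of n] lu by (intro F_deriv) auto
  from DERIV_chain[OF this Suc.IH] show ?case by (simp add: dF_Suc comp_def mult.commute)
qed

text \<open>The orbits of two points of the fundamental domain interlace, the \<open>(j + 1)\<close>-st point of either lying below the
\<open>j\<close>-th point of the other. As \<open>\<phi>\<close> is decreasing, the two products compare after a shift by one factor.\<close>

lemma dF_bounded_distortion: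
  assumes y: "l \<le> y" "y \<le> u" and y': "l \<le> y'" "y' \<le> u"
  shows "\<phi> u * dF n y' \<le> dF n y"
proof -
  have yp: "0 < y" "0 < y'" using y y' lu by auto
  have "dF n y' \<le> (\<Prod>j<n. \<phi> ((F ^^ Suc j) y))"
    unfolding dF_def
  proof (rule prod_mono, intro conjI)
    fix j
    have "(F ^^ Suc j) y = (F ^^ j) (F y)" by (simp add: funpow_swap1)
    also have "\<dots> \<le> (F ^^ j) y'"
    proof (rule iter_mono)
      show "0 < F y" using F_in[of y] y yp by simp
      have "F y \<le> F u" using y yp by (intro F_mono) auto
      then show "F y \<le> y'" using y' F_u by (simp add: F_def)
    qed (use y' in simp)
    finally show "\<phi> ((F ^^ j) y') \<le> \<phi> ((F ^^ Suc j) y)"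
      using iter_in[of y "Suc j"] iter_in[of y' j] y y' yp lu by (intro anti) auto
    show "0 \<le> \<phi> ((F ^^ j) y')"
      using iter_in[of y' j] y' yp by (intro less_imp_le[OF \<phi>_pos]) auto
  qed
  then have "\<phi> y * dF n y' \<le> \<phi> y * (\<Prod>j<n. \<phi> ((F ^^ Suc j) y))"
    using \<phi>_pos[of y] y yp by (intro mult_left_mono) auto
  also have "\<dots> = dF (Suc n) y"
    unfolding dF_def prod.lessThan_Suc_shift by simp
  also have "\<dots> \<le> dF n y * 1"
    unfolding dF_Suc using iter_in[of y n] dF_pos[of y n] y yp lu
    by (intro mult_left_mono \<phi>_le_1) auto
  finally have "\<phi> y * dF n y' \<le> dF n y" by simp
  moreover have "\<phi> u * dF n y' \<le> \<phi> y * dF n y'"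
    using \<phi>_ge[of y] dF_pos[of y' n] y y' yp by (intro mult_right_mono) auto
  ultimately show ?thesis by linarith
qed

definition gap :: "nat \<Rightarrow> real" where "gap k = x k - x (Suc k)"

lemma gap_pos: "0 < gap k"
  using x_decr by (simp add: gap_def)

definition G :: real where "G = 1 / (\<phi> u * (u - l))"

lemma G_pos: "0 < G"
  using \<phi>_u lu by (simp add: G_def)

lemma dF_le_gap:
  assumes "l \<le> y" "y \<le> u"
  shows "dF (Suc k) y \<le> G * gap k"
proof -
  have "\<exists>z>l. z < u \<and> (F ^^ Suc k) u - (F ^^ Suc k) l = (u - l) * dF (Suc k) z"
    using lu by (intro MVT2 iter_deriv) auto
  then obtain z where z: "l < z" "z < u" "gap k = (u - l) * dF (Suc k) z"
    unfolding iter_l iter_u gap_def by blast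
  have "\<phi> u * dF (Suc k) y \<le> dF (Suc k) z"
    using assms z by (intro dF_bounded_distortion) auto
  then have "(u - l) * (\<phi> u * dF (Suc k) y) \<le> gap k"
    unfolding z(3) using lu by (intro mult_left_mono) auto
  then show ?thesis using \<phi>_u lu by (simp add: G_def field_simps)
qed

lemma iter_lipschitz:
  assumes "l \<le> y" "y \<le> u" "l \<le> y'" "y' \<le> u"
  shows "\<bar>(F ^^ Suc k) y - (F ^^ Suc k) y'\<bar> \<le> G * gap k * \<bar>y - y'\<bar>"
proof -
  have *: "\<bar>(F ^^ Suc k) t - (F ^^ Suc k) s\<bar> \<le> G * gap k * \<bar>t - s\<bar>"
    if "l \<le> s" "s < t" "t \<le> u" for s t
  proof -
    have "\<exists>z>s. z < t \<and> (F ^^ Suc k) t - (F ^^ Suc k) s = (t - s) * dF (Suc k) z"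
      using that lu by (intro MVT2 iter_deriv) auto
    then obtain z where z: "s < z" "z < t" "(F ^^ Suc k) t - (F ^^ Suc k) s = (t - s) * dF (Suc k) z"
      by blast
    have "dF (Suc k) z \<le> G * gap k" using z that by (intro dF_le_gap) auto
    moreover have "0 < dF (Suc k) z" using z that lu by (intro dF_pos) auto
    ultimately show ?thesis unfolding z(3) using that by (simp add: abs_mult mult.commute)
  qed
  consider "y < y'" | "y = y'" | "y' < y" by linarith
  then show ?thesis
    using *[of y y'] *[of y' y] assms by cases (auto simp: abs_minus_commute)
qed

definition \<kappa> :: real where "\<kappa> = min 1 (\<beta> * c / 4)"

lemma \<kappa>_pos: "0 < \<kappa>"
  using \<beta> c by (simp add: \<kappa>_def)

text \<open>In the coordinate \<open>y powr - \<beta>\<close> the neutral fixed point is at infinity and \<open>F\<close> moves points by at least a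
constant.\<close>

lemma F_powr_step:
  assumes "0 < y" "y \<le> u"
  shows "y powr (- \<beta>) + \<beta> * c / 4 \<le> F y powr (- \<beta>)"
proof -
  define v where "v = c / 4 * y powr \<beta>"
  have v0: "0 \<le> v" using c by (simp add: v_def)
  have "F y \<le> y - c / 4 * y powr (1 + \<beta>)" using gap_lower[OF assms] by simp
  also have "\<dots> = y * (1 - v)" using assms by (simp add: v_def powr_add algebra_simps)
  finally have Fy: "F y \<le> y * (1 - v)" .
  have Fp: "0 < F y" using F_in assms by blast
  then have "0 < y * (1 - v)" using Fy by linarith
  then have v1: "v < 1" using assms by (simp add: zero_less_mult_iff)
  have "1 + \<beta> * v \<le> exp (\<beta> * v)" by (rule exp_ge_add_one_self)
  also have "\<dots> \<le> exp (- \<beta> * ln (1 - v))"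
  proof -
    have "ln (1 + - v) \<le> - v" using v1 by (intro ln_add_one_self_le_self2) simp
    then have "\<beta> * ln (1 - v) \<le> \<beta> * (- v)" using \<beta> by (intro mult_left_mono) auto
    then show ?thesis by simp
  qed
  also have "\<dots> = (1 - v) powr (- \<beta>)" using v1 by (simp add: powr_def)
  finally have 1: "1 + \<beta> * v \<le> (1 - v) powr (- \<beta>)" .
  have "y powr (- \<beta>) * y powr \<beta> = 1" using assms by (simp add: powr_add[symmetric])
  then have "y powr (- \<beta>) + \<beta> * c / 4 = y powr (- \<beta>) * (1 + \<beta> * v)"
    by (simp add: v_def algebra_simps)
  also have "\<dots> \<le> y powr (- \<beta>) * (1 - v) powr (- \<beta>)" using 1 by (intro mult_left_mono) auto
  also have "\<dots> = (y * (1 - v)) powr (- \<beta>)" using assms v1 by (simp add: powr_mult)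
  also have "\<dots> \<le> F y powr (- \<beta>)" using Fy Fp \<beta> by (intro powr_mono2') auto
  finally show ?thesis .
qed

lemma x_powr_le: "x n powr \<beta> \<le> 1 / (\<kappa> * (real n + 1))"
proof -
  have "\<kappa> * (real n + 1) \<le> x n powr (- \<beta>)"
  proof (induction n)
    case 0
    have "1 powr (- \<beta>) \<le> l powr (- \<beta>)" using lu \<beta> by (intro powr_mono2') auto
    then show ?case by (simp add: x_0 \<kappa>_def)
  next
    case (Suc n)
    have "\<kappa> * (real (Suc n) + 1) \<le> x n powr (- \<beta>) + \<beta> * c / 4"
      using Suc by (simp add: \<kappa>_def algebra_simps)
    also have "\<dots> \<le> x (Suc n) powr (- \<beta>)"
      unfolding x_Suc by (intro F_powr_step x_pos x_le_u)
    finally show ?case .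
  qed
  then have "inverse (x n powr (- \<beta>)) \<le> inverse (\<kappa> * (real n + 1))"
    using \<kappa>_pos by (intro le_imp_inverse_le) auto
  then show ?thesis by (simp add: powr_minus divide_inverse)
qed

lemma x_tendsto_0: "x \<longlonglongrightarrow> 0"
proof -
  have lim: "(\<lambda>n. (1 / \<kappa>) / (real (Suc n))) \<longlonglongrightarrow> 0"
    by (rule LIMSEQ_Suc[OF lim_const_over_n])
  have "(\<lambda>n. x n powr \<beta>) \<longlonglongrightarrow> 0"
  proof (rule tendsto_sandwich[OF _ _ tendsto_const lim], goal_cases)
    case 2
    have "x n powr \<beta> \<le> 1 / \<kappa> / real (Suc n)" for n
      using x_powr_le[of n] by (simp add: add.commute)
    then show ?case by (rule always_eventually[OF allI])
  qed simp
  then have "(\<lambda>n. (x n powr \<beta>) powr (1 / \<beta>)) \<longlonglongrightarrow> 0 powr (1 / \<beta>)"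
    using \<beta> by (intro tendsto_powr2) (auto intro: always_eventually)
  then show ?thesis using \<beta> x_pos by (simp add: powr_powr less_imp_le)
qed

lemma gap_le:
  "gap k \<le> B * (1 / \<kappa>) powr (1 + 1 / \<beta>) * (real k + 1) powr (- (1 + 1 / \<beta>))"
proof -
  have "gap k \<le> B * x k powr (1 + \<beta>)"
    unfolding gap_def x_Suc by (intro gap_upper x_pos x_le_u)
  also have "x k powr (1 + \<beta>) = (x k powr \<beta>) powr (1 + 1 / \<beta>)"
  proof -
    have "\<beta> * (1 + 1 / \<beta>) = 1 + \<beta>" using \<beta> by (simp add: distrib_left)
    then show ?thesis by (simp only: powr_powr)
  qed
  also have "\<dots> \<le> (1 / (\<kappa> * (real k + 1))) powr (1 + 1 / \<beta>)"
    using x_powr_le \<beta> by (intro powr_mono2) auto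
  also have "\<dots> = (1 / \<kappa>) powr (1 + 1 / \<beta>) * (real k + 1) powr (- (1 + 1 / \<beta>))"
  proof -
    have "1 / (\<kappa> * (real k + 1)) = (1 / \<kappa>) * (1 / (real k + 1))" by simp
    moreover have "(1 / (real k + 1)) powr (1 + 1 / \<beta>) = (real k + 1) powr (- (1 + 1 / \<beta>))"
      by (simp add: powr_divide powr_minus_divide del: minus_add_distrib)
    ultimately show ?thesis using \<kappa>_pos by (simp only: powr_mult)
  qed
  finally show ?thesis using mult_left_mono[OF _ B] unfolding mult.assoc by blast
qed

lemma x_le_Suc: "\<phi> u * x n \<le> x (Suc n)"
proof -
  have "\<phi> u * x n \<le> \<phi> (x n) * x n"
    using x_pos[of n] x_le_u[of n] by (intro mult_right_mono \<phi>_ge) auto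
  also have "\<dots> \<le> x (Suc n)" unfolding x_Suc using x_pos[of n] x_le_u[of n] lu by (intro F_ge) auto
  finally show ?thesis .
qed

text \<open>The Lipschitz constant of \<open>\<phi>\<close> blows up like \<open>x k powr (\<beta> - 1)\<close> near the fixed point, but the iterates have
been contracted in proportion to the gap, which is of order \<open>x k powr (1 + \<beta>)\<close>.\<close>

lemma \<phi>_iter_lipschitz:
  assumes "l \<le> y" "y \<le> u" "l \<le> y'" "y' \<le> u"
  shows "\<bar>\<phi> ((F ^^ Suc k) y) - \<phi> ((F ^^ Suc k) y')\<bar>
    \<le> B * x (Suc k) powr (\<beta> - 1) * (G * (B * x k powr (1 + \<beta>)) * \<bar>y - y'\<bar>)"
proof -
  have *: "\<bar>\<phi> s - \<phi> t\<bar> \<le> B * x (Suc k) powr (\<beta> - 1) * \<bar>s - t\<bar>"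
    if "x (Suc k) \<le> s" "s \<le> t" "t \<le> u" for s t
  proof -
    have s0: "0 < s" using that x_pos[of "Suc k"] by linarith
    have "\<phi> s - \<phi> t \<le> B * s powr (\<beta> - 1) * (t - s)" using that s0 by (intro lipschitz) auto
    also have "\<dots> \<le> B * x (Suc k) powr (\<beta> - 1) * (t - s)"
      using that B \<beta> x_pos[of "Suc k"] by (intro mult_right_mono mult_left_mono powr_mono2') auto
    finally show ?thesis using that anti[of s t] s0 lu by auto
  qed
  let ?z = "(F ^^ Suc k) y" and ?z' = "(F ^^ Suc k) y'"
  have z: "x (Suc k) \<le> ?z" "?z \<le> u" "x (Suc k) \<le> ?z'" "?z' \<le> u"
    using iter_ge_x[of y "Suc k"] iter_ge_x[of y' "Suc k"] iter_in[of y "Suc k"] iter_in[of y' "Suc k"]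
      assms lu by auto
  have "\<bar>\<phi> ?z - \<phi> ?z'\<bar> \<le> B * x (Suc k) powr (\<beta> - 1) * \<bar>?z - ?z'\<bar>"
    using *[of ?z ?z'] *[of ?z' ?z] z by (cases "?z \<le> ?z'") (auto simp: abs_minus_commute)
  also have "\<dots> \<le> B * x (Suc k) powr (\<beta> - 1) * (G * gap k * \<bar>y - y'\<bar>)"
    using assms B by (intro mult_left_mono iter_lipschitz) auto
  also have "\<dots> \<le> B * x (Suc k) powr (\<beta> - 1) * (G * (B * x k powr (1 + \<beta>)) * \<bar>y - y'\<bar>)"
    using B G_pos gap_upper[OF x_pos x_le_u, of k]
    by (intro mult_left_mono mult_right_mono) (auto simp: gap_def x_Suc)
  finally show ?thesis .
qed

text \<open>The derivative of \<open>F ^^ Suc k\<close> followed by the other inverse branch, whose derivative is \<open>1 - \<phi>\<close>.\<close>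

definition wt :: "nat \<Rightarrow> real \<Rightarrow> real" where
  "wt k y = dF (Suc k) y * (1 - \<phi> ((F ^^ Suc k) y))"

text \<open>The sum telescopes, as \<open>wt k\<close> is the difference of two consecutive products \<open>dF\<close>.\<close>

lemma wt_sums: "l \<le> y \<Longrightarrow> y \<le> u \<Longrightarrow> (\<lambda>k. wt k y) sums \<phi> y"
proof -
  assume y: "l \<le> y" "y \<le> u"
  have "gap \<longlonglongrightarrow> 0 - 0"
    unfolding gap_def[abs_def] by (intro tendsto_diff x_tendsto_0 LIMSEQ_Suc)
  then have g: "(\<lambda>k. G * gap k) \<longlonglongrightarrow> 0" by (simp add: tendsto_mult_right_zero)
  have "(\<lambda>k. dF (Suc k) y) \<longlonglongrightarrow> 0"
    by (rule tendsto_sandwich[OF _ _ tendsto_const g])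
      (use y dF_le_gap dF_pos[of y] lu in \<open>auto intro!: always_eventually less_imp_le\<close>)
  from telescope_sums'[OF this] show "(\<lambda>k. wt k y) sums \<phi> y"
    by (simp add: wt_def dF_Suc algebra_simps dF_def)
qed

lemma wt_pos:
  assumes "l \<le> y" "y \<le> u"
  shows "0 < wt k y"
proof -
  have "0 < (F ^^ Suc k) y" "(F ^^ Suc k) y \<le> u"
    using iter_in[of y "Suc k"] assms lu by auto
  then have "0 < 1 - \<phi> ((F ^^ Suc k) y)"
    using lower[of "(F ^^ Suc k) y"] mult_pos_pos[OF c, of "(F ^^ Suc k) y powr \<beta>"] by simp
  then show ?thesis unfolding wt_def using dF_pos[of y "Suc k"] assms lu by simp
qed

text \<open>The ratio of consecutive points tends to 1, because it is at least \<open>\<phi> (x n)\<close>.\<close>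

lemma eventually_geometric_le_x:
  assumes "0 < r" "r < 1"
  shows "\<forall>\<^sub>F n in sequentially. r ^ n \<le> x n"
proof -
  \<comment> \<open>one factor \<open>s ^ n\<close> bounds the orbit from below, the other absorbs its starting value\<close>
  define s where "s = sqrt r"
  have s: "0 < s" "s < 1" "s * s = r" using assms by (auto simp: s_def)
  have "((\<lambda>n. \<phi> (x n)) \<longlongrightarrow> \<phi> 0) sequentially"
    by (rule continuous_on_tendsto_compose[OF cont x_tendsto_0])
      (use x_pos x_le_u lu in \<open>auto intro!: always_eventually less_imp_le order_trans[OF x_le_u]\<close>)
  then have "\<forall>\<^sub>F n in sequentially. s < \<phi> (x n)"
    by (rule order_tendstoD) (use s \<phi>_0 in simp)
  then obtain N where N: "\<And>n. N \<le> n \<Longrightarrow> s < \<phi> (x n)"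
    by (auto simp: eventually_sequentially)
  have geo: "x N * s ^ n \<le> x (N + n)" for n
  proof (induction n)
    case (Suc n)
    have "x N * s ^ Suc n \<le> s * x (N + n)" using Suc s by (simp add: mult_ac)
    also have "\<dots> \<le> \<phi> (x (N + n)) * x (N + n)"
      using N[of "N + n"] x_pos[of "N + n"] by (intro mult_right_mono) auto
    also have "\<dots> \<le> x (N + Suc n)"
      using F_ge[of "x (N + n)"] x_pos[of "N + n"] x_le_u[of "N + n"] lu by (simp add: x_Suc)
    finally show ?case .
  qed simp
  have "(\<lambda>n. s ^ n) \<longlonglongrightarrow> 0" using s by (intro LIMSEQ_power_zero) simp
  then have "\<forall>\<^sub>F n in sequentially. s ^ n < x N"
    by (rule order_tendstoD) (rule x_pos)
  moreover have "\<forall>\<^sub>F n in sequentially. N \<le> n" by (rule eventually_ge_at_top)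
  ultimately show ?thesis
  proof eventually_elim
    case (elim n)
    have "r ^ n = s ^ n * s ^ n" by (simp add: s(3)[symmetric] power_mult_distrib)
    also have "\<dots> \<le> x N * s ^ (n - N)"
      using elim s x_pos[of N] by (intro mult_mono power_decreasing) auto
    also have "\<dots> \<le> x n" using geo[of "n - N"] elim by simp
    finally show ?case .
  qed
qed

text \<open>The factor number \<open>i\<close> of \<open>dF\<close> contributes at most a multiple of \<open>x i powr (2 * \<beta>)\<close> to the logarithmic Lipschitz
constant, which is \<open>O(1 / i\<^sup>2)\<close> and summable. In the last factor \<open>1 - \<phi>\<close> of \<open>wt\<close> the contribution is divided by
the small value \<open>x k powr \<beta>\<close> of that factor and still remains bounded.\<close>

lemma distortion:
  "\<exists>S\<ge>0. \<forall>k. \<forall>y\<in>{l..u}. \<forall>y'\<in>{l..u}.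
    dF (Suc k) y \<le> exp (S * \<bar>y - y'\<bar>) * dF (Suc k) y' \<and>
    wt k y \<le> exp (S * \<bar>y - y'\<bar>) * wt k y'"
proof -
  define E where "E = B * B * G * \<phi> u powr (\<beta> - 1) * (1 / \<kappa>)\<^sup>2"
  define d where "d i = (if i = 0 then B * l powr (\<beta> - 1) / \<phi> u else E / \<phi> u * (1 / (real i)\<^sup>2))" for i :: nat
  have E0: "0 \<le> E" using G_pos by (simp add: E_def)
  have d0: "0 \<le> d i" for i using E0 B \<phi>_u by (simp add: d_def)
  have factor: "\<phi> ((F ^^ i) y) \<le> exp (d i * \<bar>y - y'\<bar>) * \<phi> ((F ^^ i) y')"
    if y: "l \<le> y" "y \<le> u" and y': "l \<le> y'" "y' \<le> u" for y y' i
  proof (rule le_exp_mult[where m = "\<phi> u"])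
    show "\<phi> u \<le> \<phi> ((F ^^ i) y')"
      using iter_in[of y' i] y' lu by (intro \<phi>_ge) auto
    show "\<bar>\<phi> ((F ^^ i) y) - \<phi> ((F ^^ i) y')\<bar> \<le> d i * \<bar>y - y'\<bar> * \<phi> u"
    proof (cases i)
      case 0
      have *: "\<bar>\<phi> s - \<phi> t\<bar> \<le> B * l powr (\<beta> - 1) * \<bar>s - t\<bar>"
        if "l \<le> s" "s \<le> t" "t \<le> u" for s t
      proof -
        have "\<phi> s - \<phi> t \<le> B * s powr (\<beta> - 1) * (t - s)" using that lu by (intro lipschitz) auto
        also have "\<dots> \<le> B * l powr (\<beta> - 1) * (t - s)"
          using that B \<beta> lu by (intro mult_right_mono mult_left_mono powr_mono2') auto
        finally show ?thesis using that anti[of s t] lu by auto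
      qed
      show ?thesis
        using 0 *[of y y'] *[of y' y] y y' \<phi>_u
        by (cases "y \<le> y'") (auto simp: d_def abs_minus_commute)
    next
      case (Suc k)
      have "x (Suc k) powr (\<beta> - 1) \<le> (\<phi> u * x k) powr (\<beta> - 1)"
        using x_le_Suc[of k] x_pos[of k] \<phi>_u \<beta> by (intro powr_mono2') auto
      also have "\<dots> = \<phi> u powr (\<beta> - 1) * x k powr (\<beta> - 1)"
        using x_pos[of k] \<phi>_u by (simp add: powr_mult)
      finally have 1: "x (Suc k) powr (\<beta> - 1) \<le> \<phi> u powr (\<beta> - 1) * x k powr (\<beta> - 1)" .
      have "x (Suc k) powr (\<beta> - 1) * x k powr (1 + \<beta>)
          \<le> \<phi> u powr (\<beta> - 1) * x k powr (\<beta> - 1) * x k powr (1 + \<beta>)"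
        using 1 by (intro mult_right_mono) auto
      also have "\<dots> = \<phi> u powr (\<beta> - 1) * (x k powr \<beta>)\<^sup>2"
        using x_pos[of k] by (simp add: powr_add[symmetric] power2_eq_square)
      also have "\<dots> \<le> \<phi> u powr (\<beta> - 1) * (1 / (\<kappa> * (real k + 1)))\<^sup>2"
        by (intro mult_left_mono power_mono x_powr_le) auto
      finally have 2: "x (Suc k) powr (\<beta> - 1) * x k powr (1 + \<beta>)
          \<le> \<phi> u powr (\<beta> - 1) * (1 / (\<kappa> * (real k + 1)))\<^sup>2" .
      have "\<bar>\<phi> ((F ^^ Suc k) y) - \<phi> ((F ^^ Suc k) y')\<bar>
          \<le> B * x (Suc k) powr (\<beta> - 1) * (G * (B * x k powr (1 + \<beta>)) * \<bar>y - y'\<bar>)"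
        by (rule \<phi>_iter_lipschitz[OF y y'])
      also have "\<dots> = B * B * G * (x (Suc k) powr (\<beta> - 1) * x k powr (1 + \<beta>)) * \<bar>y - y'\<bar>"
        by (simp add: mult_ac)
      also have "\<dots> \<le> B * B * G * (\<phi> u powr (\<beta> - 1) * (1 / (\<kappa> * (real k + 1)))\<^sup>2) * \<bar>y - y'\<bar>"
        using 2 G_pos by (intro mult_right_mono mult_left_mono) auto
      also have "\<dots> = d i * \<bar>y - y'\<bar> * \<phi> u"
      proof -
        have "(1 / (\<kappa> * (real k + 1)))\<^sup>2 = (1 / \<kappa>)\<^sup>2 * (1 / (real (Suc k))\<^sup>2)"
          by (simp add: power_divide power_mult_distrib add.commute)
        then show ?thesis using Suc \<phi>_u by (simp add: d_def E_def)
      qed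
      finally show ?thesis using Suc by simp
    qed
  qed (use d0 \<phi>_u in auto)
  have "summable (\<lambda>i. E / \<phi> u * (1 / (real (Suc i))\<^sup>2))"
    by (intro summable_mult) (subst summable_Suc_iff, rule inverse_power_summable[of 2, unfolded inverse_eq_divide], simp)
  then have "summable (\<lambda>i. d (Suc i))" by (simp add: d_def)
  then have sd: "summable d" by (simp add: summable_Suc_iff)
  have dF_lip: "dF n y \<le> exp (suminf d * \<bar>y - y'\<bar>) * dF n y'"
    if y: "l \<le> y" "y \<le> u" and y': "l \<le> y'" "y' \<le> u" for y y' n
  proof -
    have "dF n y \<le> (\<Prod>i<n. exp (d i * \<bar>y - y'\<bar>) * \<phi> ((F ^^ i) y'))"
      unfolding dF_def
      using factor[OF y y'] iter_in[of y] y lu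
      by (intro prod_mono conjI less_imp_le[OF \<phi>_pos]) (auto intro: less_imp_le)
    also have "\<dots> = exp ((\<Sum>i<n. d i) * \<bar>y - y'\<bar>) * dF n y'"
      by (simp add: prod.distrib dF_def exp_sum sum_distrib_right)
    also have "\<dots> \<le> exp (suminf d * \<bar>y - y'\<bar>) * dF n y'"
      using sum_le_suminf[OF sd, of "{..<n}"] d0 dF_pos[of y' n] y' lu
      by (intro mult_right_mono) (auto intro: mult_right_mono)
    finally show ?thesis .
  qed
  \<comment> \<open>the contribution of the last factor of \<open>wt\<close>\<close>
  define S2 where "S2 = B * B * G / (c * \<phi> u * \<kappa>)"
  have S20: "0 \<le> S2" using G_pos c \<phi>_u \<kappa>_pos by (simp add: S2_def)
  have wt_lip: "wt k y \<le> exp ((suminf d + S2) * \<bar>y - y'\<bar>) * wt k y'"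
    if y: "l \<le> y" "y \<le> u" and y': "l \<le> y'" "y' \<le> u" for y y' k
  proof -
    let ?z = "(F ^^ Suc k) y" and ?z' = "(F ^^ Suc k) y'"
    have "1 - \<phi> ?z \<le> exp (S2 * \<bar>y - y'\<bar>) * (1 - \<phi> ?z')"
    proof (rule le_exp_mult[where m = "c * x (Suc k) powr \<beta>"])
      have "c * x (Suc k) powr \<beta> \<le> c * ?z' powr \<beta>"
        using c x_pos[of "Suc k"] \<beta> iter_ge_x[OF y', of "Suc k"] by (intro mult_left_mono powr_mono2) auto
      also have "\<dots> \<le> 1 - \<phi> ?z'"
        using iter_in[of y' "Suc k"] y' lu by (intro lower) auto
      finally show "c * x (Suc k) powr \<beta> \<le> 1 - \<phi> ?z'" .
      have "x (Suc k) powr (\<beta> - 1) = x (Suc k) powr \<beta> / x (Suc k)"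
        using x_pos[of "Suc k"] by (simp add: powr_diff)
      moreover have "x k powr (1 + \<beta>) = x k * x k powr \<beta>" using x_pos[of k] by (simp add: powr_add)
      ultimately have e: "x (Suc k) powr (\<beta> - 1) * x k powr (1 + \<beta>)
          = x (Suc k) powr \<beta> * (x k / x (Suc k)) * x k powr \<beta>" by simp
      have q: "x k / x (Suc k) \<le> 1 / \<phi> u"
        using x_le_Suc[of k] x_pos[of "Suc k"] \<phi>_u by (simp add: field_simps)
      have p: "x k powr \<beta> \<le> 1 / \<kappa>"
      proof -
        have "1 / (\<kappa> * (real k + 1)) \<le> 1 / (\<kappa> * 1)"
          using \<kappa>_pos by (intro divide_left_mono mult_left_mono) auto
        then show ?thesis using x_powr_le[of k] by simp
      qed
      have m: "x (Suc k) powr (\<beta> - 1) * x k powr (1 + \<beta>) \<le> x (Suc k) powr \<beta> * (1 / \<phi> u) * (1 / \<kappa>)"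
        unfolding e using x_pos[of k] x_pos[of "Suc k"] \<phi>_u
        by (intro mult_mono mult_left_mono q p) (auto intro: divide_nonneg_nonneg less_imp_le)
      have "\<bar>(1 - \<phi> ?z) - (1 - \<phi> ?z')\<bar> \<le> B * x (Suc k) powr (\<beta> - 1) * (G * (B * x k powr (1 + \<beta>)) * \<bar>y - y'\<bar>)"
        using \<phi>_iter_lipschitz[OF y y', of k] by (simp add: abs_minus_commute)
      also have "\<dots> = B * B * G * (x (Suc k) powr (\<beta> - 1) * x k powr (1 + \<beta>)) * \<bar>y - y'\<bar>"
        by (simp add: mult_ac)
      also have "\<dots> \<le> B * B * G * (x (Suc k) powr \<beta> * (1 / \<phi> u) * (1 / \<kappa>)) * \<bar>y - y'\<bar>"
        using m G_pos by (intro mult_right_mono mult_left_mono) auto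
      also have "\<dots> = S2 * \<bar>y - y'\<bar> * (c * x (Suc k) powr \<beta>)"
        using c by (simp add: S2_def)
      finally show "\<bar>(1 - \<phi> ?z) - (1 - \<phi> ?z')\<bar> \<le> S2 * \<bar>y - y'\<bar> * (c * x (Suc k) powr \<beta>)" .
    qed (use S20 c in auto)
    then have "wt k y \<le> (exp (suminf d * \<bar>y - y'\<bar>) * dF (Suc k) y') * (exp (S2 * \<bar>y - y'\<bar>) * (1 - \<phi> ?z'))"
      unfolding wt_def using dF_lip[OF y y', of "Suc k"] dF_pos[of y' "Suc k"] iter_in[of y "Suc k"] y y' lu
      by (intro mult_mono) (auto simp: \<phi>_le_1)
    also have "\<dots> = exp ((suminf d + S2) * \<bar>y - y'\<bar>) * wt k y'"
      by (simp add: wt_def distrib_right exp_add)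
    finally show ?thesis .
  qed
  have "dF (Suc k) y \<le> exp ((suminf d + S2) * \<bar>y - y'\<bar>) * dF (Suc k) y'"
    if y: "l \<le> y" "y \<le> u" and y': "l \<le> y'" "y' \<le> u" for y y' k
  proof -
    have "exp (suminf d * \<bar>y - y'\<bar>) \<le> exp ((suminf d + S2) * \<bar>y - y'\<bar>)"
      using S20 by (simp add: mult_right_mono)
    then show ?thesis
      using dF_lip[OF y y', of "Suc k"] dF_pos[of y' "Suc k"] y' lu
        mult_right_mono[of _ _ "dF (Suc k) y'"] by (smt (verit))
  qed
  then show ?thesis
    using wt_lip S20 suminf_nonneg[OF sd d0] by (intro exI[of _ "suminf d + S2"]) auto
qed

end

context neutral_branch
begin

lemma iter_continuous: "continuous_on {l..u} (F ^^ n)"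
proof (rule DERIV_continuous_on)
  fix y assume "y \<in> {l..u}"
  then show "((F ^^ n) has_real_derivative dF n y) (at y within {l..u})"
    using lu by (intro has_field_derivative_at_within[OF iter_deriv]) auto
qed

lemma \<phi>_iter_continuous: "continuous_on {l..u} (\<lambda>y. \<phi> ((F ^^ n) y))"
proof (rule continuous_on_compose2[OF cont iter_continuous])
  show "(F ^^ n) ` {l..u} \<subseteq> {0..1}"
  proof (rule image_subsetI)
    fix y assume "y \<in> {l..u}"
    then show "(F ^^ n) y \<in> {0..1}" using iter_in[of y n] lu by simp
  qed
qed

lemma dF_continuous: "continuous_on {l..u} (dF n)"
  unfolding dF_def[abs_def] by (intro continuous_on_prod \<phi>_iter_continuous)

lemma wt_continuous: "continuous_on {l..u} (wt k)"
  unfolding wt_def[abs_def] by (intro continuous_intros dF_continuous \<phi>_iter_continuous)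

lemma wt_le:
  assumes "l \<le> y" "y \<le> u"
  shows "wt k y \<le> \<phi> y" "wt k y \<le> G * gap k"
proof -
  have s: "summable (\<lambda>k. wt k y)" using wt_sums[OF assms] by (rule sums_summable)
  have "sum (\<lambda>k. wt k y) {k} \<le> (\<Sum>k. wt k y)"
    using wt_pos[OF assms] by (intro sum_le_suminf s) (auto intro: less_imp_le)
  then show "wt k y \<le> \<phi> y" using wt_sums[OF assms] by (simp add: sums_iff)
  have "wt k y \<le> dF (Suc k) y * 1"
    unfolding wt_def using dF_pos[of y "Suc k"] \<phi>_pos[of "(F ^^ Suc k) y"] iter_in[of y "Suc k"] assms lu
    by (intro mult_left_mono) auto
  then show "wt k y \<le> G * gap k" using dF_le_gap[OF assms, of k] by simp
qed

lemma gap_moment: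
  assumes "\<beta> \<le> \<alpha>" "1 < q" "q < 1 / \<alpha>"
  shows "summable (\<lambda>k. (real k + 1) powr q * gap k)"
proof -
  let ?A = "B * (1 / \<kappa>) powr (1 + 1 / \<beta>)"
  have "summable (\<lambda>k. real (Suc k) powr (q - (1 + 1 / \<alpha>)))"
    using assms by (subst summable_Suc_iff[of "\<lambda>k. real k powr (q - (1 + 1 / \<alpha>))"]) (simp add: summable_real_powr_iff)
  then have s: "summable (\<lambda>k. ?A * real (Suc k) powr (q - (1 + 1 / \<alpha>)))" by (rule summable_mult)
  show ?thesis
  proof (rule summable_comparison_test'[OF s, of 0])
    fix k
    have e: "real k + 1 = real (Suc k)" by simp
    have "(real k + 1) powr q * gap k \<le> (real k + 1) powr q * (?A * (real k + 1) powr (- (1 + 1 / \<beta>)))"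
      by (intro mult_left_mono gap_le) simp
    also have "\<dots> \<le> (real k + 1) powr q * (?A * (real k + 1) powr (- (1 + 1 / \<alpha>)))"
      using assms \<beta> B by (intro mult_left_mono powr_mono) (auto simp: frac_le)
    also have "\<dots> = ?A * ((real k + 1) powr q * (real k + 1) powr (- (1 + 1 / \<alpha>)))" by simp
    also have "(real k + 1) powr q * (real k + 1) powr (- (1 + 1 / \<alpha>)) = real (Suc k) powr (q - (1 + 1 / \<alpha>))"
      unfolding e powr_add[symmetric] by (simp only: diff_conv_add_uminus)
    finally show "norm ((real k + 1) powr q * gap k) \<le> ?A * real (Suc k) powr (q - (1 + 1 / \<alpha>))"
      using gap_pos[of k] by simp
  qed
qed

text \<open>Summation by parts. The difference \<open>gap k - gap (Suc k)\<close> will be the measure of a letter of level \<open>k\<close>, and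
the weight its value of \<open>Y\<close>.\<close>

lemma weighted_gaps_le:
  "(\<Sum>k<n. real (k + 1 - m) * (gap k - gap (Suc k))) \<le> x m - x (max n m) - real (n - m) * gap n"
proof (induction n)
  case (Suc n)
  have "(\<Sum>k<Suc n. real (k + 1 - m) * (gap k - gap (Suc k)))
      \<le> x m - x (max n m) - real (n - m) * gap n + real (Suc n - m) * (gap n - gap (Suc n))"
    using Suc by simp
  also have "\<dots> \<le> x m - x (max (Suc n) m) - real (Suc n - m) * gap (Suc n)"
  proof (cases "m \<le> n")
    case True
    then have "real (Suc n - m) = real (n - m) + 1" by (simp add: of_nat_diff)
    moreover have "max n m = n" "max (Suc n) m = Suc n" using True by auto
    ultimately show ?thesis by (simp add: algebra_simps gap_def)
  next
    case False
    then show ?thesis by (simp add: max_def)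
  qed
  finally show ?case .
qed simp

end

section \<open>End points of a cut function\<close>

text \<open>Close to 0 the bounds come from integrating those on the derivative. On the rest of the interval \<open>1 - \<psi>\<close>
is bounded below by monotonicity and \<open>\<psi>'\<close> is bounded by compactness, while all the powers of \<open>t\<close> are bounded above and
below.\<close>

lemma end_point_bounds:
  fixes \<psi> \<psi>' :: "real \<Rightarrow> real" and \<beta> k u :: real
  assumes \<beta>: "0 < \<beta>" "\<beta> < 1" and k: "0 < k" and u: "0 < u" "u < 1"
    and cont: "continuous_on {0..1} \<psi>" and rng: "\<And>t. t \<in> {0..1} \<Longrightarrow> 0 \<le> \<psi> t"
    and anti: "\<And>s t. 0 \<le> s \<Longrightarrow> s \<le> t \<Longrightarrow> t \<le> 1 \<Longrightarrow> \<psi> t \<le> \<psi> s"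
    and \<psi>_0: "\<psi> 0 = 1"
    and deriv: "\<And>t. 0 < t \<Longrightarrow> t < 1 \<Longrightarrow> (\<psi> has_real_derivative \<psi>' t) (at t)"
    and cont': "continuous_on {0<..<1} \<psi>'"
    and near: "\<forall>\<^sub>F t in at_right 0. \<bar>\<psi>' t + k * \<beta> * t powr (\<beta> - 1)\<bar> \<le> k / 2 * \<beta> * t powr (\<beta> - 1)"
  shows "\<exists>c B. 0 < c \<and> 0 \<le> B \<and> (\<forall>t. 0 < t \<longrightarrow> t \<le> u \<longrightarrow> c * t powr \<beta> \<le> 1 - \<psi> t) \<and>
    (\<forall>t. 0 < t \<longrightarrow> t \<le> u \<longrightarrow> 1 - \<psi> t \<le> B * t powr \<beta>) \<and>
    (\<forall>s t. 0 < s \<longrightarrow> s \<le> t \<longrightarrow> t \<le> u \<longrightarrow> \<psi> s - \<psi> t \<le> B * s powr (\<beta> - 1) * (t - s))"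
proof -
  obtain e0 where e0: "0 < e0"
    and ne: "\<And>t. 0 < t \<Longrightarrow> t < e0 \<Longrightarrow> \<bar>\<psi>' t + k * \<beta> * t powr (\<beta> - 1)\<bar> \<le> k / 2 * \<beta> * t powr (\<beta> - 1)"
    using near unfolding eventually_at_right_field by auto
  \<comment> \<open>half of the minimum, so that the bounds on the derivative hold at \<open>e\<close> itself\<close>
  define e where "e = min e0 u / 2"
  have e: "0 < e" "e < e0" "e < u" "e < 1" using e0 u by (auto simp: e_def)
  have pow_deriv: "((\<lambda>s. m * s powr \<beta>) has_real_derivative m * (\<beta> * t powr (\<beta> - 1))) (at t)"
    if "0 < t" for t m :: real
    using that by (auto intro!: derivative_eq_intros)
  have pow_cont: "continuous_on {0..t} (\<lambda>s::real. m * s powr \<beta>)" for t m :: real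
    using \<beta> by (intro continuous_intros continuous_on_powr') auto
  have low: "k / 2 * t powr \<beta> \<le> 1 - \<psi> t" and up: "1 - \<psi> t \<le> 3 / 2 * k * t powr \<beta>"
    if t: "0 < t" "t \<le> e" for t
  proof -
    have ct: "continuous_on {0..t} \<psi>" by (rule continuous_on_subset[OF cont]) (use t e in auto)
    have "\<psi> 0 + k / 2 * 0 powr \<beta> \<ge> \<psi> t + k / 2 * t powr \<beta>"
    proof (rule DERIV_nonpos_imp_decreasing_open[where f = "\<lambda>t. \<psi> t + k / 2 * t powr \<beta>"])
      fix s assume s: "0 < s" "s < t"
      show "\<exists>y. ((\<lambda>t. \<psi> t + k / 2 * t powr \<beta>) has_real_derivative y) (at s) \<and> y \<le> 0"
      proof (intro exI[of _ "\<psi>' s + k / 2 * (\<beta> * s powr (\<beta> - 1))"] conjI DERIV_add deriv pow_deriv)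
        define p where "p = k * (\<beta> * s powr (\<beta> - 1))"
        have "\<bar>\<psi>' s + p\<bar> \<le> p / 2" using ne[of s] s t e by (simp add: p_def mult.assoc)
        then have "\<psi>' s + p / 2 \<le> 0 \<and> 0 \<le> \<psi>' s + 3 / 2 * p" by linarith
        then show "\<psi>' s + k / 2 * (\<beta> * s powr (\<beta> - 1)) \<le> 0" by (simp add: p_def)
      qed (use s t e in auto)
    qed (use t in simp, intro continuous_on_add ct pow_cont)
    then show "k / 2 * t powr \<beta> \<le> 1 - \<psi> t" using \<psi>_0 by simp
    have "\<psi> 0 + 3 / 2 * k * 0 powr \<beta> \<le> \<psi> t + 3 / 2 * k * t powr \<beta>"
    proof (rule DERIV_nonneg_imp_increasing_open[where f = "\<lambda>t. \<psi> t + 3 / 2 * k * t powr \<beta>"])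
      fix s assume s: "0 < s" "s < t"
      show "\<exists>y. ((\<lambda>t. \<psi> t + 3 / 2 * k * t powr \<beta>) has_real_derivative y) (at s) \<and> 0 \<le> y"
      proof (intro exI[of _ "\<psi>' s + 3 / 2 * k * (\<beta> * s powr (\<beta> - 1))"] conjI DERIV_add deriv pow_deriv)
        define p where "p = k * (\<beta> * s powr (\<beta> - 1))"
        have "\<bar>\<psi>' s + p\<bar> \<le> p / 2" using ne[of s] s t e by (simp add: p_def mult.assoc)
        then have "\<psi>' s + p / 2 \<le> 0 \<and> 0 \<le> \<psi>' s + 3 / 2 * p" by linarith
        then show "0 \<le> \<psi>' s + 3 / 2 * k * (\<beta> * s powr (\<beta> - 1))" by (simp add: p_def)
      qed (use s t e in auto)
    qed (use t in simp, intro continuous_on_add ct pow_cont)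
    then show "1 - \<psi> t \<le> 3 / 2 * k * t powr \<beta>" using \<psi>_0 by simp
  qed
  obtain D where D: "\<And>t. t \<in> {e..u} \<Longrightarrow> \<bar>\<psi>' t\<bar> \<le> D"
  proof -
    have "compact (\<psi>' ` {e..u})"
      by (rule compact_continuous_image[OF continuous_on_subset[OF cont']]) (use e u in auto)
    then have "bounded (\<psi>' ` {e..u})" by (rule compact_imp_bounded)
    then obtain D where "\<forall>z\<in>\<psi>' ` {e..u}. norm z \<le> D" unfolding bounded_iff by blast
    then show ?thesis using that[of D] by auto
  qed
  define c where "c = k / 2 * e powr \<beta>"
  define B where "B = Max {3 / 2 * k, 1 / e powr \<beta>, D}"
  have c0: "0 < c" using k e by (simp add: c_def)
  have B: "3 / 2 * k \<le> B" "1 / e powr \<beta> \<le> B" "D \<le> B" by (simp_all add: B_def)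
  have B0: "0 \<le> B" using B(1) k by linarith
  have pw1: "t powr \<beta> \<le> 1" if "0 < t" "t \<le> 1" for t
    using powr_mono2[of \<beta> t 1] that \<beta> by simp
  have "c * t powr \<beta> \<le> 1 - \<psi> t" if t: "0 < t" "t \<le> u" for t
  proof (cases "t \<le> e")
    case True
    have "c * t powr \<beta> \<le> k / 2 * 1 * t powr \<beta>"
      unfolding c_def using k pw1[of e] e by (intro mult_right_mono mult_left_mono) auto
    then show ?thesis using low[OF t(1) True] by simp
  next
    case False
    have "c * t powr \<beta> \<le> c * 1" using c0 pw1[of t] t u by (intro mult_left_mono) auto
    also have "\<dots> \<le> 1 - \<psi> e" using low[of e] e by (simp add: c_def)
    also have "\<dots> \<le> 1 - \<psi> t" using anti[of e t] False e t u by simp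
    finally show ?thesis .
  qed
  moreover have "1 - \<psi> t \<le> B * t powr \<beta>" if t: "0 < t" "t \<le> u" for t
  proof (cases "t \<le> e")
    case True
    have "3 / 2 * k * t powr \<beta> \<le> B * t powr \<beta>" using B by (intro mult_right_mono) auto
    then show ?thesis using up[OF t(1) True] by simp
  next
    case False
    have "1 - \<psi> t \<le> 1" using rng[of t] t u by simp
    also have "1 = 1 / e powr \<beta> * e powr \<beta>" using e by simp
    also have "\<dots> \<le> B * t powr \<beta>"
      using False e \<beta> B B0 by (intro mult_mono powr_mono2) auto
    finally show ?thesis .
  qed
  moreover have "\<psi> s - \<psi> t \<le> B * s powr (\<beta> - 1) * (t - s)" if s: "0 < s" "s \<le> t" "t \<le> u" for s t
  proof (cases "s = t")
    case False
    then have st: "s < t" using s by simp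
    have "\<exists>z>s. z < t \<and> \<psi> t - \<psi> s = (t - s) * \<psi>' z"
      using s st u by (intro MVT2 deriv) auto
    then obtain z where z: "s < z" "z < t" "\<psi> t - \<psi> s = (t - s) * \<psi>' z" by blast
    have "- \<psi>' z \<le> B * z powr (\<beta> - 1)"
    proof (cases "z \<le> e")
      case True
      have "- \<psi>' z \<le> 3 / 2 * k * \<beta> * z powr (\<beta> - 1)"
      proof -
        define p where "p = k * \<beta> * z powr (\<beta> - 1)"
        have "\<bar>\<psi>' z + p\<bar> \<le> p / 2" using ne[of z] True z s e by (simp add: p_def)
        then have "- \<psi>' z \<le> 3 / 2 * p" by linarith
        then show ?thesis by (simp add: p_def)
      qed
      also have "\<dots> \<le> B * z powr (\<beta> - 1)"
      proof -
        have "3 / 2 * k * \<beta> \<le> 3 / 2 * k * 1" using k \<beta> by (intro mult_left_mono) auto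
        also have "\<dots> \<le> B" using B(1) by simp
        finally show ?thesis by (intro mult_right_mono) auto
      qed
      finally show ?thesis .
    next
      case False
      have "- \<psi>' z \<le> D" using D[of z] False z s by (auto simp: abs_le_iff)
      also have "\<dots> \<le> B * 1" using B by simp
      also have "\<dots> \<le> B * z powr (\<beta> - 1)"
      proof -
        have "1 powr (\<beta> - 1) \<le> z powr (\<beta> - 1)" using z s u \<beta> by (intro powr_mono2') auto
        then show ?thesis using B0 by (intro mult_left_mono) auto
      qed
      finally show ?thesis .
    qed
    also have "\<dots> \<le> B * s powr (\<beta> - 1)"
      using B0 z s \<beta> by (intro mult_left_mono powr_mono2') auto
    finally have "- \<psi>' z * (t - s) \<le> B * s powr (\<beta> - 1) * (t - s)"
      using st by (intro mult_right_mono) auto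
    then show ?thesis using z(3) by (simp add: algebra_simps)
  qed simp
  ultimately show ?thesis using c0 B0 by blast
qed

lemma end_point_expansion:
  fixes \<psi> g g' :: "real \<Rightarrow> real" and \<beta> k :: real
  assumes \<beta>: "0 < \<beta>" and k: "0 < k"
    and C1: "\<psi> C1_differentiable_on {0<..<1}"
    and g: "\<And>t. 0 < t \<Longrightarrow> t < 1 \<Longrightarrow> (g has_real_derivative g' t) (at t)"
    and small: "g' \<in> o[at_right 0](\<lambda>t. t powr (\<beta> - 1))"
    and expansion: "\<forall>\<^sub>F t in at_right 0. \<psi> t = 1 - k * t powr \<beta> + g t"
  obtains \<psi>' where "\<And>t. 0 < t \<Longrightarrow> t < 1 \<Longrightarrow> (\<psi> has_real_derivative \<psi>' t) (at t)"
    "continuous_on {0<..<1} \<psi>'"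
    "\<forall>\<^sub>F t in at_right 0. \<bar>\<psi>' t + k * \<beta> * t powr (\<beta> - 1)\<bar> \<le> k / 2 * \<beta> * t powr (\<beta> - 1)"
proof -
  obtain \<psi>' where d: "\<And>t. t \<in> {0<..<1} \<Longrightarrow> (\<psi> has_vector_derivative \<psi>' t) (at t)"
    and c: "continuous_on {0<..<1} \<psi>'"
    using C1 unfolding C1_differentiable_on_def by blast
  have d': "(\<psi> has_real_derivative \<psi>' t) (at t)" if "0 < t" "t < 1" for t
    using d[of t] that by (simp add: has_real_derivative_iff_has_vector_derivative)
  obtain e0 where e0: "0 < e0" and ex: "\<And>t. 0 < t \<Longrightarrow> t < e0 \<Longrightarrow> \<psi> t = 1 - k * t powr \<beta> + g t"
    using expansion unfolding eventually_at_right_field by auto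
  have eq: "\<psi>' t = - (k * \<beta> * t powr (\<beta> - 1)) + g' t" if t: "0 < t" "t < min e0 1" for t
  proof (rule DERIV_unique)
    show "(\<psi> has_real_derivative \<psi>' t) (at t)" using t by (intro d') auto
    have "((\<lambda>t. 1 - k * t powr \<beta> + g t) has_real_derivative - (k * \<beta> * t powr (\<beta> - 1)) + g' t) (at t)"
      using t g[of t] by (auto intro!: derivative_eq_intros)
    then show "(\<psi> has_real_derivative - (k * \<beta> * t powr (\<beta> - 1)) + g' t) (at t)"
      by (rule has_field_derivative_transform_within_open[where S = "{0<..<min e0 1}"]) (use t ex in auto)
  qed
  have "\<forall>\<^sub>F t in at_right 0. norm (g' t) \<le> k / 2 * \<beta> * norm (t powr (\<beta> - 1))"
    using landau_o.smallD[OF small, of "k / 2 * \<beta>"] k \<beta> by simp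
  moreover have "\<forall>\<^sub>F t in at_right 0. 0 < t \<and> t < min e0 1"
    using e0 by (auto simp: eventually_at_right_field intro!: exI[of _ "min e0 1"])
  ultimately have "\<forall>\<^sub>F t in at_right 0. \<bar>\<psi>' t + k * \<beta> * t powr (\<beta> - 1)\<bar> \<le> k / 2 * \<beta> * t powr (\<beta> - 1)"
    by eventually_elim (simp add: eq)
  then show ?thesis using that d' c by blast
qed

lemma C1_differentiable_DERIV_deriv:
  fixes g :: "real \<Rightarrow> real"
  assumes "g C1_differentiable_on {0<..<1::real}" "0 < t" "t < 1"
  shows "(g has_real_derivative deriv g t) (at t)"
proof -
  obtain D where "(g has_vector_derivative D t) (at t)"
    using assms unfolding C1_differentiable_on_def by fastforce
  then have "(g has_real_derivative D t) (at t)"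
    by (simp add: has_real_derivative_iff_has_vector_derivative)
  then show ?thesis using DERIV_imp_deriv by metis
qed

lemma C1_differentiable_reflect:
  fixes \<phi> :: "real \<Rightarrow> real"
  assumes "\<phi> C1_differentiable_on {0<..<1::real}"
  shows "(\<lambda>t. 1 - \<phi> (1 - t)) C1_differentiable_on {0<..<1::real}"
proof -
  obtain D where D: "\<And>t. t \<in> {0<..<1} \<Longrightarrow> (\<phi> has_vector_derivative D t) (at t)"
    and c: "continuous_on {0<..<1} D"
    using assms unfolding C1_differentiable_on_def by blast
  have "((\<lambda>t. 1 - \<phi> (1 - t)) has_vector_derivative D (1 - t)) (at t)" if "t \<in> {0<..<1}" for t
  proof -
    have "(\<phi> has_real_derivative D (1 - t)) (at (1 - t))"
      using D[of "1 - t"] that by (simp add: has_real_derivative_iff_has_vector_derivative)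
    moreover have "((\<lambda>t. 1 - t) has_real_derivative - 1) (at t)" by (auto intro!: derivative_eq_intros)
    ultimately have "((\<lambda>t. \<phi> (1 - t)) has_real_derivative D (1 - t) * - 1) (at t)"
      by (rule DERIV_chain2)
    then have "((\<lambda>t. 1 - \<phi> (1 - t)) has_real_derivative 0 - D (1 - t) * - 1) (at t)"
      by (intro DERIV_diff DERIV_const)
    then show ?thesis by (simp add: has_real_derivative_iff_has_vector_derivative)
  qed
  moreover have "continuous_on {0<..<1} (\<lambda>t. D (1 - t))"
    by (rule continuous_on_compose2[OF c]) (auto intro!: continuous_intros)
  ultimately show ?thesis unfolding C1_differentiable_on_def by (intro exI[of _ "\<lambda>t. D (1 - t)"]) auto
qed

text \<open>The expansion at 1, read for the function \<open>t \<mapsto> 1 - \<phi> (1 - t)\<close>, has the form of the expansion at 0 with the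
remainder \<open>- g\<^sub>1\<close>, so both ends are instances of the same two lemmas.\<close>

lemma cut_function_ends:
  assumes cut: "cut_function \<alpha> \<phi>" and \<alpha>: "0 < \<alpha>" "\<alpha> < 1" and uv: "0 < u" "u < 1" "0 < v" "v < 1"
  obtains c B \<beta> c' B' where
    "continuous_on {0..1} \<phi>" "\<And>s t. 0 \<le> s \<Longrightarrow> s \<le> t \<Longrightarrow> t \<le> 1 \<Longrightarrow> \<phi> t \<le> \<phi> s"
    "\<And>t. 0 \<le> t \<Longrightarrow> t \<le> 1 \<Longrightarrow> 0 \<le> \<phi> t \<and> \<phi> t \<le> 1" "\<phi> 0 = 1" "\<phi> 1 = 0"
    "0 < c" "0 \<le> B" "\<And>t. 0 < t \<Longrightarrow> t \<le> u \<Longrightarrow> c * t powr \<alpha> \<le> 1 - \<phi> t"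
    "\<And>t. 0 < t \<Longrightarrow> t \<le> u \<Longrightarrow> 1 - \<phi> t \<le> B * t powr \<alpha>"
    "\<And>s t. 0 < s \<Longrightarrow> s \<le> t \<Longrightarrow> t \<le> u \<Longrightarrow> \<phi> s - \<phi> t \<le> B * s powr (\<alpha> - 1) * (t - s)"
    "0 < \<beta>" "\<beta> \<le> \<alpha>"
    "0 < c'" "0 \<le> B'" "\<And>t. 0 < t \<Longrightarrow> t \<le> v \<Longrightarrow> c' * t powr \<beta> \<le> \<phi> (1 - t)"
    "\<And>t. 0 < t \<Longrightarrow> t \<le> v \<Longrightarrow> \<phi> (1 - t) \<le> B' * t powr \<beta>"
    "\<And>s t. 0 < s \<Longrightarrow> s \<le> t \<Longrightarrow> t \<le> v \<Longrightarrow> \<phi> (1 - t) - \<phi> (1 - s) \<le> B' * s powr (\<beta> - 1) * (t - s)"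
proof -
  have rng: "0 \<le> \<phi> t \<and> \<phi> t \<le> 1" if "0 \<le> t" "t \<le> 1" for t
    using cut that by (auto simp: cut_function_def)
  have cont: "continuous_on {0..1} \<phi>" and C1: "\<phi> C1_differentiable_on {0<..<1}" and \<phi>_1: "\<phi> 1 = 0"
    using cut by (auto simp: cut_function_def)
  have anti: "\<phi> t \<le> \<phi> s" if "0 \<le> s" "s \<le> t" "t \<le> 1" for s t
    using cut that by (auto simp: cut_function_def monotone_on_def)
  obtain c\<^sub>0 g\<^sub>0 where c\<^sub>0: "0 < c\<^sub>0" and g\<^sub>0: "g\<^sub>0 C1_differentiable_on {0<..<1}" "(g\<^sub>0 \<longlongrightarrow> 0) (at_right 0)"
      "deriv g\<^sub>0 \<in> o[at_right 0](\<lambda>t. t powr (\<alpha> - 1))"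
      "\<forall>\<^sub>F t in at_right 0. \<phi> t = 1 - c\<^sub>0 * t powr \<alpha> + g\<^sub>0 t"
    using cut unfolding cut_function_def by blast
  obtain c\<^sub>1 \<beta> g\<^sub>1 where c\<^sub>1: "0 < c\<^sub>1" and \<beta>: "0 < \<beta>" "\<beta> \<le> \<alpha>" and g\<^sub>1: "g\<^sub>1 C1_differentiable_on {0<..<1}"
      "deriv g\<^sub>1 \<in> o[at_right 0](\<lambda>s. s powr (\<beta> - 1))"
      "\<forall>\<^sub>F t in at_left 1. \<phi> t = c\<^sub>1 * (1 - t) powr \<beta> + g\<^sub>1 (1 - t)"
    using cut unfolding cut_function_def by blast
  have \<phi>_0: "\<phi> 0 = 1"
  proof (rule tendsto_unique[of "at_right (0::real)"])
    have "(\<phi> \<longlongrightarrow> \<phi> 0) (at 0 within {0..1})" using cont by (auto simp: continuous_on_def)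
    then show "(\<phi> \<longlongrightarrow> \<phi> 0) (at_right 0)" by (simp add: at_within_Icc_at_right)
    have "((\<lambda>t. t powr \<alpha>) \<longlongrightarrow> 0 powr \<alpha>) (at_right (0::real))"
    proof (rule tendsto_powr2)
      show "\<forall>\<^sub>F t in at_right (0::real). 0 \<le> t"
        unfolding eventually_at_right_field by (intro exI[of _ 1]) auto
    qed (use \<alpha> in auto)
    then have "((\<lambda>t. 1 - c\<^sub>0 * t powr \<alpha> + g\<^sub>0 t) \<longlongrightarrow> 1 - c\<^sub>0 * 0 powr \<alpha> + 0) (at_right 0)"
      by (intro tendsto_add tendsto_diff tendsto_mult tendsto_const g\<^sub>0(2))
    then show "(\<phi> \<longlongrightarrow> 1) (at_right 0)"
      using g\<^sub>0(4) by (subst tendsto_cong) auto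
  qed simp
  let ?\<psi> = "\<lambda>t. 1 - \<phi> (1 - t)"
  obtain \<phi>' where \<phi>': "\<And>t. 0 < t \<Longrightarrow> t < 1 \<Longrightarrow> (\<phi> has_real_derivative \<phi>' t) (at t)"
    "continuous_on {0<..<1} \<phi>'"
    "\<forall>\<^sub>F t in at_right 0. \<bar>\<phi>' t + c\<^sub>0 * \<alpha> * t powr (\<alpha> - 1)\<bar> \<le> c\<^sub>0 / 2 * \<alpha> * t powr (\<alpha> - 1)"
    by (rule end_point_expansion[OF \<alpha>(1) c\<^sub>0 C1 C1_differentiable_DERIV_deriv[OF g\<^sub>0(1)] g\<^sub>0(3,4)]) auto
  have "\<exists>c B. 0 < c \<and> 0 \<le> B \<and> (\<forall>t. 0 < t \<longrightarrow> t \<le> u \<longrightarrow> c * t powr \<alpha> \<le> 1 - \<phi> t) \<and>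
    (\<forall>t. 0 < t \<longrightarrow> t \<le> u \<longrightarrow> 1 - \<phi> t \<le> B * t powr \<alpha>) \<and>
    (\<forall>s t. 0 < s \<longrightarrow> s \<le> t \<longrightarrow> t \<le> u \<longrightarrow> \<phi> s - \<phi> t \<le> B * s powr (\<alpha> - 1) * (t - s))"
    by (rule end_point_bounds[OF \<alpha> c\<^sub>0 uv(1,2) cont _ anti \<phi>_0 \<phi>']) (use rng in auto)
  then obtain c B where 1: "0 < c" "0 \<le> B" "\<And>t. 0 < t \<Longrightarrow> t \<le> u \<Longrightarrow> c * t powr \<alpha> \<le> 1 - \<phi> t"
    "\<And>t. 0 < t \<Longrightarrow> t \<le> u \<Longrightarrow> 1 - \<phi> t \<le> B * t powr \<alpha>"
    "\<And>s t. 0 < s \<Longrightarrow> s \<le> t \<Longrightarrow> t \<le> u \<Longrightarrow> \<phi> s - \<phi> t \<le> B * s powr (\<alpha> - 1) * (t - s)" by blast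
  have dg: "((\<lambda>t. - g\<^sub>1 t) has_real_derivative - deriv g\<^sub>1 t) (at t)" if "0 < t" "t < 1" for t
    by (intro DERIV_minus C1_differentiable_DERIV_deriv[OF g\<^sub>1(1)] that)
  have og: "(\<lambda>t. - deriv g\<^sub>1 t) \<in> o[at_right 0](\<lambda>t. t powr (\<beta> - 1))" using g\<^sub>1(2) by simp
  have ex: "\<forall>\<^sub>F t in at_right 0. ?\<psi> t = 1 - c\<^sub>1 * t powr \<beta> + - g\<^sub>1 t"
  proof -
    obtain b where b: "b < 1" "\<And>y. b < y \<Longrightarrow> y < 1 \<Longrightarrow> \<phi> y = c\<^sub>1 * (1 - y) powr \<beta> + g\<^sub>1 (1 - y)"
      using g\<^sub>1(3) unfolding eventually_at_left_field by auto
    then show ?thesis unfolding eventually_at_right_field by (intro exI[of _ "1 - b"]) auto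
  qed
  obtain \<psi>' where \<psi>': "\<And>t. 0 < t \<Longrightarrow> t < 1 \<Longrightarrow> (?\<psi> has_real_derivative \<psi>' t) (at t)"
    "continuous_on {0<..<1} \<psi>'"
    "\<forall>\<^sub>F t in at_right 0. \<bar>\<psi>' t + c\<^sub>1 * \<beta> * t powr (\<beta> - 1)\<bar> \<le> c\<^sub>1 / 2 * \<beta> * t powr (\<beta> - 1)"
    by (rule end_point_expansion[OF \<beta>(1) c\<^sub>1 C1_differentiable_reflect[OF C1] dg og ex]) auto
  have \<beta>1: "\<beta> < 1" using \<beta> \<alpha> by simp
  have cont': "continuous_on {0..1} ?\<psi>"
    by (intro continuous_intros continuous_on_compose2[OF cont]) auto
  have anti': "?\<psi> t \<le> ?\<psi> s" if "0 \<le> s" "s \<le> t" "t \<le> 1" for s t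
    using anti[of "1 - t" "1 - s"] that by simp
  have "\<exists>c B. 0 < c \<and> 0 \<le> B \<and> (\<forall>t. 0 < t \<longrightarrow> t \<le> v \<longrightarrow> c * t powr \<beta> \<le> 1 - ?\<psi> t) \<and>
    (\<forall>t. 0 < t \<longrightarrow> t \<le> v \<longrightarrow> 1 - ?\<psi> t \<le> B * t powr \<beta>) \<and>
    (\<forall>s t. 0 < s \<longrightarrow> s \<le> t \<longrightarrow> t \<le> v \<longrightarrow> ?\<psi> s - ?\<psi> t \<le> B * s powr (\<beta> - 1) * (t - s))"
    by (rule end_point_bounds[OF \<beta>(1) \<beta>1 c\<^sub>1 uv(3,4) cont' _ anti' _ \<psi>'])
      (use rng \<phi>_1 in auto)
  then obtain c' B' where 2: "0 < c'" "0 \<le> B'" "\<And>t. 0 < t \<Longrightarrow> t \<le> v \<Longrightarrow> c' * t powr \<beta> \<le> \<phi> (1 - t)"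
    "\<And>t. 0 < t \<Longrightarrow> t \<le> v \<Longrightarrow> \<phi> (1 - t) \<le> B' * t powr \<beta>"
    "\<And>s t. 0 < s \<Longrightarrow> s \<le> t \<Longrightarrow> t \<le> v \<Longrightarrow> \<phi> (1 - t) - \<phi> (1 - s) \<le> B' * s powr (\<beta> - 1) * (t - s)"
    by auto
  show ?thesis by (rule that[OF cont anti rng \<phi>_0 \<phi>_1 1 \<beta> 2])
qed

section \<open>First return to the middle interval\<close>

lemma integral_reflect_unit:
  fixes g :: "real \<Rightarrow> real"
  assumes "0 \<le> s" "s \<le> 1" "continuous_on {0..1} g"
  shows "integral {0..s} (\<lambda>t. g (1 - t)) = integral {1 - s..1} g"
proof -
  have "g integrable_on {1 - s..1}"
    by (rule integrable_continuous_real) (rule continuous_on_subset[OF assms(3)], use assms in auto)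
  then have "(g has_integral integral {1 - s..1} g) (cbox (1 - s) 1)" by (simp add: integrable_integral)
  from has_integral_affinity[OF this, of "-1" 1]
  have "((\<lambda>t. g (1 - t)) has_integral integral {1 - s..1} g) ((\<lambda>x. 1 - x) ` {1 - s..1})"
    by simp
  moreover have "(\<lambda>x. 1 - x) ` {1 - s..1} = {0..s}"
  proof -
    have "y \<in> (\<lambda>x. 1 - x) ` {1 - s..1}" if "y \<in> {0..s}" for y
      using that by (intro image_eqI[of _ _ "1 - y"]) auto
    then show ?thesis by auto
  qed
  ultimately show ?thesis by (simp add: integral_unique)
qed

text \<open>The inverse branch at 0 is the sublocale \<open>L\<close>; the inverse branch at 1 becomes the sublocale \<open>R\<close> after
reflection at 1/2. The orbits of both are the partition points (\<open>L_x\<close>, \<open>R_x\<close>).\<close>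

locale two_branches =
  fixes \<phi> f :: "real \<Rightarrow> real" and \<alpha> \<beta> a c B c' B' :: real and x y :: "nat \<Rightarrow> real"
  assumes left: "neutral_branch \<phi> \<alpha> (x 0) (y 0) c B"
    and right: "neutral_branch (\<lambda>t. 1 - \<phi> (1 - t)) \<beta> (1 - y 0) (1 - x 0) c' B'"
    and \<beta>_le: "\<beta> \<le> \<alpha>"
    and a_def: "a = integral {0..1} \<phi>"
    and f_range: "\<And>z. 0 \<le> z \<Longrightarrow> z \<le> 1 \<Longrightarrow> 0 \<le> f z \<and> f z \<le> 1"
    and f_left: "\<And>z. 0 \<le> z \<Longrightarrow> z \<le> 1 \<Longrightarrow> z \<le> a \<Longrightarrow> z = integral {0..f z} \<phi>"
    and f_right: "\<And>z. 0 \<le> z \<Longrightarrow> z \<le> 1 \<Longrightarrow> a < z \<Longrightarrow> 1 - z = integral {f z..1} (\<lambda>t. 1 - \<phi> t)"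
    and partition: "partition_points a f x y"
begin

sublocale L: neutral_branch \<phi> \<alpha> "x 0" "y 0" c B
  by (rule left)

sublocale R: neutral_branch "\<lambda>t. 1 - \<phi> (1 - t)" \<beta> "1 - y 0" "1 - x 0" c' B'
  by (rule right)

lemma order: "0 < x 0" "x 0 < a" "a < y 0" "y 0 < 1"
  using partition by (auto simp: partition_points_def)

lemma \<phi>_1: "\<phi> 1 = 0"
  using R.\<phi>_0 by simp

lemma \<phi>_pos: "0 \<le> t \<Longrightarrow> t < 1 \<Longrightarrow> 0 < \<phi> t"
proof -
  assume t: "0 \<le> t" "t < 1"
  show "0 < \<phi> t"
  proof (cases "t \<le> y 0")
    case True
    then show ?thesis using t by (intro L.\<phi>_pos)
  next
    case False
    then have "0 < c' * (1 - t) powr \<beta>" using R.c t by simp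
    also have "\<dots> \<le> 1 - (1 - \<phi> (1 - (1 - t)))" using False t order by (intro R.lower) auto
    finally show ?thesis by simp
  qed
qed

lemma \<phi>_less_1: "0 < t \<Longrightarrow> t \<le> 1 \<Longrightarrow> \<phi> t < 1"
proof -
  assume t: "0 < t" "t \<le> 1"
  show "\<phi> t < 1"
  proof (cases "t \<le> y 0")
    case True
    have "0 < c * t powr \<alpha>" using L.c t by simp
    also have "\<dots> \<le> 1 - \<phi> t" using True t by (intro L.lower) auto
    finally show ?thesis by simp
  next
    case False
    have "0 < 1 - \<phi> (1 - (1 - t))" using False t order by (intro R.\<phi>_pos) auto
    then show ?thesis by simp
  qed
qed

lemma \<phi>_range: "0 \<le> t \<Longrightarrow> t \<le> 1 \<Longrightarrow> 0 \<le> \<phi> t \<and> \<phi> t \<le> 1"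
  using \<phi>_pos[of t] \<phi>_less_1[of t] L.\<phi>_0 \<phi>_1 by (cases "t = 0"; cases "t = 1") auto

definition F\<^sub>0 :: "real \<Rightarrow> real" where "F\<^sub>0 = L.F"

definition F\<^sub>1 :: "real \<Rightarrow> real" where "F\<^sub>1 w = 1 - R.F (1 - w)"

lemma F\<^sub>0_1: "F\<^sub>0 1 = a"
  by (simp add: F\<^sub>0_def L.F_def a_def)

lemma F\<^sub>0_0: "F\<^sub>0 0 = 0"
  by (simp add: F\<^sub>0_def L.F_0)

lemma integral_tail: "0 \<le> w \<Longrightarrow> w \<le> 1 \<Longrightarrow> integral {w..1} \<phi> = a - F\<^sub>0 w"
  using L.F_diff[of w 1] F\<^sub>0_1 by (simp add: F\<^sub>0_def)

lemma R_F_eq: "0 \<le> s \<Longrightarrow> s \<le> 1 \<Longrightarrow> R.F s = s - (a - F\<^sub>0 (1 - s))"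
proof -
  assume s: "0 \<le> s" "s \<le> 1"
  have i: "(\<lambda>t. \<phi> (1 - t)) integrable_on {0..s}"
    using s by (intro integrable_continuous_real continuous_on_compose2[OF L.cont] continuous_intros) auto
  have "R.F s = integral {0..s} (\<lambda>t. 1) - integral {0..s} (\<lambda>t. \<phi> (1 - t))"
    unfolding R.F_def by (rule integral_diff[OF _ i]) auto
  also have "integral {0..s} (\<lambda>t. \<phi> (1 - t)) = integral {1 - s..1} \<phi>"
    by (rule integral_reflect_unit[OF s L.cont])
  finally show ?thesis using s integral_tail[of "1 - s"] by simp
qed

text \<open>Equivalently \<open>F\<^sub>0 w + F\<^sub>1 w = a + w\<close>: the preimage of an interval has the same length as the interval.\<close>

lemma F\<^sub>1_eq: "0 \<le> w \<Longrightarrow> w \<le> 1 \<Longrightarrow> F\<^sub>1 w = a + w - F\<^sub>0 w"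
  by (simp add: F\<^sub>1_def R_F_eq)

lemma F\<^sub>1_0: "F\<^sub>1 0 = a" and F\<^sub>1_1: "F\<^sub>1 1 = 1"
  by (simp_all add: F\<^sub>1_eq F\<^sub>0_0 F\<^sub>0_1)

lemma F\<^sub>0_strict: "0 \<le> s \<Longrightarrow> s < t \<Longrightarrow> t \<le> 1 \<Longrightarrow> F\<^sub>0 s < F\<^sub>0 t"
proof -
  assume st: "0 \<le> s" "s < t" "t \<le> 1"
  let ?m = "(s + t) / 2"
  have "0 < \<phi> ?m * (?m - s)" using st by (intro mult_pos_pos \<phi>_pos) auto
  also have "\<dots> \<le> L.F ?m - L.F s" using st by (intro L.F_diff_bounds) auto
  finally have 1: "L.F s < L.F ?m" by simp
  have "0 \<le> \<phi> t * (t - ?m)" using st \<phi>_range[of t] by (intro mult_nonneg_nonneg) auto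
  also have "\<dots> \<le> L.F t - L.F ?m" using st by (intro L.F_diff_bounds) auto
  finally show ?thesis using 1 by (simp add: F\<^sub>0_def)
qed

lemma F\<^sub>1_strict: "0 \<le> s \<Longrightarrow> s < t \<Longrightarrow> t \<le> 1 \<Longrightarrow> F\<^sub>1 s < F\<^sub>1 t"
proof -
  assume st: "0 \<le> s" "s < t" "t \<le> 1"
  define m where "m = (s + t) / 2"
  have m: "s < m" "m < t" using st by (auto simp: m_def)
  have "L.F m - L.F s \<le> \<phi> s * (m - s)" using st m by (intro L.F_diff_bounds) auto
  also have "\<dots> \<le> 1 * (m - s)" using st m \<phi>_range[of s] by (intro mult_right_mono) auto
  finally have 1: "L.F m - L.F s \<le> m - s" by simp
  have "L.F t - L.F m \<le> \<phi> m * (t - m)" using st m by (intro L.F_diff_bounds) auto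
  also have "\<dots> < 1 * (t - m)" using st m by (intro mult_strict_right_mono \<phi>_less_1) auto
  finally have "L.F t - L.F s < t - s" using 1 by simp
  then show ?thesis using st by (simp add: F\<^sub>1_eq F\<^sub>0_def)
qed

lemma F\<^sub>0_f: "0 \<le> z \<Longrightarrow> z \<le> a \<Longrightarrow> F\<^sub>0 (f z) = z"
  using f_left[of z] order by (simp add: F\<^sub>0_def L.F_def)

lemma F\<^sub>1_f: "a < z \<Longrightarrow> z \<le> 1 \<Longrightarrow> F\<^sub>1 (f z) = z"
proof -
  assume z: "a < z" "z \<le> 1"
  have fz: "0 \<le> f z" "f z \<le> 1" using f_range[of z] z order by auto
  have i: "\<phi> integrable_on {f z..1}" using fz by (intro L.\<phi>_integrable) auto
  have "1 - z = integral {f z..1} (\<lambda>t. 1 - \<phi> t)" using f_right[of z] z order by simp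
  also have "\<dots> = integral {f z..1} (\<lambda>t. 1) - integral {f z..1} \<phi>"
    by (rule integral_diff[OF _ i]) auto
  finally show ?thesis using fz by (simp add: integral_tail F\<^sub>1_eq)
qed

lemma F\<^sub>0_range: "0 \<le> w \<Longrightarrow> w \<le> 1 \<Longrightarrow> 0 \<le> F\<^sub>0 w \<and> F\<^sub>0 w \<le> a"
  using F\<^sub>0_strict[of 0 w] F\<^sub>0_strict[of w 1] F\<^sub>0_0 F\<^sub>0_1 by (cases "w = 0"; cases "w = 1") auto

lemma F\<^sub>1_range: "0 \<le> w \<Longrightarrow> w \<le> 1 \<Longrightarrow> a \<le> F\<^sub>1 w \<and> F\<^sub>1 w \<le> 1"
  using F\<^sub>1_strict[of 0 w] F\<^sub>1_strict[of w 1] F\<^sub>1_0 F\<^sub>1_1 by (cases "w = 0"; cases "w = 1") auto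

lemma f_F\<^sub>0: "0 \<le> w \<Longrightarrow> w \<le> 1 \<Longrightarrow> f (F\<^sub>0 w) = w"
proof -
  assume w: "0 \<le> w" "w \<le> 1"
  have r: "0 \<le> F\<^sub>0 w" "F\<^sub>0 w \<le> a" using F\<^sub>0_range[OF w] by auto
  have "0 \<le> f (F\<^sub>0 w)" "f (F\<^sub>0 w) \<le> 1" using f_range[of "F\<^sub>0 w"] r order by auto
  moreover have "F\<^sub>0 (f (F\<^sub>0 w)) = F\<^sub>0 w" using r by (rule F\<^sub>0_f)
  ultimately show ?thesis using F\<^sub>0_strict[of "f (F\<^sub>0 w)" w] F\<^sub>0_strict[of w "f (F\<^sub>0 w)"] w
    by (cases "f (F\<^sub>0 w)" w rule: linorder_cases) auto
qed

lemma f_F\<^sub>1: "0 < w \<Longrightarrow> w \<le> 1 \<Longrightarrow> f (F\<^sub>1 w) = w"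
proof -
  assume w: "0 < w" "w \<le> 1"
  have r: "a < F\<^sub>1 w" "F\<^sub>1 w \<le> 1" using F\<^sub>1_strict[of 0 w] F\<^sub>1_range[of w] w F\<^sub>1_0 by auto
  have "0 \<le> f (F\<^sub>1 w)" "f (F\<^sub>1 w) \<le> 1" using f_range[of "F\<^sub>1 w"] r order by auto
  moreover have "F\<^sub>1 (f (F\<^sub>1 w)) = F\<^sub>1 w" using r by (rule F\<^sub>1_f)
  ultimately show ?thesis using F\<^sub>1_strict[of "f (F\<^sub>1 w)" w] F\<^sub>1_strict[of w "f (F\<^sub>1 w)"] w
    by (cases "f (F\<^sub>1 w)" w rule: linorder_cases) auto
qed

lemma F\<^sub>0_y0: "F\<^sub>0 (y 0) = x 0"
  by (simp add: F\<^sub>0_def L.F_def L.F_u)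

lemma F\<^sub>1_x0: "F\<^sub>1 (x 0) = y 0"
  by (simp add: F\<^sub>1_def R.F_def R.F_u)

lemma x_Suc: "x (Suc n) = F\<^sub>0 (x n)"
  using F\<^sub>0_f[of "x (Suc n)"] partition by (auto simp: partition_points_def less_imp_le)

lemma y_Suc: "y (Suc n) = F\<^sub>1 (y n)"
  using F\<^sub>1_f[of "y (Suc n)"] partition by (auto simp: partition_points_def less_imp_le)

lemma L_x: "L.x n = x n"
  by (induction n) (simp_all add: L.x_0 L.x_Suc x_Suc F\<^sub>0_def)

lemma R_x: "R.x n = 1 - y n"
  by (induction n) (simp_all add: R.x_0 R.x_Suc y_Suc F\<^sub>1_def)

lemma x_bounds: "0 < x n" "x (Suc n) < x n" "x n \<le> x 0"
  using L.x_pos[of n] L.x_decr[of n] L.x_antimono[of 0 n] by (simp_all add: L_x)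

lemma y_bounds: "y n < 1" "y n < y (Suc n)" "y 0 \<le> y n"
  using R.x_pos[of n] R.x_decr[of n] R.x_antimono[of 0 n] by (simp_all add: R_x)

lemma x_antimono: "m \<le> n \<Longrightarrow> x n \<le> x m"
  using L.x_antimono[of m n] by (simp add: L_x)

lemma y_mono: "m \<le> n \<Longrightarrow> y m \<le> y n"
  using R.x_antimono[of m n] by (simp add: R_x)

text \<open>For \<open>w\<close> in \<open>\<Delta>\<close>, \<open>entryL k w\<close> and \<open>entryR k w\<close> are the points at level \<open>k\<close> on the left and on the right that
arrive at \<open>w\<close> after \<open>k + 1\<close> steps.\<close>

definition entryL :: "nat \<Rightarrow> real \<Rightarrow> real" where "entryL k w = (L.F ^^ Suc k) w"

definition entryR :: "nat \<Rightarrow> real \<Rightarrow> real" where "entryR k w = 1 - (R.F ^^ Suc k) (1 - w)"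

abbreviation \<Delta> :: "real set" where "\<Delta> \<equiv> {x 0<..<y 0}"

lemma entryL_in: "w \<in> \<Delta> \<Longrightarrow> entryL k w \<in> J_left x k"
  using L.iter_strict_mono[of "x 0" w "Suc k"] L.iter_strict_mono[of w "y 0" "Suc k"] order
    L.iter_l[of "Suc k"] L.iter_u[of k]
  by (simp add: entryL_def J_left_def L_x)

lemma entryR_in: "w \<in> \<Delta> \<Longrightarrow> entryR k w \<in> J_right y k"
  using R.iter_strict_mono[of "1 - y 0" "1 - w" "Suc k"] R.iter_strict_mono[of "1 - w" "1 - x 0" "Suc k"] order
    R.iter_l[of "Suc k"] R.iter_u[of k]
  by (simp add: entryR_def J_right_def R_x)

lemma J_left_bounds: "z \<in> J_left x k \<Longrightarrow> 0 < z \<and> z < x 0"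
  using x_bounds(1)[of "Suc k"] x_bounds(3)[of k] by (auto simp: J_left_def)

lemma J_right_bounds: "z \<in> J_right y k \<Longrightarrow> y 0 < z \<and> z < 1"
  using y_bounds(1)[of "Suc k"] y_bounds(3)[of k] by (auto simp: J_right_def)

lemma f_entryL:
  assumes "w \<in> \<Delta>"
  shows "f (entryL (Suc k) w) = entryL k w" "f (entryL 0 w) = w"
proof -
  have "entryL (Suc k) w = F\<^sub>0 (entryL k w)" "entryL 0 w = F\<^sub>0 w" by (simp_all add: entryL_def F\<^sub>0_def)
  then show "f (entryL (Suc k) w) = entryL k w" "f (entryL 0 w) = w"
    using J_left_bounds[OF entryL_in[OF assms], of k] assms order by (auto intro!: f_F\<^sub>0)
qed

lemma f_entryR:
  assumes "w \<in> \<Delta>"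
  shows "f (entryR (Suc k) w) = entryR k w" "f (entryR 0 w) = w"
proof -
  have "entryR (Suc k) w = F\<^sub>1 (entryR k w)" "entryR 0 w = F\<^sub>1 w" by (simp_all add: entryR_def F\<^sub>1_def)
  then show "f (entryR (Suc k) w) = entryR k w" "f (entryR 0 w) = w"
    using J_right_bounds[OF entryR_in[OF assms], of k] assms order by (auto intro!: f_F\<^sub>1)
qed

lemma N_on_J:
  assumes "z \<in> J_left x j \<or> z \<in> J_right y j" "1 \<le> k\<^sub>0"
  shows "N_fun x y k\<^sub>0 z = (if j = 0 then -1 else if k\<^sub>0 \<le> j then 1 else 0)"
  using assms(1)
proof
  assume z: "z \<in> J_left x j"
  then have z': "x (Suc j) < z" "z < x j" "0 < z" "z < x 0" using J_left_bounds by (auto simp: J_left_def)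
  have yk: "z < y k\<^sub>0" "z < y 0" using z' order y_bounds(3)[of k\<^sub>0] by auto
  have 0: "z \<notin> J_left x 0 \<union> J_right y 0" if "j \<noteq> 0"
    using that z' yk x_antimono[of 1 j] by (auto simp: J_left_def J_right_def)
  show ?thesis
  proof (cases "k\<^sub>0 \<le> j")
    case True
    then have "z < x k\<^sub>0" using z' x_antimono[of k\<^sub>0 j] by simp
    then show ?thesis using 0 z z' True assms(2) by (auto simp: N_fun_def)
  next
    case False
    then have "x k\<^sub>0 \<le> z" using z' x_antimono[of "Suc j" k\<^sub>0] by simp
    then show ?thesis using 0 z yk False by (cases "j = 0") (auto simp: N_fun_def)
  qed
next
  assume z: "z \<in> J_right y j"
  then have z': "y j < z" "z < y (Suc j)" "y 0 < z" "z < 1" using J_right_bounds by (auto simp: J_right_def)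
  have xk: "x k\<^sub>0 \<le> z" "x 0 < z" using z' order x_bounds(3)[of k\<^sub>0] by auto
  have 0: "z \<notin> J_left x 0 \<union> J_right y 0" if "j \<noteq> 0"
    using that z' xk y_mono[of 1 j] by (auto simp: J_left_def J_right_def)
  show ?thesis
  proof (cases "k\<^sub>0 \<le> j")
    case True
    then have "y k\<^sub>0 < z" using z' y_mono[of k\<^sub>0 j] by simp
    then show ?thesis using 0 z z' True assms(2) by (auto simp: N_fun_def)
  next
    case False
    then have "z \<le> y k\<^sub>0" using z' y_mono[of "Suc j" k\<^sub>0] by simp
    then show ?thesis using 0 z xk False by (cases "j = 0") (auto simp: N_fun_def)
  qed
qed

lemma N_on_\<Delta>: "z \<in> \<Delta> \<Longrightarrow> N_fun x y k\<^sub>0 z = 0"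
  using x_bounds(3)[of k\<^sub>0] y_bounds(3)[of k\<^sub>0] by (auto simp: N_fun_def J_left_def J_right_def)

text \<open>On the way down from level \<open>k\<close> each level \<open>j \<ge> k\<^sub>0\<close> counts \<open>1\<close> and level 0 counts \<open>-1\<close>. There are \<open>k + 1 - k\<^sub>0\<close>
levels of the first kind, and truncated subtraction is correct for \<open>k < k\<^sub>0\<close>.\<close>

lemma excursion:
  assumes e: "\<And>k. e k \<in> J_left x k \<or> e k \<in> J_right y k" and f_Suc: "\<And>k. f (e (Suc k)) = e k"
    and f_0: "f (e 0) = w" and k\<^sub>0: "1 \<le> k\<^sub>0"
  shows "(f ^^ Suc k) (e k) = w"
    "(\<Sum>i\<le>k. N_fun x y k\<^sub>0 ((f ^^ i) (e k))) = int (k + 1 - k\<^sub>0) - 1"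
proof (induction k)
  case 0
  show "(f ^^ Suc 0) (e 0) = w" using f_0 by simp
  show "(\<Sum>i\<le>0. N_fun x y k\<^sub>0 ((f ^^ i) (e 0))) = int (0 + 1 - k\<^sub>0) - 1"
    using N_on_J[OF e k\<^sub>0, of 0] k\<^sub>0 by simp
next
  case (Suc k)
  show "(f ^^ Suc (Suc k)) (e (Suc k)) = w" using Suc(1) f_Suc[of k] by (simp add: funpow_swap1)
  have "(\<Sum>i\<le>Suc k. N_fun x y k\<^sub>0 ((f ^^ i) (e (Suc k))))
      = N_fun x y k\<^sub>0 (e (Suc k)) + (\<Sum>i\<le>k. N_fun x y k\<^sub>0 ((f ^^ Suc i) (e (Suc k))))"
    by (subst sum.atMost_Suc_shift) simp
  also have "(\<Sum>i\<le>k. N_fun x y k\<^sub>0 ((f ^^ Suc i) (e (Suc k)))) = (\<Sum>i\<le>k. N_fun x y k\<^sub>0 ((f ^^ i) (e k)))"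
    by (simp add: funpow_swap1 f_Suc)
  finally show "(\<Sum>i\<le>Suc k. N_fun x y k\<^sub>0 ((f ^^ i) (e (Suc k)))) = int (Suc k + 1 - k\<^sub>0) - 1"
    using N_on_J[OF e k\<^sub>0, of "Suc k"] Suc(2) by auto
qed

text \<open>The inverse branches of the first return map to \<open>\<Delta>\<close>. Even letters are excursions on the left, odd letters those on the
right; the half of the letter is the level at which the excursion starts.\<close>

definition h :: "nat \<Rightarrow> real \<Rightarrow> real" where
  "h \<omega> w = (if even \<omega> then F\<^sub>1 (entryL (\<omega> div 2) w) else F\<^sub>0 (entryR (\<omega> div 2) w))"

definition dh :: "nat \<Rightarrow> real \<Rightarrow> real" where
  "dh \<omega> w = (if even \<omega> then L.wt (\<omega> div 2) w else R.wt (\<omega> div 2) (1 - w))"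

lemma h_split:
  assumes "w \<in> \<Delta>"
  shows "even \<omega> \<Longrightarrow> h \<omega> w \<in> {a<..<y 0}" "odd \<omega> \<Longrightarrow> h \<omega> w \<in> {x 0<..<a}"
proof -
  let ?k = "\<omega> div 2"
  have l: "0 < entryL ?k w" "entryL ?k w < x 0"
    using J_left_bounds[OF entryL_in[OF assms], of ?k] by auto
  have r: "y 0 < entryR ?k w" "entryR ?k w < 1"
    using J_right_bounds[OF entryR_in[OF assms], of ?k] by auto
  show "even \<omega> \<Longrightarrow> h \<omega> w \<in> {a<..<y 0}"
    using F\<^sub>1_strict[of 0 "entryL ?k w"] F\<^sub>1_strict[of "entryL ?k w" "x 0"] l order F\<^sub>1_0 F\<^sub>1_x0
    by (simp add: h_def)
  show "odd \<omega> \<Longrightarrow> h \<omega> w \<in> {x 0<..<a}"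
    using F\<^sub>0_strict[of "y 0" "entryR ?k w"] F\<^sub>0_strict[of "entryR ?k w" 1] r order F\<^sub>0_y0 F\<^sub>0_1
    by (simp add: h_def)
qed

lemma h_in: "w \<in> \<Delta> \<Longrightarrow> h \<omega> w \<in> \<Delta>"
  using h_split[of w \<omega>] order by (cases "even \<omega>") auto

lemma return:
  assumes w: "w \<in> \<Delta>" and k\<^sub>0: "1 \<le> k\<^sub>0"
  shows "(f ^^ (\<omega> div 2 + 2)) (h \<omega> w) = w"
    "(\<Sum>i<\<omega> div 2 + 2. N_fun x y k\<^sub>0 ((f ^^ i) (h \<omega> w))) = int (\<omega> div 2 + 1 - k\<^sub>0) - 1"
proof -
  define k where "k = \<omega> div 2"
  define e where "e = (if even \<omega> then (\<lambda>k. entryL k w) else (\<lambda>k. entryR k w))"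
  have e1: "e k \<in> J_left x k \<or> e k \<in> J_right y k" for k
    using entryL_in[OF w] entryR_in[OF w] by (simp add: e_def)
  have e2: "f (e (Suc k)) = e k" and e3: "f (e 0) = w" for k
    using f_entryL[OF w] f_entryR[OF w] by (auto simp: e_def)
  have fh: "f (h \<omega> w) = e k"
    using J_left_bounds[OF entryL_in[OF w], of k] J_right_bounds[OF entryR_in[OF w], of k] order
    by (auto simp: h_def e_def k_def[symmetric] intro!: f_F\<^sub>0 f_F\<^sub>1)
  note E = excursion[of e w k\<^sub>0 k, OF e1 e2 e3 k\<^sub>0]
  have shift: "(f ^^ Suc i) (h \<omega> w) = (f ^^ i) (e k)" for i
    using fh by (simp add: funpow_swap1)
  have "(f ^^ Suc (Suc k)) (h \<omega> w) = w" unfolding shift by (rule E)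
  then show "(f ^^ (\<omega> div 2 + 2)) (h \<omega> w) = w" by (simp add: k_def)
  have "(\<Sum>i<Suc (Suc k). N_fun x y k\<^sub>0 ((f ^^ i) (h \<omega> w)))
      = N_fun x y k\<^sub>0 (h \<omega> w) + (\<Sum>i<Suc k. N_fun x y k\<^sub>0 ((f ^^ Suc i) (h \<omega> w)))"
    by (subst sum.lessThan_Suc_shift) simp
  also have "\<dots> = int (k + 1 - k\<^sub>0) - 1"
    unfolding shift lessThan_Suc_atMost E(2) N_on_\<Delta>[OF h_in[OF w]] by simp
  finally show "(\<Sum>i<\<omega> div 2 + 2. N_fun x y k\<^sub>0 ((f ^^ i) (h \<omega> w))) = int (\<omega> div 2 + 1 - k\<^sub>0) - 1"
    by (simp add: k_def)
qed

end

section \<open>Lebesgue measure along excursions\<close>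

lemma suminf_even_odd:
  fixes g :: "nat \<Rightarrow> ennreal"
  shows "(\<Sum>\<omega>. g \<omega>) = (\<Sum>k. g (2 * k)) + (\<Sum>k. g (2 * k + 1))"
proof -
  have "g sums (\<Sum>\<omega>. g \<omega>)" by (intro summable_sums summableI)
  then have "(\<lambda>n. sum g {n * 2..<n * 2 + 2}) sums (\<Sum>\<omega>. g \<omega>)" by (rule sums_group) simp
  moreover have "sum g {n * 2..<n * 2 + 2} = g (2 * n) + g (2 * n + 1)" for n
    by (simp add: mult.commute numeral_2_eq_2)
  ultimately have "(\<lambda>n. g (2 * n) + g (2 * n + 1)) sums (\<Sum>\<omega>. g \<omega>)" by simp
  then have "(\<Sum>\<omega>. g \<omega>) = (\<Sum>n. g (2 * n) + g (2 * n + 1))" by (simp add: sums_iff)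
  then show ?thesis by (simp add: suminf_add)
qed

text \<open>Adjacent closed intervals overlap only in the points of the sequence, which form a null set.\<close>

lemma indicator_decreasing_partition:
  fixes b :: "nat \<Rightarrow> real"
  assumes decr: "\<And>n. b (Suc n) < b n" and lim: "b \<longlonglongrightarrow> b\<^sub>0" and t: "t \<notin> range b"
  shows "(indicator {b\<^sub>0<..b 0} t :: ennreal) = (\<Sum>k. indicator {b (Suc k)..b k} t)"
proof -
  have dec: "decseq b" by (rule decseq_SucI[of b]) (rule less_imp_le[OF decr])
  have b0: "b\<^sub>0 < b n" for n
    using decseq_ge[OF dec lim, of "Suc n"] decr[of n] by linarith
  show ?thesis
  proof (cases "t \<in> {b\<^sub>0<..b 0}")
    case True
    have "\<forall>\<^sub>F n in sequentially. b n < t" using True by (intro order_tendstoD(2)[OF lim]) auto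
    then obtain n where "b n < t" by (auto simp: eventually_sequentially)
    then have ex: "\<exists>n. b n < t" ..
    define m where "m = (LEAST n. b n < t)"
    have m: "b m < t" unfolding m_def using ex by (rule LeastI_ex)
    have m0: "m \<noteq> 0"
    proof
      assume "m = 0"
      with m True show False by simp
    qed
    then obtain k where k: "m = Suc k" by (cases m) auto
    have "\<not> b k < t" using not_less_Least[of k "\<lambda>n. b n < t"] k by (simp add: m_def[symmetric])
    then have kt: "b (Suc k) < t" "t < b k" using m k t by (auto simp: not_less less_le)
    have only: "t \<notin> {b (Suc j)..b j}" if "j \<noteq> k" for j
    proof (cases "j < k")
      case True
      then have "b k \<le> b (Suc j)" by (intro decseqD[OF dec]) simp
      then show ?thesis using kt by auto
    next
      case False
      then have "b j \<le> b (Suc k)" using that by (intro decseqD[OF dec]) simp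
      then show ?thesis using kt by auto
    qed
    have "(\<Sum>j. indicator {b (Suc j)..b j} t :: ennreal) = (\<Sum>j\<in>{k}. indicator {b (Suc j)..b j} t)"
      by (rule suminf_finite) (use only in auto)
    then show ?thesis using True kt by simp
  next
    case False
    have "t \<notin> {b (Suc k)..b k}" for k
    proof
      assume "t \<in> {b (Suc k)..b k}"
      moreover have "b k \<le> b 0" by (intro decseqD[OF dec]) simp
      ultimately show False using b0[of "Suc k"] False by auto
    qed
    then have "(\<Sum>j. indicator {b (Suc j)..b j} t :: ennreal) = 0" by simp
    then show ?thesis using False by simp
  qed
qed

lemma AE_lborel_not_in_range: "AE t in lborel. t \<notin> range (b :: nat \<Rightarrow> real)"
  by (rule AE_not_in) (auto intro!: countable_imp_null_set_lborel)

lemma nn_integral_decreasing_partition: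
  fixes b :: "nat \<Rightarrow> real" and v :: "real \<Rightarrow> ennreal"
  assumes [measurable]: "v \<in> borel_measurable borel"
    and b: "\<And>n. b (Suc n) < b n" "b \<longlonglongrightarrow> b\<^sub>0"
  shows "(\<integral>\<^sup>+t. v t * indicator {b\<^sub>0<..b 0} t \<partial>lborel) = (\<Sum>k. \<integral>\<^sup>+t. v t * indicator {b (Suc k)..b k} t \<partial>lborel)"
proof -
  have "(\<integral>\<^sup>+t. v t * indicator {b\<^sub>0<..b 0} t \<partial>lborel) = (\<integral>\<^sup>+t. (\<Sum>k. v t * indicator {b (Suc k)..b k} t) \<partial>lborel)"
    using AE_lborel_not_in_range[of b]
    by (intro nn_integral_cong_AE) (auto simp: indicator_decreasing_partition[OF b] elim: eventually_mono)
  then show ?thesis by (subst (asm) nn_integral_suminf) auto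
qed

lemma nn_integral_increasing_partition:
  fixes b :: "nat \<Rightarrow> real" and v :: "real \<Rightarrow> ennreal"
  assumes [measurable]: "v \<in> borel_measurable borel"
    and b: "\<And>n. b n < b (Suc n)" "b \<longlonglongrightarrow> b\<^sub>0"
  shows "(\<integral>\<^sup>+t. v t * indicator {b 0..<b\<^sub>0} t \<partial>lborel) = (\<Sum>k. \<integral>\<^sup>+t. v t * indicator {b k..b (Suc k)} t \<partial>lborel)"
proof -
  have i: "indicator {b 0..<b\<^sub>0} t = (\<Sum>k. indicator {b k..b (Suc k)} t :: ennreal)" if "t \<notin> range b" for t
  proof -
    have "- t \<notin> range (\<lambda>n. - b n)" using that by auto
    moreover have "(\<lambda>n. - b n) \<longlonglongrightarrow> - b\<^sub>0" using b(2) by (rule tendsto_minus)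
    ultimately have "(indicator {- b\<^sub>0<..- b 0} (- t) :: ennreal) = (\<Sum>k. indicator {- b (Suc k)..- b k} (- t))"
      using b(1) by (intro indicator_decreasing_partition[of "\<lambda>n. - b n"]) auto
    moreover have "(indicator {- b\<^sub>0<..- b 0} (- t) :: ennreal) = indicator {b 0..<b\<^sub>0} t"
      by (simp add: indicator_def conj_commute)
    moreover have "(indicator {- b (Suc k)..- b k} (- t) :: ennreal) = indicator {b k..b (Suc k)} t" for k
      by (simp add: indicator_def conj_commute)
    ultimately show ?thesis by simp
  qed
  have "(\<integral>\<^sup>+t. v t * indicator {b 0..<b\<^sub>0} t \<partial>lborel) = (\<integral>\<^sup>+t. (\<Sum>k. v t * indicator {b k..b (Suc k)} t) \<partial>lborel)"
    using AE_lborel_not_in_range[of b]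
    by (intro nn_integral_cong_AE) (auto simp: i elim: eventually_mono)
  then show ?thesis by (subst (asm) nn_integral_suminf) auto
qed

context two_branches
begin

abbreviation M :: "real measure" where "M \<equiv> restrict_space lborel \<Delta>"

lemma nn_integral_M: "(\<integral>\<^sup>+w. g w \<partial>M) = (\<integral>\<^sup>+w. g w * indicator {x 0..y 0} w \<partial>lborel)"
proof -
  have "(\<integral>\<^sup>+w. g w \<partial>M) = (\<integral>\<^sup>+w. g w * indicator \<Delta> w \<partial>lborel)"
    by (simp add: nn_integral_restrict_space)
  also have "\<dots> = (\<integral>\<^sup>+w. g w * indicator {x 0..y 0} w \<partial>lborel)"
    using AE_lborel_singleton[of "x 0"] AE_lborel_singleton[of "y 0"]
    by (intro nn_integral_cong_AE) (auto simp: indicator_def)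
  finally show ?thesis .
qed

lemma F\<^sub>0_deriv: "0 < w \<Longrightarrow> w < 1 \<Longrightarrow> (F\<^sub>0 has_real_derivative \<phi> w) (at w)"
  unfolding F\<^sub>0_def by (rule L.F_deriv)

lemma reflect_deriv:
  assumes "(g has_real_derivative d) (at (1 - w))"
  shows "((\<lambda>w. 1 - g (1 - w)) has_real_derivative d) (at w)"
proof -
  have "((\<lambda>w. 1 - w) has_real_derivative - 1) (at w)" by (auto intro!: derivative_eq_intros)
  from DERIV_diff[OF DERIV_const DERIV_chain2[OF assms this], of 1] show ?thesis by simp
qed

lemma F\<^sub>1_deriv: "0 < w \<Longrightarrow> w < 1 \<Longrightarrow> (F\<^sub>1 has_real_derivative 1 - \<phi> w) (at w)"
  unfolding F\<^sub>1_def[abs_def] using R.F_deriv[of "1 - w"] by (intro reflect_deriv) simp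

lemma entryL_deriv: "x 0 \<le> w \<Longrightarrow> w \<le> y 0 \<Longrightarrow> (entryL k has_real_derivative L.dF (Suc k) w) (at w)"
  unfolding entryL_def[abs_def] using L.iter_deriv[of w "Suc k"] order by simp

lemma entryR_deriv: "x 0 \<le> w \<Longrightarrow> w \<le> y 0 \<Longrightarrow> (entryR k has_real_derivative R.dF (Suc k) (1 - w)) (at w)"
  unfolding entryR_def[abs_def] using R.iter_deriv[of "1 - w" "Suc k"] order
  by (intro reflect_deriv) (simp add: comp_def)

lemma entry_unit:
  assumes "x 0 \<le> w" "w \<le> y 0"
  shows "0 < entryL k w \<and> entryL k w < 1" "0 < entryR k w \<and> entryR k w < 1"
  using L.iter_in[of w "Suc k"] R.iter_in[of "1 - w" "Suc k"] assms order
  by (auto simp: entryL_def entryR_def simp del: funpow.simps)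

lemma h_deriv:
  assumes "x 0 \<le> w" "w \<le> y 0"
  shows "(h \<omega> has_real_derivative dh \<omega> w) (at w)"
proof (cases "even \<omega>")
  case True
  let ?k = "\<omega> div 2"
  have "((\<lambda>w. F\<^sub>1 (entryL ?k w)) has_real_derivative (1 - \<phi> (entryL ?k w)) * L.dF (Suc ?k) w) (at w)"
    using entry_unit[OF assms] by (intro DERIV_chain2[OF F\<^sub>1_deriv entryL_deriv] assms) auto
  then show ?thesis
    using True by (simp add: h_def[abs_def] dh_def L.wt_def entryL_def mult.commute del: funpow.simps)
next
  case False
  let ?k = "\<omega> div 2"
  have "((\<lambda>w. F\<^sub>0 (entryR ?k w)) has_real_derivative \<phi> (entryR ?k w) * R.dF (Suc ?k) (1 - w)) (at w)"
    using entry_unit[OF assms] by (intro DERIV_chain2[OF F\<^sub>0_deriv entryR_deriv] assms) auto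
  then show ?thesis
    using False by (simp add: h_def[abs_def] dh_def R.wt_def entryR_def mult.commute del: funpow.simps)
qed

lemma dh_pos: "x 0 \<le> w \<Longrightarrow> w \<le> y 0 \<Longrightarrow> 0 < dh \<omega> w"
  using L.wt_pos[of w] R.wt_pos[of "1 - w"] by (simp add: dh_def)

lemma reflect_continuous: "continuous_on {1 - y 0..1 - x 0} g \<Longrightarrow> continuous_on {x 0..y 0} (\<lambda>w. g (1 - w))" for g :: "real \<Rightarrow> real"
  by (rule continuous_on_compose2[of "{1 - y 0..1 - x 0}" g]) (auto intro!: continuous_intros)

lemma dh_continuous: "continuous_on {x 0..y 0} (dh \<omega>)"
  unfolding dh_def[abs_def]
  by (cases "even \<omega>") (simp_all add: L.wt_continuous reflect_continuous[OF R.wt_continuous])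

lemma entry_ends:
  "entryL k (x 0) = x (Suc k)" "entryL k (y 0) = x k" "entryR k (x 0) = y k" "entryR k (y 0) = y (Suc k)"
  using L.iter_l[of "Suc k"] L.iter_u[of k] R.iter_l[of "Suc k"] R.iter_u[of k]
  by (simp_all add: entryL_def entryR_def L_x R_x del: funpow.simps)

lemma substitution:
  fixes v :: "real \<Rightarrow> ennreal"
  assumes "v \<in> borel_measurable borel"
    and "\<And>w. x 0 \<le> w \<Longrightarrow> w \<le> y 0 \<Longrightarrow> (g has_real_derivative g' w) (at w)"
    and "continuous_on {x 0..y 0} g'" "\<And>w. x 0 \<le> w \<Longrightarrow> w \<le> y 0 \<Longrightarrow> 0 \<le> g' w"
  shows "(\<integral>\<^sup>+t. v t * indicator {g (x 0)..g (y 0)} t \<partial>lborel) = (\<integral>\<^sup>+w. ennreal (g' w) * v (g w) \<partial>M)"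
  unfolding nn_integral_M
  using nn_integral_substitution_aux[of v "x 0" "y 0" g g'] assms order by (simp add: mult_ac)

lemma substitution_entryL:
  assumes "v \<in> borel_measurable borel"
  shows "(\<integral>\<^sup>+t. v t * indicator {x (Suc k)..x k} t \<partial>lborel)
    = (\<integral>\<^sup>+w. ennreal (L.dF (Suc k) w) * v (entryL k w) \<partial>M)"
  using substitution[OF assms, of "entryL k" "L.dF (Suc k)"] entryL_deriv L.dF_continuous L.dF_pos order
  by (simp add: entry_ends less_imp_le)

lemma substitution_entryR:
  assumes "v \<in> borel_measurable borel"
  shows "(\<integral>\<^sup>+t. v t * indicator {y k..y (Suc k)} t \<partial>lborel)
    = (\<integral>\<^sup>+w. ennreal (R.dF (Suc k) (1 - w)) * v (entryR k w) \<partial>M)"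
  using substitution[OF assms, of "entryR k" "\<lambda>w. R.dF (Suc k) (1 - w)"] entryR_deriv
    reflect_continuous[OF R.dF_continuous] R.dF_pos order
  by (simp add: entry_ends less_imp_le)

lemma substitution_h:
  assumes "v \<in> borel_measurable borel"
  shows "(\<integral>\<^sup>+t. v t * indicator {h \<omega> (x 0)..h \<omega> (y 0)} t \<partial>lborel)
    = (\<integral>\<^sup>+w. ennreal (dh \<omega> w) * v (h \<omega> w) \<partial>M)"
  using substitution[OF assms, of "h \<omega>" "dh \<omega>"] h_deriv dh_continuous dh_pos by (simp add: less_imp_le)

lemma x_lim: "x \<longlonglongrightarrow> 0" and y_lim: "y \<longlonglongrightarrow> 1"
proof -
  show "x \<longlonglongrightarrow> 0" using L.x_tendsto_0 by (simp add: L_x[abs_def])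
  have "(\<lambda>n. 1 - R.x n) \<longlonglongrightarrow> 1 - 0" by (intro tendsto_intros R.x_tendsto_0)
  then show "y \<longlonglongrightarrow> 1" by (simp add: R_x)
qed

lemma x_unit: "0 \<le> x n \<and> x n \<le> 1" and y_unit: "0 \<le> y n \<and> y n \<le> 1"
  using x_bounds[of n] y_bounds[of n] order by auto

lemma F\<^sub>0_continuous: "continuous_on {0..1} F\<^sub>0"
  unfolding F\<^sub>0_def L.F_def[abs_def]
  by (intro indefinite_integral_continuous_1 integrable_continuous_real L.cont)

lemma F\<^sub>1_continuous: "continuous_on {0..1} F\<^sub>1"
  by (subst continuous_on_cong[OF refl F\<^sub>1_eq]) (auto intro!: continuous_intros F\<^sub>0_continuous)

text \<open>A point of \<open>\<Delta>\<close> other than \<open>a\<close> starts an excursion on the left if it lies right of \<open>a\<close>, and on the right if it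
lies left of \<open>a\<close>; up to the boundary points the levels partition both halves of \<open>\<Delta>\<close>.\<close>

lemma nn_integral_transfer:
  assumes [measurable]: "v \<in> borel_measurable M"
  shows "(\<integral>\<^sup>+w. v w \<partial>M) = (\<Sum>\<omega>. \<integral>\<^sup>+w. ennreal (dh \<omega> w) * v (h \<omega> w) \<partial>M)"
proof -
  define v' where "v' w = v w * indicator \<Delta> w" for w
  have [measurable]: "v' \<in> borel_measurable borel"
    using borel_measurable_restrict_space_iff_ennreal[of \<Delta> lborel v] assms
    by (simp add: v'_def[abs_def])
  have vh: "(\<integral>\<^sup>+w. ennreal (dh \<omega> w) * v' (h \<omega> w) \<partial>M) = (\<integral>\<^sup>+w. ennreal (dh \<omega> w) * v (h \<omega> w) \<partial>M)" for \<omega>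
    using h_in[of _ \<omega>] by (intro nn_integral_cong) (auto simp: v'_def space_restrict_space)
  have "(\<integral>\<^sup>+w. v w \<partial>M) = (\<integral>\<^sup>+w. v' w \<partial>lborel)"
    by (simp add: nn_integral_restrict_space v'_def)
  also have "\<dots> = (\<integral>\<^sup>+w. v' w * indicator {a<..y 0} w + v' w * indicator {x 0..<a} w \<partial>lborel)"
    using AE_lborel_singleton[of a] order
    by (intro nn_integral_cong_AE) (auto simp: v'_def indicator_def elim!: eventually_mono)
  also have "\<dots> = (\<integral>\<^sup>+w. v' w * indicator {a<..y 0} w \<partial>lborel) + (\<integral>\<^sup>+w. v' w * indicator {x 0..<a} w \<partial>lborel)"
    by (rule nn_integral_add) auto
  also have "(\<integral>\<^sup>+w. v' w * indicator {a<..y 0} w \<partial>lborel)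
      = (\<Sum>k. \<integral>\<^sup>+w. ennreal (dh (2 * k) w) * v' (h (2 * k) w) \<partial>M)"
  proof -
    have "(\<lambda>k. F\<^sub>1 (x k)) \<longlonglongrightarrow> F\<^sub>1 0"
      by (rule continuous_on_tendsto_compose[OF F\<^sub>1_continuous x_lim])
        (use x_unit in \<open>auto intro!: always_eventually\<close>)
    moreover have "F\<^sub>1 (x (Suc k)) < F\<^sub>1 (x k)" for k
      using x_bounds[of k] x_bounds[of "Suc k"] order by (intro F\<^sub>1_strict) auto
    ultimately have "(\<integral>\<^sup>+w. v' w * indicator {a<..y 0} w \<partial>lborel)
        = (\<Sum>k. \<integral>\<^sup>+t. v' t * indicator {F\<^sub>1 (x (Suc k))..F\<^sub>1 (x k)} t \<partial>lborel)"
      using nn_integral_decreasing_partition[of v' "\<lambda>k. F\<^sub>1 (x k)" a] by (simp add: F\<^sub>1_0 F\<^sub>1_x0)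
    also have "\<dots> = (\<Sum>k. \<integral>\<^sup>+w. ennreal (dh (2 * k) w) * v' (h (2 * k) w) \<partial>M)"
      by (subst substitution_h[symmetric]) (simp_all add: h_def entry_ends)
    finally show ?thesis .
  qed
  also have "(\<integral>\<^sup>+w. v' w * indicator {x 0..<a} w \<partial>lborel)
      = (\<Sum>k. \<integral>\<^sup>+w. ennreal (dh (2 * k + 1) w) * v' (h (2 * k + 1) w) \<partial>M)"
  proof -
    have "(\<lambda>k. F\<^sub>0 (y k)) \<longlonglongrightarrow> F\<^sub>0 1"
      by (rule continuous_on_tendsto_compose[OF F\<^sub>0_continuous y_lim])
        (use y_unit in \<open>auto intro!: always_eventually\<close>)
    moreover have "F\<^sub>0 (y k) < F\<^sub>0 (y (Suc k))" for k
      using y_bounds[of k] y_bounds[of "Suc k"] order by (intro F\<^sub>0_strict) auto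
    ultimately have "(\<integral>\<^sup>+w. v' w * indicator {x 0..<a} w \<partial>lborel)
        = (\<Sum>k. \<integral>\<^sup>+t. v' t * indicator {F\<^sub>0 (y k)..F\<^sub>0 (y (Suc k))} t \<partial>lborel)"
      using nn_integral_increasing_partition[of v' "\<lambda>k. F\<^sub>0 (y k)" a] by (simp add: F\<^sub>0_1 F\<^sub>0_y0)
    also have "\<dots> = (\<Sum>k. \<integral>\<^sup>+w. ennreal (dh (2 * k + 1) w) * v' (h (2 * k + 1) w) \<partial>M)"
      by (subst substitution_h[symmetric]) (simp_all add: h_def entry_ends)
    finally show ?thesis .
  qed
  finally show ?thesis unfolding vh by (simp add: suminf_even_odd[of "\<lambda>\<omega>. \<integral>\<^sup>+w. ennreal (dh \<omega> w) * v (h \<omega> w) \<partial>M"])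
qed

end

lemma weighted_mass_le:
  assumes "\<And>k. 0 \<le> gp k - gp (Suc k)" "\<And>k. gp k \<ge> (0::real)" "\<And>n. z n \<ge> (0::real)"
    and "\<And>n. (\<Sum>k<n. real (k + 1 - m) * (gp k - gp (Suc k))) \<le> z m - z (max n m) - real (n - m) * gp n"
  shows "(\<Sum>k. ennreal (real (k + 1 - m)) * ennreal (gp k - gp (Suc k))) \<le> ennreal (z m)"
proof (rule suminf_le_const)
  fix n
  have "(\<Sum>k<n. ennreal (real (k + 1 - m)) * ennreal (gp k - gp (Suc k)))
      = ennreal (\<Sum>k<n. real (k + 1 - m) * (gp k - gp (Suc k)))"
    using assms(1) by (subst sum_ennreal[symmetric]) (auto simp: ennreal_mult)
  also have "\<dots> \<le> ennreal (z m)"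
  proof (rule ennreal_leI)
    have "0 \<le> real (n - m) * gp n" using assms(2) by simp
    then show "(\<Sum>k<n. real (k + 1 - m) * (gp k - gp (Suc k))) \<le> z m"
      using assms(4)[of n] assms(3)[of "max n m"] by linarith
  qed
  finally show "(\<Sum>k<n. ennreal (real (k + 1 - m)) * ennreal (gp k - gp (Suc k))) \<le> ennreal (z m)" .
qed simp

context two_branches
begin

definition \<theta> :: real where "\<theta> = max (\<phi> (x 0)) (1 - \<phi> (y 0))"

lemma \<theta>_bounds: "0 \<le> \<theta>" "\<theta> < 1"
  using \<phi>_pos[of "x 0"] \<phi>_pos[of "y 0"] \<phi>_less_1[of "x 0"] order by (auto simp: \<theta>_def)

lemma dh_le:
  assumes w: "x 0 \<le> w" "w \<le> y 0"
  shows "dh \<omega> w \<le> \<theta>"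
    "dh \<omega> w \<le> L.G * L.gap (\<omega> div 2) + R.G * R.gap (\<omega> div 2)"
proof -
  let ?k = "\<omega> div 2"
  have r: "1 - y 0 \<le> 1 - w" "1 - w \<le> 1 - x 0" using w by auto
  have "\<phi> w \<le> \<phi> (x 0)" "\<phi> (y 0) \<le> \<phi> w" using w order by (auto intro!: L.anti)
  then show "dh \<omega> w \<le> \<theta>"
    using L.wt_le(1)[OF w, of ?k] R.wt_le(1)[OF r, of ?k] by (auto simp: dh_def \<theta>_def)
  have "0 \<le> L.G * L.gap ?k" "0 \<le> R.G * R.gap ?k"
    using L.G_pos R.G_pos L.gap_pos R.gap_pos by (simp_all add: less_imp_le)
  then show "dh \<omega> w \<le> L.G * L.gap ?k + R.G * R.gap ?k"
    using L.wt_le(2)[OF w, of ?k] R.wt_le(2)[OF r, of ?k] by (simp add: dh_def)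
qed

lemma h_contracting:
  assumes "x 0 \<le> w" "w \<le> y 0" "x 0 \<le> w'" "w' \<le> y 0"
  shows "\<bar>h \<omega> w - h \<omega> w'\<bar> \<le> \<theta> * \<bar>w - w'\<bar>"
proof -
  have *: "\<bar>h \<omega> t - h \<omega> s\<bar> \<le> \<theta> * \<bar>t - s\<bar>" if "x 0 \<le> s" "s < t" "t \<le> y 0" for s t
  proof -
    have "\<exists>z>s. z < t \<and> h \<omega> t - h \<omega> s = (t - s) * dh \<omega> z"
      using that by (intro MVT2 h_deriv) auto
    then obtain z where z: "s < z" "z < t" "h \<omega> t - h \<omega> s = (t - s) * dh \<omega> z" by blast
    have "0 < dh \<omega> z" "dh \<omega> z \<le> \<theta>" using z that by (auto intro!: dh_pos dh_le)
    then show ?thesis unfolding z(3) using that by (simp add: abs_mult mult.commute)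
  qed
  consider "w < w'" | "w = w'" | "w' < w" by linarith
  then show ?thesis
    using *[of w w'] *[of w' w] assms by cases (auto simp: abs_minus_commute)
qed

lemma sets_M: "sets M = sets (restrict_space borel \<Delta>)"
  by (rule sets_restrict_space_cong) (rule sets_lborel)

lemma continuous_imp_measurable_M:
  fixes g :: "real \<Rightarrow> real"
  assumes "continuous_on {x 0..y 0} g"
  shows "g \<in> borel_measurable M"
proof -
  have "continuous_on \<Delta> g" by (rule continuous_on_subset[OF assms]) auto
  then have "g \<in> borel_measurable (restrict_space borel \<Delta>)"
    by (rule borel_measurable_continuous_on_restrict)
  then show ?thesis unfolding measurable_cong_sets[OF sets_M refl] .
qed

lemma h_measurable: "h \<omega> \<in> M \<rightarrow>\<^sub>M M"
proof (rule measurable_restrict_space2)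
  have "continuous_on {x 0..y 0} (h \<omega>)"
  proof (rule DERIV_continuous_on)
    fix w assume "w \<in> {x 0..y 0}"
    then show "(h \<omega> has_real_derivative dh \<omega> w) (at w within {x 0..y 0})"
      by (intro has_field_derivative_at_within[OF h_deriv]) auto
  qed
  then have "h \<omega> \<in> borel_measurable M" by (rule continuous_imp_measurable_M)
  then show "h \<omega> \<in> M \<rightarrow>\<^sub>M lborel" unfolding measurable_cong_sets[OF refl sets_lborel] .
  show "h \<omega> \<in> space M \<rightarrow> \<Delta>" using h_in by (auto simp: space_restrict_space)
qed

lemma dh_sum:
  assumes "w \<in> \<Delta>"
  shows "(\<Sum>\<omega>. ennreal (dh \<omega> w)) = 1"
proof -
  have w: "x 0 \<le> w" "w \<le> y 0" and r: "1 - y 0 \<le> 1 - w" "1 - w \<le> 1 - x 0" using assms by auto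
  have "(\<Sum>k. ennreal (L.wt k w)) = ennreal (\<phi> w)"
    using L.wt_sums[OF w] L.wt_pos[OF w] by (intro suminf_ennreal_eq) (auto simp: less_imp_le)
  moreover have "(\<Sum>k. ennreal (R.wt k (1 - w))) = ennreal (1 - \<phi> w)"
    using R.wt_sums[OF r] R.wt_pos[OF r] by (intro suminf_ennreal_eq) (auto simp: less_imp_le)
  ultimately have "(\<Sum>\<omega>. ennreal (dh \<omega> w)) = ennreal (\<phi> w) + ennreal (1 - \<phi> w)"
    by (subst suminf_even_odd) (simp add: dh_def)
  also have "\<dots> = 1"
    using \<phi>_range[of w] assms order by (simp add: ennreal_plus[symmetric] del: ennreal_plus)
  finally show ?thesis .
qed

text \<open>One constant serves for the branches of the return map and for the entries into \<open>\<Delta>\<close> from all levels.\<close>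

lemma distortion:
  obtains S where "0 \<le> S"
    "\<And>k w w'. w \<in> {x 0..y 0} \<Longrightarrow> w' \<in> {x 0..y 0} \<Longrightarrow> dh k w \<le> exp (S * \<bar>w - w'\<bar>) * dh k w'"
    "\<And>k w w'. w \<in> {x 0..y 0} \<Longrightarrow> w' \<in> {x 0..y 0} \<Longrightarrow> L.dF (Suc k) w \<le> exp (S * \<bar>w - w'\<bar>) * L.dF (Suc k) w'"
    "\<And>k w w'. w \<in> {x 0..y 0} \<Longrightarrow> w' \<in> {x 0..y 0} \<Longrightarrow>
      R.dF (Suc k) (1 - w) \<le> exp (S * \<bar>w - w'\<bar>) * R.dF (Suc k) (1 - w')"
proof -
  obtain S1 where S1: "0 \<le> S1" "\<And>k w w'. w \<in> {x 0..y 0} \<Longrightarrow> w' \<in> {x 0..y 0} \<Longrightarrow>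
      L.dF (Suc k) w \<le> exp (S1 * \<bar>w - w'\<bar>) * L.dF (Suc k) w' \<and> L.wt k w \<le> exp (S1 * \<bar>w - w'\<bar>) * L.wt k w'"
    using L.distortion by blast
  obtain S2 where S2: "0 \<le> S2" "\<And>k w w'. w \<in> {1 - y 0..1 - x 0} \<Longrightarrow> w' \<in> {1 - y 0..1 - x 0} \<Longrightarrow>
      R.dF (Suc k) w \<le> exp (S2 * \<bar>w - w'\<bar>) * R.dF (Suc k) w' \<and> R.wt k w \<le> exp (S2 * \<bar>w - w'\<bar>) * R.wt k w'"
    using R.distortion by blast
  define S where "S = max S1 S2"
  have SS: "S1 \<le> S" "S2 \<le> S" by (auto simp: S_def)
  have up: "p \<le> exp (S * d) * p'" if "p \<le> exp (s * d) * p'" "s \<le> S" "0 \<le> d" "0 < p'" for p p' s d :: real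
  proof -
    have "exp (s * d) * p' \<le> exp (S * d) * p'" using that by (intro mult_right_mono) (auto intro: mult_right_mono)
    then show ?thesis using that by linarith
  qed
  have l: "L.dF (Suc k) w \<le> exp (S * \<bar>w - w'\<bar>) * L.dF (Suc k) w'" "L.wt k w \<le> exp (S * \<bar>w - w'\<bar>) * L.wt k w'"
    if w: "w \<in> {x 0..y 0}" "w' \<in> {x 0..y 0}" for k w w'
    using S1(2)[OF w, of k] w order L.dF_pos[of w' "Suc k"] L.wt_pos[of w' k]
    by (auto intro!: up[OF _ SS(1)])
  have r: "R.dF (Suc k) (1 - w) \<le> exp (S * \<bar>w - w'\<bar>) * R.dF (Suc k) (1 - w')"
    "R.wt k (1 - w) \<le> exp (S * \<bar>w - w'\<bar>) * R.wt k (1 - w')"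
    if w: "w \<in> {x 0..y 0}" "w' \<in> {x 0..y 0}" for k w w'
  proof -
    have e: "\<bar>1 - w - (1 - w')\<bar> = \<bar>w - w'\<bar>" by linarith
    have "1 - w \<in> {1 - y 0..1 - x 0}" "1 - w' \<in> {1 - y 0..1 - x 0}" using w by auto
    from S2(2)[OF this, of k, unfolded e]
    show "R.dF (Suc k) (1 - w) \<le> exp (S * \<bar>w - w'\<bar>) * R.dF (Suc k) (1 - w')"
      "R.wt k (1 - w) \<le> exp (S * \<bar>w - w'\<bar>) * R.wt k (1 - w')"
      using w order R.dF_pos[of "1 - w'" "Suc k"] R.wt_pos[of "1 - w'" k]
      by (auto intro!: up[OF _ SS(2)])
  qed
  show ?thesis
    using that[of S] l r S1(1) SS by (auto simp: dh_def)
qed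

text \<open>The gaps at level \<open>k\<close> are \<open>O((k + 1) powr - (1 + 1 / \<alpha>))\<close> on both sides, because \<open>\<beta> \<le> \<alpha>\<close>.\<close>

lemma finite_power_moment:
  assumes q: "1 < q" "q < 1 / \<alpha>" and P: "0 \<le> P"
    and g: "\<And>k. 0 \<le> g k" "\<And>k. g k \<le> P * (real k + 1)"
  shows "(\<Sum>k. ennreal (g k powr q) * ennreal (L.gap k)) < \<infinity>"
    "(\<Sum>k. ennreal (g k powr q) * ennreal (R.gap k)) < \<infinity>"
proof -
  have *: "(\<Sum>k. ennreal (g k powr q) * ennreal (gp k)) < \<infinity>"
    if s: "summable (\<lambda>k. (real k + 1) powr q * gp k)" and gp: "\<And>k. 0 < gp k" for gp
  proof -
    have le: "g k powr q * gp k \<le> P powr q * ((real k + 1) powr q * gp k)" for k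
    proof -
      have "g k powr q \<le> (P * (real k + 1)) powr q" using g q by (intro powr_mono2) auto
      also have "\<dots> = P powr q * (real k + 1) powr q" using P by (intro powr_mult)
      finally show ?thesis using gp[of k] by (simp add: mult_right_mono mult.assoc[symmetric])
    qed
    have "summable (\<lambda>k. g k powr q * gp k)"
      by (rule summable_comparison_test'[OF summable_mult[OF s, of "P powr q"], of 0])
        (use le gp in \<open>auto simp: abs_mult less_imp_le\<close>)
    then have "(\<Sum>k. ennreal (g k powr q * gp k)) = ennreal (\<Sum>k. g k powr q * gp k)"
      using gp by (intro suminf_ennreal2) (auto simp: less_imp_le)
    then show ?thesis using gp by (simp add: ennreal_mult less_imp_le)
  qed
  show "(\<Sum>k. ennreal (g k powr q) * ennreal (L.gap k)) < \<infinity>"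
    by (rule *[OF L.gap_moment[OF order_refl q] L.gap_pos])
  show "(\<Sum>k. ennreal (g k powr q) * ennreal (R.gap k)) < \<infinity>"
    by (rule *[OF R.gap_moment[OF \<beta>_le q] R.gap_pos])
qed

text \<open>By \<open>F\<^sub>0 w + F\<^sub>1 w = a + w\<close>, what one branch takes from the length of an interval the other branch restores.\<close>

lemma gap_diff:
  "L.gap k - L.gap (Suc k) = F\<^sub>1 (x k) - F\<^sub>1 (x (Suc k))"
  "R.gap k - R.gap (Suc k) = F\<^sub>0 (y (Suc k)) - F\<^sub>0 (y k)"
proof -
  have "F\<^sub>1 (x n) = a + x n - x (Suc n)" for n
    using x_unit[of n] by (simp add: F\<^sub>1_eq x_Suc)
  then show "L.gap k - L.gap (Suc k) = F\<^sub>1 (x k) - F\<^sub>1 (x (Suc k))"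
    unfolding L.gap_def L_x by simp
  have "F\<^sub>0 (y n) = a + y n - y (Suc n)" for n
    using y_unit[of n] by (simp add: F\<^sub>1_eq y_Suc)
  then show "R.gap k - R.gap (Suc k) = F\<^sub>0 (y (Suc k)) - F\<^sub>0 (y k)"
    unfolding R.gap_def R_x by simp
qed

lemma gap_decr: "0 \<le> L.gap k - L.gap (Suc k)" "0 \<le> R.gap k - R.gap (Suc k)"
  unfolding gap_diff
  using F\<^sub>1_strict[of "x (Suc k)" "x k"] F\<^sub>0_strict[of "y k" "y (Suc k)"] x_bounds[of k] y_bounds[of k]
    x_unit y_unit by (auto simp: less_imp_le)

lemma mass_dh:
  "(\<integral>\<^sup>+w. ennreal (dh (2 * k) w) \<partial>M) = ennreal (L.gap k - L.gap (Suc k))"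
  "(\<integral>\<^sup>+w. ennreal (dh (2 * k + 1) w) \<partial>M) = ennreal (R.gap k - R.gap (Suc k))"
  using substitution_h[of "\<lambda>_. 1" "2 * k"] substitution_h[of "\<lambda>_. 1" "2 * k + 1"] gap_decr[of k]
  unfolding gap_diff by (simp_all add: h_def entry_ends)

text \<open>The right-hand side is the measure of the set where \<open>N\<close> is 1.\<close>

lemma mean_increment_le:
  "(\<Sum>\<omega>. ennreal (real (\<omega> div 2 + 1 - m)) * (\<integral>\<^sup>+w. ennreal (dh \<omega> w) \<partial>M)) \<le> ennreal (x m + (1 - y m))"
proof -
  have "(\<Sum>k. ennreal (real (k + 1 - m)) * ennreal (L.gap k - L.gap (Suc k))) \<le> ennreal (x m)"
    using L.weighted_gaps_le[of m] L.gap_pos gap_decr L.x_pos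
    by (intro weighted_mass_le) (auto simp: L_x less_imp_le)
  moreover have "(\<Sum>k. ennreal (real (k + 1 - m)) * ennreal (R.gap k - R.gap (Suc k))) \<le> ennreal (1 - y m)"
    using R.weighted_gaps_le[of m] R.gap_pos gap_decr R.x_pos
    unfolding R_x[symmetric] by (intro weighted_mass_le) (auto simp: less_imp_le)
  ultimately have "(\<Sum>k. ennreal (real (k + 1 - m)) * ennreal (L.gap k - L.gap (Suc k)))
      + (\<Sum>k. ennreal (real (k + 1 - m)) * ennreal (R.gap k - R.gap (Suc k))) \<le> ennreal (x m) + ennreal (1 - y m)"
    by (rule add_mono)
  then show ?thesis
    using x_unit[of m] y_unit[of m]
    by (subst suminf_even_odd) (simp only: mass_dh, simp)
qed

definition survivors :: "nat \<Rightarrow> nat \<Rightarrow> real set" where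
  "survivors k\<^sub>0 n = {t\<in>{0..1}. \<forall>j<n. 0 \<le> (\<Sum>i\<le>j. N_fun x y k\<^sub>0 ((f ^^ i) t))}"

lemma f_iter_range: "t \<in> {0..1} \<Longrightarrow> (f ^^ n) t \<in> {0..1}"
  by (induction n) (auto simp: f_range)

lemma f_mono:
  "0 \<le> s \<Longrightarrow> s \<le> t \<Longrightarrow> t \<le> a \<Longrightarrow> f s \<le> f t" "a < s \<Longrightarrow> s \<le> t \<Longrightarrow> t \<le> 1 \<Longrightarrow> f s \<le> f t"
proof -
  show "f s \<le> f t" if "0 \<le> s" "s \<le> t" "t \<le> a"
    using F\<^sub>0_strict[of "f t" "f s"] F\<^sub>0_f[of s] F\<^sub>0_f[of t] f_range[of s] f_range[of t] that order
    by (cases "f t < f s") auto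
  show "f s \<le> f t" if "a < s" "s \<le> t" "t \<le> 1"
    using F\<^sub>1_strict[of "f t" "f s"] F\<^sub>1_f[of s] F\<^sub>1_f[of t] f_range[of s] f_range[of t] that order
    by (cases "f t < f s") auto
qed

abbreviation I :: "real measure" where "I \<equiv> restrict_space borel {0..1}"

lemma f_measurable: "f \<in> I \<rightarrow>\<^sub>M I"
proof -
  have "f \<in> borel_measurable I"
  proof (rule measurable_piecewise_restrict[of "{{0..a}, {a<..1}}"])
    fix \<Omega> assume "\<Omega> \<in> {{0..a}, {a<..1}}"
    then have \<Omega>: "\<Omega> = {0..a} \<or> \<Omega> = {a<..1}" by auto
    then have sub: "\<Omega> \<subseteq> {0..1}" using order by auto
    have \<Omega>_borel: "\<Omega> \<in> sets borel" using \<Omega> by (elim disjE) simp_all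
    have "mono_on \<Omega> f" using \<Omega> f_mono by (auto simp: mono_on_def)
    then have "f \<in> borel_measurable (restrict_space borel \<Omega>)" by (rule borel_measurable_mono_on_fnc)
    moreover have "restrict_space I \<Omega> = restrict_space borel \<Omega>"
      using restrict_restrict_space[of "{0..1}" borel \<Omega>] sub \<Omega>_borel by (simp add: Int_absorb1)
    ultimately show "f \<in> borel_measurable (restrict_space I \<Omega>)" by simp
    have "\<Omega> \<inter> space I = \<Omega>" using sub by (auto simp: space_restrict_space)
    then show "\<Omega> \<inter> space I \<in> sets I" using sub \<Omega>_borel by (simp add: sets_restrict_space_iff)
  qed (use order in \<open>auto simp: space_restrict_space\<close>)
  then show ?thesis
    using f_range by (intro measurable_restrict_space2) (auto simp: space_restrict_space)
qed

lemma f_iter_measurable: "f ^^ n \<in> I \<rightarrow>\<^sub>M I"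
proof (induction n)
  case (Suc n)
  then show ?case using measurable_comp[OF Suc f_measurable] by (simp add: comp_def)
qed (simp add: id_def)

lemma N_fun_measurable: "(\<lambda>t. real_of_int (N_fun x y k\<^sub>0 t)) \<in> borel_measurable borel"
proof -
  let ?A = "J_left x 0 \<union> J_right y 0" and ?B = "{0..<x k\<^sub>0} \<union> {y k\<^sub>0<..1}"
  have "(\<lambda>t. if t \<in> ?A then - 1 else if t \<in> ?B then 1 else 0 :: real) \<in> borel_measurable borel"
    by (intro measurable_If_set measurable_const) (auto simp: J_left_def J_right_def)
  moreover have "real_of_int (N_fun x y k\<^sub>0 t) = (if t \<in> ?A then - 1 else if t \<in> ?B then 1 else 0)" for t
    by (simp add: N_fun_def)
  ultimately show ?thesis by simp
qed

lemma sum_N_measurable: "(\<lambda>t. real_of_int (\<Sum>i\<le>j. N_fun x y k\<^sub>0 ((f ^^ i) t))) \<in> borel_measurable I"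
proof -
  have "(\<lambda>t. real_of_int (N_fun x y k\<^sub>0 ((f ^^ i) t))) \<in> borel_measurable I" for i
    by (rule measurable_compose[OF f_iter_measurable measurable_restrict_space1[OF N_fun_measurable]])
  then show ?thesis unfolding of_int_sum by (intro borel_measurable_sum)
qed

lemma walk_set_measurable:
  "{t\<in>{0..1}. \<forall>j<n. (s::int) \<le> (\<Sum>i\<le>j. N_fun x y k\<^sub>0 ((f ^^ i) t))} \<in> sets borel"
proof -
  have "{t \<in> space I. \<forall>j\<in>{..<n}. real_of_int s \<le> real_of_int (\<Sum>i\<le>j. N_fun x y k\<^sub>0 ((f ^^ i) t))} \<in> sets I"
    using sum_N_measurable by (intro sets.sets_Collect_finite_All borel_measurable_le) auto
  moreover have "{t\<in>{0..1}. \<forall>j<n. s \<le> (\<Sum>i\<le>j. N_fun x y k\<^sub>0 ((f ^^ i) t))}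
      = {t \<in> space I. \<forall>j\<in>{..<n}. real_of_int s \<le> real_of_int (\<Sum>i\<le>j. N_fun x y k\<^sub>0 ((f ^^ i) t))}"
    unfolding of_int_le_iff by (simp add: space_restrict_space Ball_def)
  ultimately show ?thesis by (simp add: sets_restrict_space_iff)
qed

lemma survivors_measurable: "survivors k\<^sub>0 n \<in> sets borel"
  unfolding survivors_def by (rule walk_set_measurable)

text \<open>The Markov property of the walk: after a complete excursion it starts afresh at \<open>w\<close>, at the height
reached.\<close>

lemma walk_shift:
  assumes "(\<Sum>i<r. N_fun x y k\<^sub>0 ((f ^^ i) z)) = Y - 1" "(f ^^ r) z = w"
    and "\<And>j. j < m \<Longrightarrow> s \<le> (\<Sum>i\<le>j. N_fun x y k\<^sub>0 ((f ^^ i) z))" "j < m - r"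
  shows "s - (Y - 1) \<le> (\<Sum>i\<le>j. N_fun x y k\<^sub>0 ((f ^^ i) w))"
proof -
  have "(\<Sum>i\<le>r + j. N_fun x y k\<^sub>0 ((f ^^ i) z))
      = (\<Sum>i<r. N_fun x y k\<^sub>0 ((f ^^ i) z)) + (\<Sum>i\<le>j. N_fun x y k\<^sub>0 ((f ^^ (r + i)) z))"
    by (induction j) (simp_all add: lessThan_Suc_atMost[symmetric])
  moreover have "(f ^^ (r + i)) z = (f ^^ i) w" for i
    using assms(2) by (simp add: funpow_add add.commute[of r])
  moreover have "s \<le> (\<Sum>i\<le>r + j. N_fun x y k\<^sub>0 ((f ^^ i) z))" using assms(4) by (intro assms(3)) auto
  ultimately show ?thesis using assms(1) by simp
qed

end

section \<open>Tail of the first passage time\<close>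

context two_branches
begin

text \<open>Both sides of the hypothesis telescope. On the right the result is the length of \<open>\<Delta>\<close>, since level 0 is the preimage
of \<open>\<Delta>\<close> and Lebesgue measure is invariant. For \<open>k\<^sub>0 = 0\<close> the left-hand side would contain the right-hand side.\<close>

lemma drift_imp:
  assumes "(\<Sum>k. emeasure lebesgue01 (J_left x (k\<^sub>0 + k) \<union> J_right y (k\<^sub>0 + k)))
           < emeasure lebesgue01 (J_left x 0 \<union> J_right y 0)"
  shows "1 \<le> k\<^sub>0" "x k\<^sub>0 + (1 - y k\<^sub>0) < y 0 - x 0"
proof -
  have J: "emeasure lebesgue01 (J_left x n \<union> J_right y n) = ennreal ((x n - x (Suc n)) + (y (Suc n) - y n))" for n
  proof -
    have sub: "J_left x n \<union> J_right y n \<subseteq> {0..1}"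
      using J_left_bounds[of _ n] J_right_bounds[of _ n] order by fastforce
    have m: "J_left x n \<in> sets borel" "J_right y n \<in> sets borel" by (auto simp: J_left_def J_right_def)
    have "emeasure lebesgue01 (J_left x n \<union> J_right y n) = emeasure lborel (J_left x n \<union> J_right y n)"
      using sub m by (subst emeasure_restrict_space) auto
    also have "\<dots> = emeasure lborel (J_left x n) + emeasure lborel (J_right y n)"
    proof (rule plus_emeasure[symmetric])
      show "J_left x n \<inter> J_right y n = {}"
        using J_left_bounds[of _ n] J_right_bounds[of _ n] order by fastforce
    qed (use m in auto)
    also have "\<dots> = ennreal (x n - x (Suc n)) + ennreal (y (Suc n) - y n)"
      using x_bounds(2)[of n] y_bounds(2)[of n] by (simp add: J_left_def J_right_def)
    also have "\<dots> = ennreal ((x n - x (Suc n)) + (y (Suc n) - y n))"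
      using x_bounds(2)[of n] y_bounds(2)[of n] by (intro ennreal_plus[symmetric]) auto
    finally show ?thesis .
  qed
  let ?d = "\<lambda>n. (x n - x (Suc n)) + (y (Suc n) - y n)"
  have d: "0 \<le> ?d n" for n using x_bounds(2)[of n] y_bounds(2)[of n] by simp
  have "(\<lambda>k. (x (k\<^sub>0 + k) - y (k\<^sub>0 + k)) - (x (k\<^sub>0 + Suc k) - y (k\<^sub>0 + Suc k))) sums
      ((x (k\<^sub>0 + 0) - y (k\<^sub>0 + 0)) - (0 - 1))"
  proof (rule telescope_sums')
    show "(\<lambda>k. x (k\<^sub>0 + k) - y (k\<^sub>0 + k)) \<longlonglongrightarrow> 0 - 1"
      by (intro tendsto_diff LIMSEQ_ignore_initial_segment[OF x_lim, of k\<^sub>0, unfolded add.commute[of _ k\<^sub>0]]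
          LIMSEQ_ignore_initial_segment[OF y_lim, of k\<^sub>0, unfolded add.commute[of _ k\<^sub>0]])
  qed
  then have "(\<lambda>k. ?d (k\<^sub>0 + k)) sums (x k\<^sub>0 + (1 - y k\<^sub>0))" by (simp add: algebra_simps)
  then have "(\<Sum>k. ennreal (?d (k\<^sub>0 + k))) = ennreal (x k\<^sub>0 + (1 - y k\<^sub>0))"
    using d by (intro suminf_ennreal_eq)
  then have *: "ennreal (x k\<^sub>0 + (1 - y k\<^sub>0)) < ennreal (?d 0)" using assms unfolding J by simp
  have d0: "?d 0 = y 0 - x 0"
    using F\<^sub>1_eq[of "x 0"] F\<^sub>1_eq[of "y 0"] order F\<^sub>0_y0 F\<^sub>1_x0 x_Suc[of 0] y_Suc[of 0] by simp
  then show 2: "x k\<^sub>0 + (1 - y k\<^sub>0) < y 0 - x 0"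
    using *[unfolded d0] x_unit[of k\<^sub>0] y_unit[of k\<^sub>0]
    by (subst (asm) ennreal_less_iff) auto
  show "1 \<le> k\<^sub>0"
  proof (rule ccontr)
    assume "\<not> 1 \<le> k\<^sub>0"
    then have "k\<^sub>0 = 0" by simp
    then have "x 0 + (1 - y 0) < y 0 - x 0" using 2 by simp
    then show False using d0 x_unit[of "Suc 0"] y_unit[of "Suc 0"] by simp
  qed
qed

text \<open>Height \<open>\<sigma>\<close> stands for the partial sum \<open>\<sigma> - 1\<close> of \<open>N\<close>, so that the heights of a surviving walk are positive
natural numbers.\<close>

definition E :: "nat \<Rightarrow> nat \<Rightarrow> nat \<Rightarrow> real set" where
  "E k\<^sub>0 m \<sigma> = {w\<in>\<Delta>. \<forall>j<m. 1 - int \<sigma> \<le> (\<Sum>i\<le>j. N_fun x y k\<^sub>0 ((f ^^ i) w))}"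

lemma E_measurable: "E k\<^sub>0 m \<sigma> \<in> sets M"
proof -
  have "E k\<^sub>0 m \<sigma> = \<Delta> \<inter> {t\<in>{0..1}. \<forall>j<m. 1 - int \<sigma> \<le> (\<Sum>i\<le>j. N_fun x y k\<^sub>0 ((f ^^ i) t))}"
  proof -
    have "\<Delta> \<subseteq> {0..1}" using order by auto
    then show ?thesis unfolding E_def by blast
  qed
  also have "\<dots> \<in> sets borel" by (rule sets.Int[OF _ walk_set_measurable]) simp
  finally have "E k\<^sub>0 m \<sigma> \<in> sets lborel" by simp
  moreover have "E k\<^sub>0 m \<sigma> \<subseteq> \<Delta>" unfolding E_def by blast
  ultimately show ?thesis using sets_restrict_space_iff[of \<Delta> lborel] by simp
qed

lemma E_0: "1 \<le> m \<Longrightarrow> E k\<^sub>0 m 0 = {}"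
proof -
  assume m: "1 \<le> m"
  have "w \<notin> E k\<^sub>0 m 0" for w
  proof
    assume "w \<in> E k\<^sub>0 m 0"
    then have w: "w \<in> \<Delta>" and le: "\<And>j. j < m \<Longrightarrow> 1 - int 0 \<le> (\<Sum>i\<le>j. N_fun x y k\<^sub>0 ((f ^^ i) w))"
      unfolding E_def by blast+
    have "0 < m" using m by simp
    from le[OF this] have "1 \<le> N_fun x y k\<^sub>0 w" by simp
    then show False using N_on_\<Delta>[OF w, of k\<^sub>0] by simp
  qed
  then show ?thesis by blast
qed

lemma E_step:
  assumes "1 \<le> k\<^sub>0" "1 \<le> \<sigma>" "w \<in> \<Delta>" "h \<omega> w \<in> E k\<^sub>0 m \<sigma>"
  shows "w \<in> E k\<^sub>0 (m - (\<omega> div 2 + 2)) (\<sigma> + (\<omega> div 2 + 1 - k\<^sub>0) - 1)"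
proof -
  have "1 - int (\<sigma> + (\<omega> div 2 + 1 - k\<^sub>0) - 1) \<le> (\<Sum>i\<le>j. N_fun x y k\<^sub>0 ((f ^^ i) w))"
    if "j < m - (\<omega> div 2 + 2)" for j
    using walk_shift[OF return(2,1)[OF assms(3,1), of \<omega>] _ that, of "1 - int \<sigma>"] assms(2,4)
    by (auto simp: E_def)
  then show ?thesis using assms(3) by (simp add: E_def)
qed

lemma entry_E:
  assumes k\<^sub>0: "1 \<le> k\<^sub>0" and w: "w \<in> \<Delta>"
    and e: "e = (\<lambda>k. entryL k w) \<or> e = (\<lambda>k. entryR k w)" and s: "e k \<in> survivors k\<^sub>0 n"
  shows "w \<in> E k\<^sub>0 (n - (k + 1)) (k + 1 - k\<^sub>0)"
proof -
  have e1: "e k \<in> J_left x k \<or> e k \<in> J_right y k" for k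
    using entryL_in[OF w] entryR_in[OF w] e by auto
  have e2: "f (e (Suc k)) = e k" and e3: "f (e 0) = w" for k
    using f_entryL[OF w] f_entryR[OF w] e by auto
  note X = excursion[of e w k\<^sub>0 k, OF e1 e2 e3 k\<^sub>0]
  have "1 - int (k + 1 - k\<^sub>0) \<le> (\<Sum>i\<le>j. N_fun x y k\<^sub>0 ((f ^^ i) w))" if "j < n - Suc k" for j
    using walk_shift[OF X(2)[folded lessThan_Suc_atMost] X(1) _ that, of 0] s
    by (auto simp: survivors_def)
  then show ?thesis using w by (simp add: E_def)
qed

lemma nn_integral_unit_interval:
  fixes v :: "real \<Rightarrow> ennreal"
  assumes [measurable]: "v \<in> borel_measurable borel"
  shows "(\<integral>\<^sup>+t. v t * indicator {0..1} t \<partial>lborel) =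
    (\<integral>\<^sup>+w. v w \<partial>M) + (\<Sum>k. \<integral>\<^sup>+w. ennreal (L.dF (Suc k) w) * v (entryL k w) \<partial>M)
      + (\<Sum>k. \<integral>\<^sup>+w. ennreal (R.dF (Suc k) (1 - w)) * v (entryR k w) \<partial>M)"
proof -
  have "(\<integral>\<^sup>+t. v t * indicator {0..1} t \<partial>lborel)
      = (\<integral>\<^sup>+t. v t * indicator {x 0..y 0} t + v t * indicator {0<..x 0} t + v t * indicator {y 0..<1} t \<partial>lborel)"
  proof (rule nn_integral_cong_AE)
    have "AE t in lborel. t \<notin> range (\<lambda>n. [0, 1, x 0, y 0] ! n)" by (rule AE_lborel_not_in_range)
    then show "AE t in lborel. v t * indicator {0..1} t
        = v t * indicator {x 0..y 0} t + v t * indicator {0<..x 0} t + v t * indicator {y 0..<1} t"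
    proof (rule eventually_mono)
      fix t assume t: "t \<notin> range (\<lambda>n. [0, 1, x 0, y 0] ! n)"
      have "t \<noteq> [0, 1, x 0, y 0] ! n" for n using t by blast
      from this[of 0] this[of 1] this[of 2] this[of 3]
      have "t \<noteq> 0" "t \<noteq> 1" "t \<noteq> x 0" "t \<noteq> y 0" by (simp_all add: numeral_2_eq_2 numeral_3_eq_3)
      then show "v t * indicator {0..1} t
          = v t * indicator {x 0..y 0} t + v t * indicator {0<..x 0} t + v t * indicator {y 0..<1} t"
        using order by (auto simp: indicator_def)
    qed
  qed
  also have "\<dots> = (\<integral>\<^sup>+t. v t * indicator {x 0..y 0} t \<partial>lborel)
      + (\<integral>\<^sup>+t. v t * indicator {0<..x 0} t \<partial>lborel) + (\<integral>\<^sup>+t. v t * indicator {y 0..<1} t \<partial>lborel)"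
    by (subst nn_integral_add | simp)+
  also have "(\<integral>\<^sup>+t. v t * indicator {0<..x 0} t \<partial>lborel)
      = (\<Sum>k. \<integral>\<^sup>+w. ennreal (L.dF (Suc k) w) * v (entryL k w) \<partial>M)"
    unfolding nn_integral_decreasing_partition[of v x 0, OF assms x_bounds(2) x_lim]
    by (simp only: substitution_entryL[OF assms])
  also have "(\<integral>\<^sup>+t. v t * indicator {y 0..<1} t \<partial>lborel)
      = (\<Sum>k. \<integral>\<^sup>+w. ennreal (R.dF (Suc k) (1 - w)) * v (entryR k w) \<partial>M)"
    unfolding nn_integral_increasing_partition[of v y 1, OF assms y_bounds(2) y_lim]
    by (simp only: substitution_entryR[OF assms])
  finally show ?thesis by (simp only: nn_integral_M)
qed

lemma emeasure_M: "emeasure M (space M) = ennreal (y 0 - x 0)"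
  using order by (simp add: emeasure_restrict_space space_restrict_space)

text \<open>A point outside \<open>\<Delta>\<close> at level \<open>k\<close> enters \<open>\<Delta>\<close> after \<open>k + 1\<close> steps, at height at most \<open>k + 1\<close> and with a regular
density whose mass is the length of the level. The bound \<open>survival_bound\<close> for each level is then \<open>n powr - q\<close> times a quantity of
order \<open>(k + 1) powr q\<close> times that length, and these quantities are summable for \<open>q < 1 / \<alpha>\<close>.\<close>

lemma survivors_tail:
  assumes q: "1 < q" "q < 1 / \<alpha>" and k\<^sub>0: "1 \<le> k\<^sub>0" and dr: "x k\<^sub>0 + (1 - y k\<^sub>0) < y 0 - x 0"
  shows "\<exists>T\<ge>0. \<forall>n\<ge>1. emeasure lborel (survivors k\<^sub>0 n) \<le> ennreal (T * real n powr (- q))"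
proof -
  obtain S where S: "0 \<le> S"
    "\<And>k w w'. w \<in> {x 0..y 0} \<Longrightarrow> w' \<in> {x 0..y 0} \<Longrightarrow> dh k w \<le> exp (S * \<bar>w - w'\<bar>) * dh k w'"
    "\<And>k w w'. w \<in> {x 0..y 0} \<Longrightarrow> w' \<in> {x 0..y 0} \<Longrightarrow> L.dF (Suc k) w \<le> exp (S * \<bar>w - w'\<bar>) * L.dF (Suc k) w'"
    "\<And>k w w'. w \<in> {x 0..y 0} \<Longrightarrow> w' \<in> {x 0..y 0} \<Longrightarrow>
      R.dF (Suc k) (1 - w) \<le> exp (S * \<bar>w - w'\<bar>) * R.dF (Suc k) (1 - w')"
    by (rule distortion) (rule that, assumption+)
  let ?Y = "\<lambda>\<omega>. \<omega> div 2 + 1 - k\<^sub>0" and ?r = "\<lambda>\<omega>. \<omega> div 2 + 2"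
  have sp: "space M = \<Delta>" by (simp add: space_restrict_space)
  interpret D: drifting_system M "x 0" "y 0" h "\<lambda>\<omega> w. ennreal (dh \<omega> w)" \<theta> S ?Y ?r q
  proof unfold_locales
    show "space M = \<Delta>" by (rule sp)
    show "x 0 < y 0" using order by simp
    show "emeasure M (space M) = ennreal (y 0 - x 0)" by (rule emeasure_M)
    show "0 \<le> \<theta>" "\<theta> < 1" by (rule \<theta>_bounds)+
    show "0 \<le> S" by (rule S)
    show "h \<omega> \<in> M \<rightarrow>\<^sub>M M" for \<omega> by (rule h_measurable)
    show "(\<lambda>w. ennreal (dh \<omega> w)) \<in> borel_measurable M" for \<omega>
      by (intro measurable_compose[OF continuous_imp_measurable_M[OF dh_continuous] measurable_ennreal])
    show "\<bar>h \<omega> w - h \<omega> w'\<bar> \<le> \<theta> * \<bar>w - w'\<bar>" if "w \<in> space M" "w' \<in> space M" for \<omega> w w'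
      using that unfolding sp by (intro h_contracting) auto
    show "ennreal (dh \<omega> w) \<le> ennreal (exp (S * \<bar>w - w'\<bar>)) * ennreal (dh \<omega> w')"
      if "w \<in> space M" "w' \<in> space M" for \<omega> w w'
      using S(2)[of w w' \<omega>] that unfolding sp by (simp add: ennreal_mult'[symmetric] ennreal_leI)
    show "(\<Sum>\<omega>. ennreal (dh \<omega> w)) = 1" if "w \<in> space M" for w
      using that unfolding sp by (rule dh_sum)
    show "(\<integral>\<^sup>+w. v w \<partial>M) = (\<Sum>\<omega>. \<integral>\<^sup>+w. ennreal (dh \<omega> w) * v (h \<omega> w) \<partial>M)"
      if "v \<in> borel_measurable M" for v using that by (rule nn_integral_transfer)
    show "1 < q" by (rule q)
    show "?Y \<omega> \<le> ?r \<omega>" "1 \<le> ?r \<omega>" for \<omega> by auto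
    show "(\<Sum>\<omega>. ennreal (real (?Y \<omega>)) * (\<integral>\<^sup>+w. ennreal (dh \<omega> w) \<partial>M)) < ennreal (y 0 - x 0)"
    proof (rule le_less_trans[OF mean_increment_le])
      show "ennreal (x k\<^sub>0 + (1 - y k\<^sub>0)) < ennreal (y 0 - x 0)"
        using dr x_unit[of k\<^sub>0] y_unit[of k\<^sub>0] by (subst ennreal_less_iff) auto
    qed
    show "(\<Sum>\<omega>. ennreal (real (?r \<omega>) powr q) * (\<integral>\<^sup>+w. ennreal (dh \<omega> w) \<partial>M)) < \<infinity>"
    proof -
      have le: "ennreal (real (k + 2) powr q) * ennreal (L.gap k - L.gap (Suc k)) \<le> ennreal (real (k + 2) powr q) * ennreal (L.gap k)"
        "ennreal (real (k + 2) powr q) * ennreal (R.gap k - R.gap (Suc k)) \<le> ennreal (real (k + 2) powr q) * ennreal (R.gap k)" for k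
        using L.gap_pos[of "Suc k"] R.gap_pos[of "Suc k"] by (auto intro!: mult_left_mono ennreal_leI)
      have "(\<Sum>k. ennreal (real (k + 2) powr q) * ennreal (L.gap k - L.gap (Suc k))) < \<infinity>"
      proof (rule le_less_trans)
        show "(\<Sum>k. ennreal (real (k + 2) powr q) * ennreal (L.gap k - L.gap (Suc k)))
            \<le> (\<Sum>k. ennreal (real (k + 2) powr q) * ennreal (L.gap k))"
          by (intro suminf_le le(1)) simp_all
        show "(\<Sum>k. ennreal (real (k + 2) powr q) * ennreal (L.gap k)) < \<infinity>"
          by (rule finite_power_moment(1)[OF q, of 2]) auto
      qed
      moreover have "(\<Sum>k. ennreal (real (k + 2) powr q) * ennreal (R.gap k - R.gap (Suc k))) < \<infinity>"
      proof (rule le_less_trans)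
        show "(\<Sum>k. ennreal (real (k + 2) powr q) * ennreal (R.gap k - R.gap (Suc k)))
            \<le> (\<Sum>k. ennreal (real (k + 2) powr q) * ennreal (R.gap k))"
          by (intro suminf_le le(2)) simp_all
        show "(\<Sum>k. ennreal (real (k + 2) powr q) * ennreal (R.gap k)) < \<infinity>"
          by (rule finite_power_moment(2)[OF q, of 2]) auto
      qed
      ultimately show ?thesis
        by (subst suminf_even_odd) (simp only: mass_dh, simp add: ennreal_add_eq_top less_top)
    qed
  qed
  obtain A where A: "0 \<le> A" "\<And>n m \<sigma> t \<rho>. D.regular D.R \<rho> \<Longrightarrow> n \<le> m + t \<Longrightarrow>
    ennreal (real n powr q) * (\<integral>\<^sup>+w. \<rho> w * indicator (E k\<^sub>0 m \<sigma>) w \<partial>M)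
      \<le> ennreal (A * (real \<sigma> + real t + 1) powr q) * (\<integral>\<^sup>+w. \<rho> w \<partial>M)"
    using D.survival_bound[of "E k\<^sub>0", OF E_measurable E_0 E_step[OF k\<^sub>0]] unfolding sp by blast
  have SR: "S \<le> D.R"
  proof -
    have "S \<le> S + 1" by simp
    also have "\<dots> = (1 - \<theta>) * D.R" using \<theta>_bounds by (simp add: D.R_def)
    also have "\<dots> \<le> 1 * D.R" using \<theta>_bounds D.R_ge_1 by (intro mult_right_mono) auto
    finally show ?thesis by simp
  qed
  have regular: "D.regular D.R (\<lambda>w. ennreal (d w))"
    and mass: "(\<integral>\<^sup>+w. ennreal (d w) \<partial>M) \<le> ennreal (b * (y 0 - x 0))"
    if cont: "continuous_on {x 0..y 0} d" and dist: "\<And>w w'. w \<in> {x 0..y 0} \<Longrightarrow> w' \<in> {x 0..y 0} \<Longrightarrow> d w \<le> exp (S * \<bar>w - w'\<bar>) * d w'"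
      and le: "\<And>w. w \<in> {x 0..y 0} \<Longrightarrow> d w \<le> b" and b: "0 \<le> b" for d b
  proof -
    have "(\<integral>\<^sup>+w. ennreal (d w) \<partial>M) \<le> (\<integral>\<^sup>+w. ennreal b \<partial>M)"
      using le by (intro nn_integral_mono ennreal_leI) (auto simp: sp)
    also have "\<dots> = ennreal (b * (y 0 - x 0))" 
      unfolding nn_integral_const emeasure_M using order b by (simp add: ennreal_mult)
    finally show m: "(\<integral>\<^sup>+w. ennreal (d w) \<partial>M) \<le> ennreal (b * (y 0 - x 0))" .
    have "D.regular S (\<lambda>w. ennreal (d w))"
      unfolding D.regular_def
    proof (intro conjI ballI)
      show "(\<lambda>w. ennreal (d w)) \<in> borel_measurable M"
        by (intro measurable_compose[OF continuous_imp_measurable_M[OF cont] measurable_ennreal])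
      show "(\<integral>\<^sup>+w. ennreal (d w) \<partial>M) < \<infinity>" using m by (rule le_less_trans) simp
      fix w w' assume "w \<in> space M" "w' \<in> space M"
      then show "ennreal (d w) \<le> ennreal (exp (S * \<bar>w - w'\<bar>)) * ennreal (d w')"
        using dist[of w w'] unfolding sp by (simp add: ennreal_mult'[symmetric] ennreal_leI)
    qed
    then show "D.regular D.R (\<lambda>w. ennreal (d w))" using SR by (rule D.regular_mono)
  qed
  define gL where "gL k = L.G * L.gap k * (y 0 - x 0)" for k
  define gR where "gR k = R.G * R.gap k * (y 0 - x 0)" for k
  have entry: "ennreal (real n powr q) * (\<integral>\<^sup>+w. ennreal (d w) * indicator (survivors k\<^sub>0 n) (e w) \<partial>M)
      \<le> ennreal (A * (2 * real k + 3) powr q) * ennreal (b * (y 0 - x 0))"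
    if d: "continuous_on {x 0..y 0} d" "\<And>w w'. w \<in> {x 0..y 0} \<Longrightarrow> w' \<in> {x 0..y 0} \<Longrightarrow> d w \<le> exp (S * \<bar>w - w'\<bar>) * d w'"
      "\<And>w. w \<in> {x 0..y 0} \<Longrightarrow> d w \<le> b" "0 \<le> b"
      and e: "\<And>w. w \<in> \<Delta> \<Longrightarrow> e w \<in> survivors k\<^sub>0 n \<Longrightarrow> w \<in> E k\<^sub>0 (n - (k + 1)) (k + 1 - k\<^sub>0)" for d b e k n
  proof -
    have nk: "n \<le> (n - (k + 1)) + (k + 1)" by (rule le_diff_conv[THEN iffD1, OF order_refl])
    have "ennreal (real n powr q) * (\<integral>\<^sup>+w. ennreal (d w) * indicator (survivors k\<^sub>0 n) (e w) \<partial>M)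
        \<le> ennreal (real n powr q) * (\<integral>\<^sup>+w. ennreal (d w) * indicator (E k\<^sub>0 (n - (k + 1)) (k + 1 - k\<^sub>0)) w \<partial>M)"
      using e by (intro mult_left_mono nn_integral_mono) (auto simp: sp indicator_def)
    also have "\<dots> \<le> ennreal (A * (real (k + 1 - k\<^sub>0) + real (k + 1) + 1) powr q) * (\<integral>\<^sup>+w. ennreal (d w) \<partial>M)"
      by (rule A(2)[OF regular[OF d] nk])
    also have "\<dots> \<le> ennreal (A * (2 * real k + 3) powr q) * ennreal (b * (y 0 - x 0))"
      using A(1) q by (intro mult_mono mass[OF d] ennreal_leI mult_left_mono powr_mono2) auto
    finally show ?thesis .
  qed
  define Tot where "Tot = ennreal (A * 2 powr q) * ennreal (y 0 - x 0)
      + (\<Sum>k. ennreal (A * (2 * real k + 3) powr q) * ennreal (gL k))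
      + (\<Sum>k. ennreal (A * (2 * real k + 3) powr q) * ennreal (gR k))"
  have bound: "ennreal (real n powr q) * emeasure lborel (survivors k\<^sub>0 n) \<le> Tot" if n: "1 \<le> n" for n
  proof -
    let ?v = "\<lambda>t. indicator (survivors k\<^sub>0 n) t :: ennreal"
    have [measurable]: "?v \<in> borel_measurable borel" using survivors_measurable by (rule borel_measurable_indicator)
    have "emeasure lborel (survivors k\<^sub>0 n) = (\<integral>\<^sup>+t. ?v t * indicator {0..1} t \<partial>lborel)"
    proof -
      have "?v t * indicator {0..1} t = ?v t" for t by (auto simp: survivors_def indicator_def)
      then show ?thesis using survivors_measurable by simp
    qed
    also have "\<dots> = (\<integral>\<^sup>+w. ?v w \<partial>M) + (\<Sum>k. \<integral>\<^sup>+w. ennreal (L.dF (Suc k) w) * ?v (entryL k w) \<partial>M)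
      + (\<Sum>k. \<integral>\<^sup>+w. ennreal (R.dF (Suc k) (1 - w)) * ?v (entryR k w) \<partial>M)"
      by (rule nn_integral_unit_interval) simp
    finally have eq: "ennreal (real n powr q) * emeasure lborel (survivors k\<^sub>0 n)
      = ennreal (real n powr q) * (\<integral>\<^sup>+w. ?v w \<partial>M)
      + (\<Sum>k. ennreal (real n powr q) * (\<integral>\<^sup>+w. ennreal (L.dF (Suc k) w) * ?v (entryL k w) \<partial>M))
      + (\<Sum>k. ennreal (real n powr q) * (\<integral>\<^sup>+w. ennreal (R.dF (Suc k) (1 - w)) * ?v (entryR k w) \<partial>M))"
      by (simp add: distrib_left)
    have "ennreal (real n powr q) * (\<integral>\<^sup>+w. ?v w \<partial>M) \<le> ennreal (A * 2 powr q) * ennreal (y 0 - x 0)"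
    proof -
      have "(\<integral>\<^sup>+w. ?v w \<partial>M) \<le> (\<integral>\<^sup>+w. 1 * indicator (E k\<^sub>0 n 1) w \<partial>M)"
        by (intro nn_integral_mono) (auto simp: sp survivors_def E_def indicator_def)
      then have "ennreal (real n powr q) * (\<integral>\<^sup>+w. ?v w \<partial>M)
          \<le> ennreal (real n powr q) * (\<integral>\<^sup>+w. 1 * indicator (E k\<^sub>0 n 1) w \<partial>M)"
        by (intro mult_left_mono) auto
      also have "\<dots> \<le> ennreal (A * (real 1 + real 0 + 1) powr q) * (\<integral>\<^sup>+w. 1 \<partial>M)"
        by (rule A(2)[OF D.regular_const]) simp_all
      finally show ?thesis unfolding nn_integral_const emeasure_M by simp
    qed
    moreover have "ennreal (real n powr q) * (\<integral>\<^sup>+w. ennreal (L.dF (Suc k) w) * ?v (entryL k w) \<partial>M)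
        \<le> ennreal (A * (2 * real k + 3) powr q) * ennreal (gL k)" for k
      unfolding gL_def
    proof (rule entry[OF L.dF_continuous S(3)])
      show "L.dF (Suc k) w \<le> L.G * L.gap k" if "w \<in> {x 0..y 0}" for w
        using that by (intro L.dF_le_gap) auto
      show "0 \<le> L.G * L.gap k" using L.G_pos L.gap_pos[of k] by simp
      show "w \<in> E k\<^sub>0 (n - (k + 1)) (k + 1 - k\<^sub>0)" if "w \<in> \<Delta>" "entryL k w \<in> survivors k\<^sub>0 n" for w
        using entry_E[OF k\<^sub>0 that(1), of "\<lambda>k. entryL k w"] that(2) by simp
    qed
    moreover have "ennreal (real n powr q) * (\<integral>\<^sup>+w. ennreal (R.dF (Suc k) (1 - w)) * ?v (entryR k w) \<partial>M)
        \<le> ennreal (A * (2 * real k + 3) powr q) * ennreal (gR k)" for k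
      unfolding gR_def
    proof (rule entry[OF reflect_continuous[OF R.dF_continuous] S(4)])
      show "R.dF (Suc k) (1 - w) \<le> R.G * R.gap k" if "w \<in> {x 0..y 0}" for w
        using that by (intro R.dF_le_gap) auto
      show "0 \<le> R.G * R.gap k" using R.G_pos R.gap_pos[of k] by simp
      show "w \<in> E k\<^sub>0 (n - (k + 1)) (k + 1 - k\<^sub>0)" if "w \<in> \<Delta>" "entryR k w \<in> survivors k\<^sub>0 n" for w
        using entry_E[OF k\<^sub>0 that(1), of "\<lambda>k. entryR k w"] that(2) by simp
    qed
    ultimately show ?thesis
      unfolding eq Tot_def by (intro add_mono suminf_le) auto
  qed
  have "Tot < \<infinity>"
  proof -
    have "(\<Sum>k. ennreal (A * (2 * real k + 3) powr q) * ennreal (gL k)) < \<infinity>"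
    proof -
      have "ennreal (A * (2 * real k + 3) powr q) * ennreal (gL k)
          = ennreal (A * L.G * (y 0 - x 0)) * (ennreal ((2 * real k + 3) powr q) * ennreal (L.gap k))" for k
        using A(1) L.G_pos L.gap_pos[of k] order
        by (simp add: gL_def ennreal_mult[symmetric] less_imp_le mult_ac)
      then have "(\<Sum>k. ennreal (A * (2 * real k + 3) powr q) * ennreal (gL k))
          = ennreal (A * L.G * (y 0 - x 0)) * (\<Sum>k. ennreal ((2 * real k + 3) powr q) * ennreal (L.gap k))"
        by simp
      then show ?thesis
        using finite_power_moment(1)[OF q, of 3 "\<lambda>k. 2 * real k + 3"] by (simp add: ennreal_mult_less_top)
    qed
    moreover have "(\<Sum>k. ennreal (A * (2 * real k + 3) powr q) * ennreal (gR k)) < \<infinity>"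
    proof -
      have "ennreal (A * (2 * real k + 3) powr q) * ennreal (gR k)
          = ennreal (A * R.G * (y 0 - x 0)) * (ennreal ((2 * real k + 3) powr q) * ennreal (R.gap k))" for k
        using A(1) R.G_pos R.gap_pos[of k] order
        by (simp add: gR_def ennreal_mult[symmetric] less_imp_le mult_ac)
      then have "(\<Sum>k. ennreal (A * (2 * real k + 3) powr q) * ennreal (gR k))
          = ennreal (A * R.G * (y 0 - x 0)) * (\<Sum>k. ennreal ((2 * real k + 3) powr q) * ennreal (R.gap k))"
        by simp
      then show ?thesis
        using finite_power_moment(2)[OF q, of 3 "\<lambda>k. 2 * real k + 3"] by (simp add: ennreal_mult_less_top)
    qed
    ultimately show ?thesis by (simp add: Tot_def ennreal_mult_less_top)
  qed
  then obtain T where T: "0 \<le> T" "Tot = ennreal T" by (cases Tot) auto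
  have "emeasure lborel (survivors k\<^sub>0 n) \<le> ennreal (T * real n powr (- q))" if n: "1 \<le> n" for n
  proof -
    have np: "real n powr (- q) * real n powr q = 1" using n by (simp add: powr_add[symmetric])
    have "ennreal (real n powr (- q)) * (ennreal (real n powr q) * emeasure lborel (survivors k\<^sub>0 n))
        \<le> ennreal (real n powr (- q)) * ennreal T"
      using bound[OF n] T by (intro mult_left_mono) auto
    moreover have "ennreal (real n powr (- q)) * ennreal (real n powr q) = 1"
      using np by (simp add: ennreal_mult[symmetric])
    ultimately show ?thesis
      using T(1) by (simp add: mult.assoc[symmetric] ennreal_mult[symmetric] mult.commute)
  qed
  then show ?thesis using T(1) by blast
qed

end

section \<open>Hyperbolic times\<close>

lemma cube_le_of_square_bound:
  fixes k s d e :: real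
  assumes "0 < k" "0 \<le> s" "k * s\<^sup>2 \<le> d" "d \<le> k * e\<^sup>2" "0 \<le> e" "e \<le> k"
  shows "s \<le> e" "s ^ 3 \<le> d"
proof -
  have "k * s\<^sup>2 \<le> k * e\<^sup>2" using assms by linarith
  then have "s\<^sup>2 \<le> e\<^sup>2" using assms(1) by simp
  then show "s \<le> e" using assms(5) by (rule power2_le_imp_le)
  then have "s * s\<^sup>2 \<le> k * s\<^sup>2" using assms by (intro mult_right_mono) auto
  then show "s ^ 3 \<le> d" using assms(3) by (simp add: power3_eq_cube power2_eq_square mult.assoc)
qed

lemma infdist_three:
  fixes z :: real
  obtains w where "w \<in> {p, q, r}" "infdist z {p, q, r} = \<bar>z - w\<bar>"
  using infdist_attains_inf[of "{p, q, r}" z] by (auto simp: dist_real_def)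

lemma sequence_bracket:
  fixes s :: "nat \<Rightarrow> real"
  assumes "s \<longlonglongrightarrow> 0" "0 < z" "z < s 0"
  obtains k where "s (Suc k) < z" "z \<le> s k"
proof -
  have "\<forall>\<^sub>F n in sequentially. s n < z" using assms by (intro order_tendstoD(2)) auto
  then have ex: "\<exists>n. s n < z" by (auto simp: eventually_sequentially)
  define m where "m = (LEAST n. s n < z)"
  have m: "s m < z" unfolding m_def using ex by (rule LeastI_ex)
  have "m \<noteq> 0"
  proof
    assume "m = 0"
    with m assms(3) show False by simp
  qed
  then obtain k where k: "m = Suc k" by (cases m) auto
  have "\<not> s k < z" using not_less_Least[of k "\<lambda>n. s n < z"] k by (simp add: m_def[symmetric])
  then show ?thesis using that[of k] m k by simp
qed

lemma square_le_powr:
  assumes "0 < s" "s \<le> 1" "p < (1::real)" "0 \<le> K"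
  shows "K * s\<^sup>2 \<le> K * s powr (1 + p)"
proof -
  have "s powr 2 \<le> s powr (1 + p)" using assms by (intro powr_mono') auto
  then show ?thesis using assms by (intro mult_left_mono) (auto simp: powr_numeral)
qed

context two_branches
begin

lemma f_fixed: "f 0 = 0" "f 1 = 1" "f a = 1"
  using f_F\<^sub>0[of 0] f_F\<^sub>1[of 1] f_F\<^sub>0[of 1] by (simp_all add: F\<^sub>0_0 F\<^sub>1_1 F\<^sub>0_1)

abbreviation S :: "real set" where "S \<equiv> {0, a, 1}"

lemma f_S: "z \<in> S \<Longrightarrow> f z \<in> S"
  using f_fixed by auto

lemma iter_S: "z \<in> S \<Longrightarrow> (f ^^ i) z \<in> S"
  by (induction i) (simp_all add: f_S del: insert_iff)

abbreviation J\<^sub>0 :: "real set" where "J\<^sub>0 \<equiv> J_left x 0 \<union> J_right y 0"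

lemma S_J: "z \<in> S \<Longrightarrow> z \<notin> J\<^sub>0"
  using J_left_bounds[of z 0] J_right_bounds[of z 0] order by auto

lemma J\<^sub>0_iff: "z \<in> J\<^sub>0 \<longleftrightarrow> x 1 < z \<and> z < x 0 \<or> y 0 < z \<and> z < y 1"
  by (simp add: J_left_def J_right_def)

lemma f_x: "f (x (Suc n)) = x n" and f_y: "f (y (Suc n)) = y n"
  using partition by (auto simp: partition_points_def)

lemma iter_near_0:
  "0 \<le> z \<Longrightarrow> z \<le> x k \<Longrightarrow> i \<le> k \<Longrightarrow> 0 \<le> (f ^^ i) z \<and> (f ^^ i) z \<le> x (k - i)"
proof (induction i)
  case (Suc i)
  let ?w = "(f ^^ i) z"
  have w: "0 \<le> ?w" "?w \<le> x (Suc (k - Suc i))" using Suc by (auto simp: Suc_diff_Suc)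
  have "x (Suc (k - Suc i)) \<le> a" using x_bounds(3)[of "Suc (k - Suc i)"] order by simp
  then have "f ?w \<le> f (x (Suc (k - Suc i)))" using w by (intro f_mono(1)) auto
  then show ?case using w f_range[of ?w] \<open>x (Suc (k - Suc i)) \<le> a\<close> order by (simp add: f_x)
qed simp

lemma iter_near_1:
  "z \<le> 1 \<Longrightarrow> y k \<le> z \<Longrightarrow> i \<le> k \<Longrightarrow> (f ^^ i) z \<le> 1 \<and> y (k - i) \<le> (f ^^ i) z"
proof (induction i)
  case (Suc i)
  let ?w = "(f ^^ i) z"
  have w: "?w \<le> 1" "y (Suc (k - Suc i)) \<le> ?w" using Suc by (auto simp: Suc_diff_Suc)
  have "a < y (Suc (k - Suc i))" using y_bounds(3)[of "Suc (k - Suc i)"] order by simp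
  then have "f (y (Suc (k - Suc i))) \<le> f ?w" using w by (intro f_mono(2)) auto
  then show ?case using w f_range[of ?w] \<open>a < y (Suc (k - Suc i))\<close> order by (simp add: f_y)
qed simp

lemma hitting_near_0:
  assumes "0 \<le> z" "z \<le> x k" "(f ^^ i) z \<in> J\<^sub>0"
  shows "k \<le> i"
proof (rule ccontr)
  assume i: "\<not> k \<le> i"
  then have "(f ^^ i) z \<le> x (k - i)" using iter_near_0[of z k i] assms by simp
  also have "\<dots> \<le> x 1" using i by (intro x_antimono) simp
  finally show False using assms(3) x_bounds(3)[of 1] order unfolding J\<^sub>0_iff by linarith
qed

lemma hitting_near_1:
  assumes "z \<le> 1" "y k \<le> z" "(f ^^ i) z \<in> J\<^sub>0"
  shows "k \<le> i"
proof (rule ccontr)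
  assume i: "\<not> k \<le> i"
  have "y 1 \<le> y (k - i)" using i by (intro y_mono) simp
  also have "\<dots> \<le> (f ^^ i) z" using iter_near_1[of z k i] assms i by simp
  finally show False using assms(3) y_bounds(3)[of 1] order unfolding J\<^sub>0_iff by linarith
qed

text \<open>A point below \<open>x k\<close> needs at least \<open>k\<close> steps to reach level 0, and \<open>x k\<close> decays more slowly than any exponential.\<close>

lemma distance_near_0:
  assumes "0 < \<tau>" "\<tau> < 1"
  shows "\<exists>\<delta>>0. \<forall>z i. 0 \<le> z \<longrightarrow> z \<le> \<delta> \<longrightarrow> (f ^^ i) z \<in> J\<^sub>0 \<longrightarrow> \<tau> ^ Suc i \<le> z"
proof -
  obtain K where K: "\<And>n. K \<le> n \<Longrightarrow> \<tau> ^ n \<le> x n"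
    using L.eventually_geometric_le_x[OF assms] by (auto simp: eventually_sequentially L_x)
  have "\<tau> ^ Suc i \<le> z" if z: "0 \<le> z" "z \<le> x (Suc K)" "(f ^^ i) z \<in> J\<^sub>0" for z i
  proof -
    have "z \<noteq> 0" using z(3) iter_S[of 0 i] S_J by blast
    then have z0: "0 < z" using z(1) by simp
    have "z < x 0" using z(2) x_bounds(2)[of K] x_antimono[of 0 K] by simp
    then obtain k where k: "x (Suc k) < z" "z \<le> x k"
      using sequence_bracket[OF x_lim z0] by blast
    have ki: "k \<le> i" using hitting_near_0 z k by blast
    have "K \<le> Suc k"
    proof (rule ccontr)
      assume "\<not> K \<le> Suc k"
      then have "x (Suc K) \<le> x (Suc k)" by (intro x_antimono) simp
      then show False using k z by simp
    qed
    then have "\<tau> ^ Suc k \<le> x (Suc k)" by (rule K)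
    moreover have "\<tau> ^ Suc i \<le> \<tau> ^ Suc k" using ki assms by (intro power_decreasing) auto
    ultimately show ?thesis using k by linarith
  qed
  then show ?thesis using x_bounds(1)[of "Suc K"] by (intro exI[of _ "x (Suc K)"]) blast
qed

lemma distance_near_1:
  assumes "0 < \<tau>" "\<tau> < 1"
  shows "\<exists>\<delta>>0. \<forall>z i. z \<le> 1 \<longrightarrow> 1 - z \<le> \<delta> \<longrightarrow> (f ^^ i) z \<in> J\<^sub>0 \<longrightarrow> \<tau> ^ Suc i \<le> 1 - z"
proof -
  obtain K where K: "\<And>n. K \<le> n \<Longrightarrow> \<tau> ^ n \<le> 1 - y n"
    using R.eventually_geometric_le_x[OF assms] by (auto simp: eventually_sequentially R_x)
  have "\<tau> ^ Suc i \<le> 1 - z" if z: "z \<le> 1" "1 - z \<le> 1 - y (Suc K)" "(f ^^ i) z \<in> J\<^sub>0" for z i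
  proof -
    have "z \<noteq> 1" using z(3) iter_S[of 1 i] S_J by blast
    then have z0: "0 < 1 - z" using z(1) by simp
    have "1 - z < 1 - y 0" using z(2) y_bounds(2)[of K] y_mono[of 0 K] by simp
    moreover have "(\<lambda>n. 1 - y n) \<longlonglongrightarrow> 0" using tendsto_diff[OF tendsto_const y_lim, of 1] by simp
    ultimately obtain k where "1 - y (Suc k) < 1 - z" "1 - z \<le> 1 - y k"
      using sequence_bracket[of "\<lambda>n. 1 - y n" "1 - z"] z0 by blast
    then have k: "z < y (Suc k)" "y k \<le> z" by simp_all
    have ki: "k \<le> i" using hitting_near_1 z k by blast
    have "K \<le> Suc k"
    proof (rule ccontr)
      assume "\<not> K \<le> Suc k"
      then have "y (Suc k) \<le> y (Suc K)" by (intro y_mono) simp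
      then show False using k z by simp
    qed
    then have "\<tau> ^ Suc k \<le> 1 - y (Suc k)" by (rule K)
    moreover have "\<tau> ^ Suc i \<le> \<tau> ^ Suc k" using ki assms by (intro power_decreasing) auto
    ultimately show ?thesis using k by linarith
  qed
  then show ?thesis using y_bounds(1)[of "Suc K"] by (intro exI[of _ "1 - y (Suc K)"]) auto
qed

lemma f_inside:
  assumes "0 < z" "z < 1" "z \<noteq> a"
  shows "0 < f z" "f z < 1"
proof -
  have r: "0 \<le> f z" "f z \<le> 1" using f_range[of z] assms by auto
  have "f z \<noteq> 0 \<and> f z \<noteq> 1"
  proof (cases "z < a")
    case True
    then have "F\<^sub>0 (f z) = z" using assms by (intro F\<^sub>0_f) auto
    then show ?thesis using True assms F\<^sub>0_0 F\<^sub>0_1 by auto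
  next
    case False
    then have "F\<^sub>1 (f z) = z" using assms by (intro F\<^sub>1_f) auto
    then show ?thesis using assms F\<^sub>1_0 F\<^sub>1_1 by auto
  qed
  then show "0 < f z" "f z < 1" using r by auto
qed

lemma f_ge: "0 \<le> z \<Longrightarrow> z \<le> a \<Longrightarrow> z \<le> f z"
  using F\<^sub>0_f[of z] L.F_le[of "f z"] f_range[of z] order by (simp add: F\<^sub>0_def)

lemma f_le: "a < z \<Longrightarrow> z \<le> 1 \<Longrightarrow> f z \<le> z"
  using F\<^sub>1_f[of z] F\<^sub>1_eq[of "f z"] F\<^sub>0_range[of "f z"] f_range[of z] order by auto

text \<open>The map expands infinitely at \<open>a\<close>: a point at distance \<open>d\<close> from \<open>a\<close> is sent to a point at distance \<open>s\<close> from 0 or 1,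
where \<open>d\<close> is at least a multiple of \<open>s\<^sup>2\<close>, hence at least \<open>s ^ 3\<close> for small \<open>s\<close>. This reduces the claim to the two
fixed points, with the cube root of \<open>\<tau>\<close>.\<close>

lemma distance_near_a:
  assumes \<tau>: "0 < \<tau>" "\<tau> < 1"
  shows "\<exists>\<delta>>0. \<forall>z i. \<bar>z - a\<bar> \<le> \<delta> \<longrightarrow> (f ^^ i) z \<in> J\<^sub>0 \<longrightarrow> \<tau> ^ Suc i \<le> \<bar>z - a\<bar>"
proof -
  define \<tau>' where "\<tau>' = root 3 \<tau>"
  have \<tau>': "0 < \<tau>'" "\<tau>' < 1" "\<tau>' ^ 3 = \<tau>" using \<tau> by (auto simp: \<tau>'_def)
  obtain e0 where e0: "0 < e0" "\<And>z i. 0 \<le> z \<Longrightarrow> z \<le> e0 \<Longrightarrow> (f ^^ i) z \<in> J\<^sub>0 \<Longrightarrow> \<tau>' ^ Suc i \<le> z"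
    using distance_near_0[OF \<tau>'(1,2)] by blast
  obtain e1 where e1: "0 < e1" "\<And>z i. z \<le> 1 \<Longrightarrow> 1 - z \<le> e1 \<Longrightarrow> (f ^^ i) z \<in> J\<^sub>0 \<Longrightarrow> \<tau>' ^ Suc i \<le> 1 - z"
    using distance_near_1[OF \<tau>'(1,2)] by blast
  define k where "k = min c c' / 4"
  have k: "0 < k" "k \<le> c / 4" "k \<le> c' / 4" using L.c R.c by (auto simp: k_def)
  define e where "e = min k (min e0 e1)"
  have e: "0 < e" "e \<le> k" "e \<le> e0" "e \<le> e1" using k e0 e1 by (auto simp: e_def)
  define \<delta> where "\<delta> = min (k * e\<^sup>2) (min ((a - x 0) / 2) ((y 0 - a) / 2))"
  have "\<delta> \<le> (a - x 0) / 2" "\<delta> \<le> (y 0 - a) / 2" unfolding \<delta>_def by linarith+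
  then have \<delta>: "0 < \<delta>" "\<delta> \<le> k * e\<^sup>2" "\<delta> < a - x 0" "\<delta> < y 0 - a"
    using k e order by (simp_all add: \<delta>_def)
  have conclude: "\<tau> ^ Suc i \<le> d"
    if s: "\<tau>' ^ i \<le> s" "s ^ 3 \<le> d" for s d :: real and i
  proof -
    have "\<tau> ^ Suc i \<le> \<tau> ^ i" using \<tau> by (intro power_decreasing) auto
    also have "\<dots> = (\<tau>' ^ i) ^ 3" by (simp add: \<tau>'(3)[symmetric] power_mult[symmetric] mult.commute)
    also have "\<dots> \<le> s ^ 3" using s \<tau>' by (intro power_mono) auto
    finally show ?thesis using s by simp
  qed
  have "\<tau> ^ Suc i \<le> \<bar>z - a\<bar>" if z: "\<bar>z - a\<bar> \<le> \<delta>" and i: "(f ^^ i) z \<in> J\<^sub>0" for z i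
  proof -
    have zr: "x 0 < z" "z < y 0" using z \<delta> by linarith+
    have "i \<noteq> 0"
    proof
      assume "i = 0"
      then show False using i zr x_bounds(2)[of 0] unfolding J\<^sub>0_iff by simp
    qed
    then obtain j where j: "i = Suc j" by (cases i) auto
    have fz: "(f ^^ j) (f z) \<in> J\<^sub>0" using i j by (simp add: funpow_swap1)
    have "z \<noteq> a" using i iter_S[of a i] S_J by blast
    then have fi: "0 < f z" "f z < 1" using zr order by (auto intro!: f_inside)
    show ?thesis
    proof (cases "z < a")
      case True
      define s where "s = 1 - f z"
      have s: "0 < s" "s < 1" using fi by (auto simp: s_def)
      have "s \<le> 1 - x 0" using f_ge[of z] True zr order by (simp add: s_def)
      then have "c' / 4 * s powr (1 + \<beta>) \<le> s - R.F s" using s by (intro R.gap_lower)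
      also have "\<dots> = a - z" using R_F_eq[of s] s F\<^sub>0_f[of z] True zr order by (simp add: s_def)
      finally have g: "c' / 4 * s powr (1 + \<beta>) \<le> a - z" .
      have "k * s\<^sup>2 \<le> c' / 4 * s\<^sup>2" using k by (intro mult_right_mono) auto
      also have "\<dots> \<le> c' / 4 * s powr (1 + \<beta>)" using s R.\<beta> R.c by (intro square_le_powr) auto
      finally have "k * s\<^sup>2 \<le> a - z" using g by simp
      moreover have "a - z \<le> k * e\<^sup>2" using z True \<delta>(2) by simp
      ultimately have "s \<le> e" "s ^ 3 \<le> a - z"
        using cube_le_of_square_bound[of k s "a - z" e] k e s by auto
      moreover have "\<tau>' ^ i \<le> s"
        using e1(2)[of "f z" j] fz fi \<open>s \<le> e\<close> e j by (simp add: s_def)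
      ultimately show ?thesis using conclude[of i s "a - z"] True by simp
    next
      case False
      then have az: "a < z" using \<open>z \<noteq> a\<close> by simp
      define s where "s = f z"
      have s: "0 < s" "s < 1" using fi by (auto simp: s_def)
      have "s \<le> y 0" using f_le[of z] az zr order by (simp add: s_def)
      then have "c / 4 * s powr (1 + \<alpha>) \<le> s - L.F s" using s by (intro L.gap_lower)
      also have "\<dots> = z - a" using F\<^sub>1_eq[of s] s F\<^sub>1_f[of z] az zr order by (simp add: s_def F\<^sub>0_def)
      finally have g: "c / 4 * s powr (1 + \<alpha>) \<le> z - a" .
      have "k * s\<^sup>2 \<le> c / 4 * s\<^sup>2" using k by (intro mult_right_mono) auto
      also have "\<dots> \<le> c / 4 * s powr (1 + \<alpha>)" using s L.\<beta> L.c by (intro square_le_powr) auto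
      finally have "k * s\<^sup>2 \<le> z - a" using g by simp
      moreover have "z - a \<le> k * e\<^sup>2" using z az \<delta>(2) by simp
      ultimately have "s \<le> e" "s ^ 3 \<le> z - a"
        using cube_le_of_square_bound[of k s "z - a" e] k e s by auto
      moreover have "\<tau>' ^ i \<le> s"
        using e0(2)[of "f z" j] fz fi \<open>s \<le> e\<close> e j by (simp add: s_def)
      ultimately show ?thesis using conclude[of i s "z - a"] az by simp
    qed
  qed
  then show ?thesis using \<delta>(1) by blast
qed

lemma distance_to_S:
  assumes \<tau>: "0 < \<tau>" "\<tau> < 1"
  shows "\<exists>\<delta>>0. \<forall>z i. 0 \<le> z \<longrightarrow> z \<le> 1 \<longrightarrow> (f ^^ i) z \<in> J\<^sub>0 \<longrightarrow> \<tau> ^ Suc i \<le> trunc_dist \<delta> z S"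
proof -
  obtain e0 where e0: "0 < e0" "\<And>z i. 0 \<le> z \<Longrightarrow> z \<le> e0 \<Longrightarrow> (f ^^ i) z \<in> J\<^sub>0 \<Longrightarrow> \<tau> ^ Suc i \<le> z"
    using distance_near_0[OF \<tau>] by blast
  obtain e1 where e1: "0 < e1" "\<And>z i. z \<le> 1 \<Longrightarrow> 1 - z \<le> e1 \<Longrightarrow> (f ^^ i) z \<in> J\<^sub>0 \<Longrightarrow> \<tau> ^ Suc i \<le> 1 - z"
    using distance_near_1[OF \<tau>] by blast
  obtain ea where ea: "0 < ea" "\<And>z i. \<bar>z - a\<bar> \<le> ea \<Longrightarrow> (f ^^ i) z \<in> J\<^sub>0 \<Longrightarrow> \<tau> ^ Suc i \<le> \<bar>z - a\<bar>"
    using distance_near_a[OF \<tau>] by blast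
  define \<delta> where "\<delta> = min e0 (min e1 ea)"
  have \<delta>: "0 < \<delta>" "\<delta> \<le> e0" "\<delta> \<le> e1" "\<delta> \<le> ea" using e0 e1 ea by (auto simp: \<delta>_def)
  have "\<tau> ^ Suc i \<le> trunc_dist \<delta> z S" if z: "0 \<le> z" "z \<le> 1" "(f ^^ i) z \<in> J\<^sub>0" for z i
  proof (cases "infdist z S \<le> \<delta>")
    case True
    obtain w where w: "w \<in> S" "infdist z S = \<bar>z - w\<bar>" by (rule infdist_three)
    from w(1) consider "w = 0" | "w = a" | "w = 1" by blast
    then have "\<tau> ^ Suc i \<le> \<bar>z - w\<bar>"
    proof cases
      case 1
      then show ?thesis using e0(2)[OF z(1) _ z(3)] True w \<delta> z by simp
    next
      case 2
      then show ?thesis using ea(2)[OF _ z(3)] True w \<delta> by simp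
    next
      case 3
      then show ?thesis using e1(2)[OF z(2) _ z(3)] True w \<delta> z by simp
    qed
    then show ?thesis using True w by (simp add: trunc_dist_def)
  next
    case False
    have "\<tau> ^ Suc i \<le> 1" using \<tau> by (intro power_le_one) auto
    then show ?thesis using False by (simp add: trunc_dist_def)
  qed
  then show ?thesis using \<delta>(1) by blast
qed

lemma inverse_deriv_f:
  "0 < z \<Longrightarrow> z < a \<Longrightarrow> inverse \<bar>deriv f z\<bar> = \<phi> (f z)"
  "a < z \<Longrightarrow> z < 1 \<Longrightarrow> inverse \<bar>deriv f z\<bar> = 1 - \<phi> (f z)"
proof -
  show "inverse \<bar>deriv f z\<bar> = \<phi> (f z)" if z: "0 < z" "z < a"
  proof -
    have w: "0 < f z" "f z < 1" using f_inside[of z] z order by auto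
    have "isCont f (F\<^sub>0 (f z))"
    proof (rule isCont_inverse_function2[where f = F\<^sub>0 and a = "f z / 2" and b = "(1 + f z) / 2"])
      fix v assume v: "f z / 2 \<le> v" "v \<le> (1 + f z) / 2"
      show "f (F\<^sub>0 v) = v" using v w by (intro f_F\<^sub>0) auto
      show "isCont F\<^sub>0 v" using v w by (intro DERIV_isCont[OF F\<^sub>0_deriv]) auto
    qed (use w in auto)
    then have "isCont f z" using F\<^sub>0_f[of z] z by simp
    then have "(f has_real_derivative inverse (\<phi> (f z))) (at z)"
      using w z \<phi>_pos[of "f z"]
      by (intro DERIV_inverse_function[where f = F\<^sub>0 and a = 0 and b = a] F\<^sub>0_deriv F\<^sub>0_f) auto
    then have "deriv f z = inverse (\<phi> (f z))" by (rule DERIV_imp_deriv)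
    then show ?thesis using \<phi>_pos[of "f z"] w by simp
  qed
  show "inverse \<bar>deriv f z\<bar> = 1 - \<phi> (f z)" if z: "a < z" "z < 1"
  proof -
    have w: "0 < f z" "f z < 1" using f_inside[of z] z order by auto
    have "isCont f (F\<^sub>1 (f z))"
    proof (rule isCont_inverse_function2[where f = F\<^sub>1 and a = "f z / 2" and b = "(1 + f z) / 2"])
      fix v assume v: "f z / 2 \<le> v" "v \<le> (1 + f z) / 2"
      show "f (F\<^sub>1 v) = v" using v w by (intro f_F\<^sub>1) auto
      show "isCont F\<^sub>1 v" using v w by (intro DERIV_isCont[OF F\<^sub>1_deriv]) auto
    qed (use w in auto)
    then have "isCont f z" using F\<^sub>1_f[of z] z by simp
    then have "(f has_real_derivative inverse (1 - \<phi> (f z))) (at z)"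
      using w z \<phi>_less_1[of "f z"]
      by (intro DERIV_inverse_function[where f = F\<^sub>1 and a = a and b = 1] F\<^sub>1_deriv F\<^sub>1_f) auto
    then have "deriv f z = inverse (1 - \<phi> (f z))" by (rule DERIV_imp_deriv)
    then show ?thesis using \<phi>_less_1[of "f z"] w by simp
  qed
qed

text \<open>Between \<open>x k\<^sub>0\<close> and \<open>y k\<^sub>0\<close> the reciprocal of the derivative of \<open>f\<close> is at most the square of this number. With the square root, a step with
\<open>N = -1\<close> makes up for one with \<open>N = 1\<close>, at which nothing is known beyond \<open>1 \<le> deriv f z\<close>.\<close>

definition rate :: "nat \<Rightarrow> real" where
  "rate k\<^sub>0 = sqrt (max (\<phi> (x k\<^sub>0)) (1 - \<phi> (y k\<^sub>0)))"

lemma rate_bounds: "0 < rate k\<^sub>0" "rate k\<^sub>0 < 1" "(rate k\<^sub>0)\<^sup>2 = max (\<phi> (x k\<^sub>0)) (1 - \<phi> (y k\<^sub>0))"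
proof -
  have "0 < \<phi> (x k\<^sub>0)" "\<phi> (x k\<^sub>0) < 1" "1 - \<phi> (y k\<^sub>0) < 1"
    using \<phi>_pos[of "x k\<^sub>0"] \<phi>_less_1[of "x k\<^sub>0"] \<phi>_pos[of "y k\<^sub>0"] x_bounds[of k\<^sub>0] y_bounds[of k\<^sub>0] order by auto
  then show "0 < rate k\<^sub>0" "rate k\<^sub>0 < 1" "(rate k\<^sub>0)\<^sup>2 = max (\<phi> (x k\<^sub>0)) (1 - \<phi> (y k\<^sub>0))"
    by (auto simp: rate_def less_max_iff_disj)
qed

lemma inverse_deriv_le:
  assumes z: "0 \<le> z" "z \<le> 1" "z \<notin> S" and k\<^sub>0: "1 \<le> k\<^sub>0"
  shows "inverse \<bar>deriv f z\<bar> \<le> rate k\<^sub>0 powr (1 - real_of_int (N_fun x y k\<^sub>0 z))"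
proof -
  have z': "0 < z" "z < 1" "z \<noteq> a" using z by auto
  have w: "0 < f z" "f z < 1" using f_inside[of z] z' by auto
  let ?\<sigma> = "rate k\<^sub>0"
  have pw: "?\<sigma> powr 2 = ?\<sigma>\<^sup>2" using rate_bounds(1)[of k\<^sub>0] by (simp add: powr_numeral)
  show ?thesis
  proof (cases "N_fun x y k\<^sub>0 z = 1")
    case True
    have "inverse \<bar>deriv f z\<bar> \<le> 1"
      using inverse_deriv_f[of z] z' w \<phi>_range[of "f z"] by (cases "z < a") auto
    then show ?thesis using True rate_bounds(1)[of k\<^sub>0] by simp
  next
    case False
    have near: "x k\<^sub>0 \<le> z \<and> z \<le> y k\<^sub>0"
    proof (cases "z \<in> J\<^sub>0")
      case True
      then show ?thesis
        using x_antimono[of 1 k\<^sub>0] y_mono[of 1 k\<^sub>0] k\<^sub>0 order x_bounds(3)[of k\<^sub>0] y_bounds(3)[of k\<^sub>0]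
        unfolding J\<^sub>0_iff by auto
    next
      case out: False
      then have "z \<notin> {0..<x k\<^sub>0} \<union> {y k\<^sub>0<..1}" using False by (auto simp: N_fun_def split: if_splits)
      then show ?thesis using z by auto
    qed
    have "inverse \<bar>deriv f z\<bar> \<le> ?\<sigma>\<^sup>2"
    proof (cases "z < a")
      case True
      have "\<phi> (f z) \<le> \<phi> (x k\<^sub>0)"
        using near f_ge[of z] True z' w x_bounds(1)[of k\<^sub>0] by (intro L.anti) auto
      then show ?thesis using inverse_deriv_f(1)[of z] True z' rate_bounds(3)[of k\<^sub>0] by simp
    next
      case False
      have "\<phi> (y k\<^sub>0) \<le> \<phi> (f z)"
        using near f_le[of z] False z' w y_bounds(1)[of k\<^sub>0] by (intro L.anti) auto
      then show ?thesis using inverse_deriv_f(2)[of z] False z' rate_bounds(3)[of k\<^sub>0] by simp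
    qed
    also have "?\<sigma>\<^sup>2 \<le> ?\<sigma> powr (1 - real_of_int (N_fun x y k\<^sub>0 z))"
      unfolding pw[symmetric] using rate_bounds[of k\<^sub>0] False
      by (intro powr_mono') (auto simp: N_fun_def)
    finally show ?thesis .
  qed
qed

text \<open>If the walk first becomes negative at time \<open>m\<close>, then its sum over any window ending at \<open>m\<close> is negative, being the
difference of a negative total and a nonnegative initial sum. Level 0 is visited at time \<open>m\<close>, so the
distances to \<open>S\<close> along the window are controlled by the number of steps that remain.\<close>

lemma hyperbolic_time_of_passage:
  assumes b: "0 < b" and k\<^sub>0: "1 \<le> k\<^sub>0"
    and \<delta>: "\<And>z i. 0 \<le> z \<Longrightarrow> z \<le> 1 \<Longrightarrow> (f ^^ i) z \<in> J\<^sub>0 \<Longrightarrow> (rate k\<^sub>0 powr b) ^ Suc i \<le> trunc_dist \<delta> z S"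
    and t: "t \<in> {0..1}" and pre: "\<And>j. j < m \<Longrightarrow> 0 \<le> (\<Sum>i\<le>j. N_fun x y k\<^sub>0 ((f ^^ i) t))"
    and neg: "(\<Sum>i\<le>m. N_fun x y k\<^sub>0 ((f ^^ i) t)) < 0"
  shows "hyperbolic_time f S b (rate k\<^sub>0) \<delta> t (Suc m)"
proof -
  let ?\<sigma> = "rate k\<^sub>0" and ?N = "\<lambda>i. N_fun x y k\<^sub>0 ((f ^^ i) t)"
  have pre': "0 \<le> (\<Sum>i<j. ?N i)" if "j \<le> m" for j
  proof (cases j)
    case (Suc k)
    then show ?thesis using pre[of k] that by (simp add: lessThan_Suc_atMost)
  qed simp
  have window: "(\<Sum>i=Suc m - l..<Suc m. ?N i) < 0" if "1 \<le> l" "l \<le> Suc m" for l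
  proof -
    have "(\<Sum>i<Suc m - l. ?N i) + (\<Sum>i=Suc m - l..<Suc m. ?N i) = (\<Sum>i<Suc m. ?N i)"
      unfolding lessThan_atLeast0 by (rule sum.atLeastLessThan_concat) auto
    moreover have "0 \<le> (\<Sum>i<Suc m - l. ?N i)" using that by (intro pre') arith
    moreover have "(\<Sum>i<Suc m. ?N i) < 0" using neg by (simp only: lessThan_Suc_atMost)
    ultimately show ?thesis by linarith
  qed
  have "?N m < 0" using window[of 1] by simp
  then have m: "(f ^^ m) t \<in> J\<^sub>0" by (auto simp: N_fun_def split: if_splits)
  have hit: "(f ^^ (m - j)) ((f ^^ j) t) \<in> J\<^sub>0" if "j \<le> m" for j
  proof -
    have "(f ^^ (m - j)) ((f ^^ j) t) = (f ^^ m) t"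
      using funpow_add[of "m - j" j f] that by simp
    then show ?thesis using m by simp
  qed
  have notS: "(f ^^ j) t \<notin> S" if "j \<le> m" for j
    using hit[OF that] iter_S S_J by blast
  have range: "0 \<le> (f ^^ j) t \<and> (f ^^ j) t \<le> 1" for j using f_iter_range[OF t, of j] by simp
  have "(\<Prod>j=Suc m - l..<Suc m. inverse \<bar>deriv f ((f ^^ j) t)\<bar>) \<le> ?\<sigma> ^ l" (is ?prod)
    and "?\<sigma> powr (b * real l) \<le> trunc_dist \<delta> ((f ^^ (Suc m - l)) t) S" (is ?dist)
    if l: "1 \<le> l" "l \<le> Suc m" for l
  proof -
    let ?A = "{Suc m - l..<Suc m}"
    have "(\<Prod>j\<in>?A. inverse \<bar>deriv f ((f ^^ j) t)\<bar>) \<le> (\<Prod>j\<in>?A. ?\<sigma> powr (1 - real_of_int (?N j)))"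
      using range notS k\<^sub>0 by (intro prod_mono conjI inverse_deriv_le) auto
    also have "\<dots> = ?\<sigma> powr (\<Sum>j\<in>?A. 1 - real_of_int (?N j))"
      using rate_bounds(1)[of k\<^sub>0] by (intro powr_sum[symmetric]) auto
    also have "\<dots> \<le> ?\<sigma> powr real l"
    proof -
      have "(\<Sum>j\<in>?A. 1 - real_of_int (?N j)) = real l - real_of_int (\<Sum>j\<in>?A. ?N j)"
        using l by (simp add: sum_subtractf)
      moreover have "real_of_int (\<Sum>j\<in>?A. ?N j) < 0" using window[OF l] by (simp only: of_int_less_0_iff)
      ultimately show ?thesis using rate_bounds[of k\<^sub>0] by (intro powr_mono') auto
    qed
    also have "\<dots> = ?\<sigma> ^ l" using rate_bounds(1)[of k\<^sub>0] by (simp add: powr_realpow)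
    finally show ?prod .
    have "?\<sigma> powr (b * real l) = (?\<sigma> powr b) ^ Suc (m - (Suc m - l))"
    proof -
      have "Suc (m - (Suc m - l)) = l" using l by simp
      then show ?thesis using rate_bounds(1)[of k\<^sub>0] by (simp add: powr_powr[symmetric] powr_realpow del: power_Suc)
    qed
    also have "\<dots> \<le> trunc_dist \<delta> ((f ^^ (Suc m - l)) t) S"
      using range hit[of "Suc m - l"] l by (intro \<delta>) auto
    finally show ?dist .
  qed
  then show ?thesis
    unfolding hyperbolic_time_def using t notS[of 0] by (auto simp del: prod.op_ivl_Suc)
qed

end

context two_branches
begin

lemma H_ge_iff: "enat n \<le> H_fun f x y k\<^sub>0 t \<longleftrightarrow> (\<forall>j<n. 0 \<le> (\<Sum>i\<le>j. N_fun x y k\<^sub>0 ((f ^^ i) t)))"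
  unfolding H_fun_def le_Inf_iff by (auto simp: not_le[symmetric])

lemma H_set_eq: "{t\<in>{0..1}. H_fun f x y k\<^sub>0 t \<ge> enat n} = survivors k\<^sub>0 n"
  by (simp only: survivors_def H_ge_iff)

lemma emeasure_lebesgue01:
  assumes "A \<in> sets borel" "A \<subseteq> {0..1}"
  shows "emeasure lebesgue01 A = emeasure lborel A" "A \<in> sets lebesgue01"
proof -
  show "emeasure lebesgue01 A = emeasure lborel A"
    using assms by (subst emeasure_restrict_space) auto
  have "A \<in> sets lebesgue" using assms(1) by simp
  then show "A \<in> sets lebesgue01" using assms(2) by (simp add: sets_restrict_space_iff)
qed

lemma borel_inter_I:
  assumes "A \<in> sets borel"
  shows "A \<inter> space I \<in> sets I"
proof -
  have "space I = {0..1}" by (simp add: space_restrict_space)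
  moreover have "A \<inter> {0..1} \<in> sets borel" using assms by (intro sets.Int) simp_all
  ultimately show ?thesis by (simp add: sets_restrict_space_iff)
qed

lemma inverse_deriv_measurable: "(\<lambda>t. inverse \<bar>deriv f t\<bar>) \<in> borel_measurable I"
proof -
  let ?D = "\<lambda>t. inverse \<bar>deriv f t\<bar>"
  let ?g = "\<lambda>t. if t \<in> {0} then ?D 0 else if t \<in> {a} then ?D a else if t \<in> {1} then ?D 1
      else if t \<in> {..<a} then \<phi> (f t) else 1 - \<phi> (f t)"
  have \<phi>: "\<phi> \<in> borel_measurable I"
    by (rule borel_measurable_continuous_on_restrict[OF L.cont])
  have \<phi>f: "(\<lambda>t. \<phi> (f t)) \<in> borel_measurable I"
    by (rule measurable_compose[OF f_measurable \<phi>])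
  have "(\<lambda>t. 1 - \<phi> (f t)) \<in> borel_measurable I"
    by (rule borel_measurable_diff[OF borel_measurable_const \<phi>f])
  note 1 = measurable_If_set[OF \<phi>f this borel_inter_I[of "{..<a}"]]
  note 2 = measurable_If_set[OF borel_measurable_const 1 borel_inter_I[of "{1}"], of "?D 1"]
  note 3 = measurable_If_set[OF borel_measurable_const 2 borel_inter_I[of "{a}"], of "?D a"]
  note 4 = measurable_If_set[OF borel_measurable_const 3 borel_inter_I[of "{0}"], of "?D 0"]
  have "?g \<in> borel_measurable I" by (rule 4) simp_all
  moreover have "?D t = ?g t" if "t \<in> space I" for t
  proof -
    have t: "0 \<le> t" "t \<le> 1" using that by (simp_all add: space_restrict_space)
    consider "t \<in> S" | "0 < t" "t < a" | "a < t" "t < 1" using t by fastforce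
    then show ?thesis
    proof cases
      case 1
      then show ?thesis by auto
    next
      case 2
      then show ?thesis using inverse_deriv_f(1)[of t] order by simp
    next
      case 3
      then show ?thesis using inverse_deriv_f(2)[of t] order by simp
    qed
  qed
  ultimately show ?thesis using measurable_cong[of I ?D ?g borel] by blast
qed

lemma trunc_dist_measurable: "(\<lambda>t. trunc_dist \<delta> t S) \<in> borel_measurable borel"
proof -
  have i: "(\<lambda>t::real. infdist t S) \<in> borel_measurable borel"
    by (intro borel_measurable_continuous_onI continuous_intros)
  have "{t \<in> space borel. infdist t S \<le> \<delta>} \<in> sets borel"
    using i by (intro borel_measurable_le) auto
  then show ?thesis
    unfolding trunc_dist_def[abs_def] by (intro measurable_If i borel_measurable_const)
qed

lemma hyperbolic_set_measurable: "{t\<in>{0..1}. hyperbolic_time f S b \<sigma> \<delta> t n} \<in> sets borel"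
proof (cases "1 \<le> n")
  case True
  have prod: "(\<lambda>t. \<Prod>j=n - l..<n. inverse \<bar>deriv f ((f ^^ j) t)\<bar>) \<in> borel_measurable I" for l
    by (intro borel_measurable_prod measurable_compose[OF f_iter_measurable inverse_deriv_measurable])
  have dist: "(\<lambda>t. trunc_dist \<delta> ((f ^^ j) t) S) \<in> borel_measurable I" for j
    by (rule measurable_compose[OF f_iter_measurable measurable_restrict_space1[OF trunc_dist_measurable]])
  define P where "P l t \<longleftrightarrow> (\<Prod>j=n - l..<n. inverse \<bar>deriv f ((f ^^ j) t)\<bar>) \<le> \<sigma> ^ l \<and>
      \<sigma> powr (b * real l) \<le> trunc_dist \<delta> ((f ^^ (n - l)) t) S" for l t
  have "{t \<in> space I. P l t} \<in> sets I" for l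
    unfolding P_def
    by (intro sets.sets_Collect_conj borel_measurable_le prod dist borel_measurable_const)
  then have "{t \<in> space I. \<forall>l\<in>{1..n}. P l t} \<in> sets I"
    by (rule sets.sets_Collect_finite_All) simp
  then have A: "{t \<in> {0..1}. \<forall>l\<in>{1..n}. P l t} \<in> sets I" by (simp add: space_restrict_space)
  have "{t \<in> {0..1}. \<forall>l\<in>{1..n}. P l t} \<in> sets borel"
    using A sets_restrict_space_iff[of "{0..1::real}" borel] by simp
  moreover have "S \<in> sets borel" by simp
  ultimately have "{t \<in> {0..1}. \<forall>l\<in>{1..n}. P l t} - S \<in> sets borel" by (rule sets.Diff)
  moreover have "{t\<in>{0..1}. hyperbolic_time f S b \<sigma> \<delta> t n} = {t \<in> {0..1}. \<forall>l\<in>{1..n}. P l t} - S"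
    using True unfolding hyperbolic_time_def P_def by blast
  ultimately show ?thesis by simp
qed (simp add: hyperbolic_time_def)

lemma first_hyperbolic_ge_iff:
  "enat n \<le> first_hyperbolic_time f S b \<sigma> \<delta> t \<longleftrightarrow> (\<forall>k<n. \<not> hyperbolic_time f S b \<sigma> \<delta> t k)"
  unfolding first_hyperbolic_time_def le_Inf_iff by (auto simp: not_le[symmetric])

lemma first_hyperbolic_set_measurable:
  "{t\<in>{0..1}. enat n \<le> first_hyperbolic_time f S b \<sigma> \<delta> t} \<in> sets borel"
proof -
  have "{t\<in>{0..1}. enat n \<le> first_hyperbolic_time f S b \<sigma> \<delta> t}
      = {0..1} - (\<Union>k\<in>{..<n}. {t\<in>{0..1}. hyperbolic_time f S b \<sigma> \<delta> t k})"
    unfolding first_hyperbolic_ge_iff by auto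
  also have "\<dots> \<in> sets borel"
    by (intro sets.Diff sets.finite_UN hyperbolic_set_measurable) auto
  finally show ?thesis .
qed

text \<open>The values are extended natural numbers, so it suffices to consider the countably many level sets.\<close>

lemma first_hyperbolic_measurable:
  "first_hyperbolic_time f S b \<sigma> \<delta> \<in> lebesgue01 \<rightarrow>\<^sub>M count_space UNIV"
proof -
  let ?h = "first_hyperbolic_time f S b \<sigma> \<delta>"
  define U where "U n = {t\<in>{0..1}. enat n \<le> ?h t}" for n
  have U: "U n \<in> sets lebesgue01" for n
    unfolding U_def by (intro emeasure_lebesgue01(2) first_hyperbolic_set_measurable) auto
  have sp: "space lebesgue01 = {0..1}" by simp
  have "?h -` {e} \<inter> space lebesgue01 \<in> sets lebesgue01" for e
  proof (cases e)
    case (enat n)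
    have "?h t = enat n \<longleftrightarrow> enat n \<le> ?h t \<and> \<not> enat (Suc n) \<le> ?h t" for t
      by (cases "?h t") auto
    then have "?h -` {e} \<inter> space lebesgue01 = U n - U (Suc n)"
      unfolding enat U_def sp by auto
    then show ?thesis using U by auto
  next
    case infinity
    have "?h t = \<infinity> \<longleftrightarrow> (\<forall>n. enat n \<le> ?h t)" for t
    proof (cases "?h t")
      case (enat k)
      then have "\<not> enat (Suc k) \<le> ?h t" "?h t \<noteq> \<infinity>" by simp_all
      then show ?thesis by blast
    qed auto
    then have "?h -` {e} \<inter> space lebesgue01 = (\<Inter>n. U n)"
      unfolding infinity U_def sp by auto
    then show ?thesis using U by auto
  qed
  then show ?thesis by (subst measurable_count_space_eq2_countable) auto
qed

lemma hyperbolic_before_passage: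
  assumes b: "0 < b" and k\<^sub>0: "1 \<le> k\<^sub>0"
    and \<delta>: "\<And>z i. 0 \<le> z \<Longrightarrow> z \<le> 1 \<Longrightarrow> (f ^^ i) z \<in> J\<^sub>0 \<Longrightarrow> (rate k\<^sub>0 powr b) ^ Suc i \<le> trunc_dist \<delta> z S"
  shows "{t\<in>{0..1}. first_hyperbolic_time f S b (rate k\<^sub>0) \<delta> t > enat n} \<subseteq> survivors k\<^sub>0 n"
proof
  fix t assume "t \<in> {t\<in>{0..1}. first_hyperbolic_time f S b (rate k\<^sub>0) \<delta> t > enat n}"
  then have t: "t \<in> {0..1}" and h: "enat (Suc n) \<le> first_hyperbolic_time f S b (rate k\<^sub>0) \<delta> t"
    by (auto simp: Suc_ile_eq)
  let ?P = "\<lambda>j. (\<Sum>i\<le>j. N_fun x y k\<^sub>0 ((f ^^ i) t)) < 0"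
  have "\<not> ?P j" if "j < n" for j
  proof
    assume j: "?P j"
    define m where "m = (LEAST j. ?P j)"
    have m: "?P m" unfolding m_def by (rule LeastI) (rule j)
    have mj: "m \<le> j" unfolding m_def by (rule Least_le) (rule j)
    have "hyperbolic_time f S b (rate k\<^sub>0) \<delta> t (Suc m)"
    proof (rule hyperbolic_time_of_passage[OF b k\<^sub>0 \<delta> t _ m])
      show "0 \<le> (\<Sum>i\<le>j. N_fun x y k\<^sub>0 ((f ^^ i) t))" if "j < m" for j
        using not_less_Least[of j ?P] that by (simp add: m_def[symmetric])
    qed
    moreover have "Suc m < Suc n" using mj that by simp
    ultimately show False using h unfolding first_hyperbolic_ge_iff by blast
  qed
  then show "t \<in> survivors k\<^sub>0 n" using t by (simp add: survivors_def not_less)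
qed

lemma survivors_subset: "survivors k\<^sub>0 n \<subseteq> {0..1}"
  by (auto simp: survivors_def)

lemma hyperbolic_times_and_passage:
  assumes b: "0 < b" and k\<^sub>0: "1 \<le> k\<^sub>0" and dr: "x k\<^sub>0 + (1 - y k\<^sub>0) < y 0 - x 0"
  shows "\<exists>\<sigma>\<in>{0<..<1}. \<exists>\<delta>>0.
    (\<forall>n\<ge>1. measure lebesgue01 {t\<in>{0..1}. first_hyperbolic_time f {0, a, 1} b \<sigma> \<delta> t > enat n}
             \<le> measure lebesgue01 {t\<in>{0..1}. H_fun f x y k\<^sub>0 t \<ge> enat n}) \<and>
    (\<forall>\<alpha>''\<in>{\<alpha><..<1}.
       (\<lambda>n. measure lebesgue01 {t\<in>{0..1}. H_fun f x y k\<^sub>0 t \<ge> enat n})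
         \<in> O(\<lambda>n. real n powr (- (1 / \<alpha>'')))) \<and>
    enat_integrable lebesgue01 (first_hyperbolic_time f {0, a, 1} b \<sigma> \<delta>)"
proof -
  have \<tau>: "0 < rate k\<^sub>0 powr b" "rate k\<^sub>0 powr b < 1"
  proof -
    show "0 < rate k\<^sub>0 powr b" using rate_bounds(1)[of k\<^sub>0] by simp
    have "rate k\<^sub>0 powr b < 1 powr b" using rate_bounds[of k\<^sub>0] b by (intro powr_less_mono2) auto
    then show "rate k\<^sub>0 powr b < 1" by simp
  qed
  obtain \<delta> where \<delta>: "0 < \<delta>"
    "\<And>z i. 0 \<le> z \<Longrightarrow> z \<le> 1 \<Longrightarrow> (f ^^ i) z \<in> J\<^sub>0 \<Longrightarrow> (rate k\<^sub>0 powr b) ^ Suc i \<le> trunc_dist \<delta> z S"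
    using distance_to_S[OF \<tau>] by blast
  let ?h = "first_hyperbolic_time f S b (rate k\<^sub>0) \<delta>"
  note sub = hyperbolic_before_passage[OF b k\<^sub>0 \<delta>(2)]
  have em: "emeasure lebesgue01 (survivors k\<^sub>0 n) = emeasure lborel (survivors k\<^sub>0 n)"
    and ms: "survivors k\<^sub>0 n \<in> sets lebesgue01" for n
    by (rule emeasure_lebesgue01[OF survivors_measurable survivors_subset])+
  have unit: "emeasure lebesgue01 (space lebesgue01) = 1"
    by (simp add: emeasure_restrict_space)
  have fin: "emeasure lebesgue01 A \<noteq> \<infinity>" for A
  proof -
    have "emeasure lebesgue01 A \<le> 1" using emeasure_space[of lebesgue01 A] unit by simp
    then show ?thesis by (auto simp: top_unique)
  qed
  have part1: "measure lebesgue01 {t\<in>{0..1}. ?h t > enat n}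
      \<le> measure lebesgue01 {t\<in>{0..1}. H_fun f x y k\<^sub>0 t \<ge> enat n}" for n
    unfolding H_set_eq measure_def
    using emeasure_mono[OF sub[of n] ms[of n]] fin by (intro enn2real_mono) (auto simp: less_top)
  have tail: "\<exists>T\<ge>0. \<forall>n\<ge>1. emeasure lebesgue01 (survivors k\<^sub>0 n) \<le> ennreal (T * real n powr (- (1 / \<gamma>)))"
    if \<gamma>: "\<alpha> < \<gamma>" "\<gamma> < 1" for \<gamma>
  proof -
    have "0 < \<gamma>" using \<gamma> L.\<beta> by linarith
    then have "1 < 1 / \<gamma>" "1 / \<gamma> < 1 / \<alpha>"
      using \<gamma> L.\<beta> by (simp_all add: divide_strict_left_mono)
    from survivors_tail[OF this k\<^sub>0 dr] show ?thesis unfolding em .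
  qed
  have part2: "(\<lambda>n. measure lebesgue01 {t\<in>{0..1}. H_fun f x y k\<^sub>0 t \<ge> enat n}) \<in> O(\<lambda>n. real n powr (- (1 / \<gamma>)))"
    if "\<gamma> \<in> {\<alpha><..<1}" for \<gamma>
  proof -
    have \<gamma>: "\<alpha> < \<gamma>" "\<gamma> < 1" using that by simp_all
    obtain T where T: "0 \<le> T"
      "\<And>n. 1 \<le> n \<Longrightarrow> emeasure lebesgue01 (survivors k\<^sub>0 n) \<le> ennreal (T * real n powr (- (1 / \<gamma>)))"
      using tail[OF \<gamma>] by blast
    show ?thesis
      unfolding H_set_eq
    proof (rule landau_o.bigI)
      show "0 < T + 1" using T(1) by simp
      show "\<forall>\<^sub>F n in sequentially. norm (measure lebesgue01 (survivors k\<^sub>0 n))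
          \<le> (T + 1) * norm (real n powr (- (1 / \<gamma>)))"
        using eventually_ge_at_top[of 1]
      proof (rule eventually_mono)
        fix n :: nat assume n: "1 \<le> n"
        have "measure lebesgue01 (survivors k\<^sub>0 n) \<le> T * real n powr (- (1 / \<gamma>))"
          unfolding measure_def by (rule enn2real_leI[OF _ T(2)[OF n]]) (use T(1) in simp)
        also have "\<dots> \<le> (T + 1) * real n powr (- (1 / \<gamma>))" by (intro mult_right_mono) simp_all
        finally show "norm (measure lebesgue01 (survivors k\<^sub>0 n)) \<le> (T + 1) * norm (real n powr (- (1 / \<gamma>)))"
          by simp
      qed
    qed
  qed
  have part3: "enat_integrable lebesgue01 ?h"
    unfolding enat_integrable_def
  proof
    show "(\<lambda>t. ennreal_of_enat (?h t)) \<in> borel_measurable lebesgue01"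
      by (rule measurable_compose[OF first_hyperbolic_measurable]) simp
    define \<gamma> where "\<gamma> = (\<alpha> + 1) / 2"
    have \<gamma>: "\<alpha> < \<gamma>" "\<gamma> < 1" "0 < \<gamma>" using L.\<beta> by (auto simp: \<gamma>_def)
    obtain T where T: "0 \<le> T"
      "\<And>n. 1 \<le> n \<Longrightarrow> emeasure lebesgue01 (survivors k\<^sub>0 n) \<le> ennreal (T * real n powr (- (1 / \<gamma>)))"
      using tail[OF \<gamma>(1,2)] by blast
    have "(\<integral>\<^sup>+t. ennreal_of_enat (?h t) \<partial>lebesgue01)
        = (\<Sum>n. emeasure lebesgue01 {t \<in> space lebesgue01. enat n < ?h t})"
      by (rule nn_integral_enat_function[OF first_hyperbolic_measurable])
    also have "\<dots> \<le> (\<Sum>n. emeasure lebesgue01 (survivors k\<^sub>0 n))"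
      using emeasure_mono[OF sub ms] by (intro suminf_le) auto
    also have "\<dots> = (\<Sum>n. emeasure lebesgue01 (survivors k\<^sub>0 (Suc n))) + emeasure lebesgue01 (survivors k\<^sub>0 0)"
      using suminf_offset[of "\<lambda>n. emeasure lebesgue01 (survivors k\<^sub>0 n)" 1] by (simp add: add.commute)
    also have "\<dots> < \<infinity>"
    proof -
      have "summable (\<lambda>n. T * real (Suc n) powr (- (1 / \<gamma>)))"
      proof (rule summable_mult)
        have "1 < 1 / \<gamma>" using \<gamma> by simp
        then show "summable (\<lambda>n. real (Suc n) powr (- (1 / \<gamma>)))"
          by (subst summable_Suc_iff[of "\<lambda>n. real n powr (- (1 / \<gamma>))"]) (simp add: summable_real_powr_iff)
      qed
      then have "(\<Sum>n. ennreal (T * real (Suc n) powr (- (1 / \<gamma>)))) < \<infinity>"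
        using T(1) by (subst suminf_ennreal2) auto
      moreover have "(\<Sum>n. emeasure lebesgue01 (survivors k\<^sub>0 (Suc n)))
          \<le> (\<Sum>n. ennreal (T * real (Suc n) powr (- (1 / \<gamma>))))"
        by (intro suminf_le T(2)) auto
      ultimately have "(\<Sum>n. emeasure lebesgue01 (survivors k\<^sub>0 (Suc n))) < \<infinity>"
        by (auto intro: le_less_trans)
      then show ?thesis using fin[of "survivors k\<^sub>0 0"] by (simp add: less_top)
    qed
    finally show "(\<integral>\<^sup>+t. ennreal_of_enat (?h t) \<partial>lebesgue01) < \<infinity>" .
  qed
  show ?thesis
    using part1 part2 part3 rate_bounds[of k\<^sub>0] \<delta>(1)
    by (intro bexI[of _ "rate k\<^sub>0"] exI[of _ \<delta>]) auto
qed

end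

section \<open>Hyperbolic times of maps in the class\<close>

theorem theorem3:
  fixes \<alpha> b a :: real and \<phi> f :: "real \<Rightarrow> real" and x y :: "nat \<Rightarrow> real" and k\<^sub>0 :: nat
  assumes "0 < \<alpha>" and "\<alpha> < 1"
    and "class_C \<alpha> \<phi> f"
    and "a = cut_point \<phi>"
    and "0 < b" and "b < 1"
    and "partition_points a f x y"
    and "(\<Sum>k. emeasure lebesgue01 (J_left x (k\<^sub>0 + k) \<union> J_right y (k\<^sub>0 + k)))
           < emeasure lebesgue01 (J_left x 0 \<union> J_right y 0)"
  shows "\<exists>\<sigma>\<in>{0<..<1}. \<exists>\<delta>>0.
    (\<forall>n\<ge>1. measure lebesgue01 {t\<in>{0..1}. first_hyperbolic_time f {0, a, 1} b \<sigma> \<delta> t > enat n}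
             \<le> measure lebesgue01 {t\<in>{0..1}. H_fun f x y k\<^sub>0 t \<ge> enat n}) \<and>
    (\<forall>\<alpha>''\<in>{\<alpha><..<1}.
       (\<lambda>n. measure lebesgue01 {t\<in>{0..1}. H_fun f x y k\<^sub>0 t \<ge> enat n})
         \<in> O(\<lambda>n. real n powr (- (1 / \<alpha>'')))) \<and>
    enat_integrable lebesgue01 (first_hyperbolic_time f {0, a, 1} b \<sigma> \<delta>)"
proof -
  have cut: "cut_function \<alpha> \<phi>" and rng: "\<And>z. 0 \<le> z \<Longrightarrow> z \<le> 1 \<Longrightarrow> 0 \<le> f z \<and> f z \<le> 1"
    and left: "\<And>z. 0 \<le> z \<Longrightarrow> z \<le> 1 \<Longrightarrow> z \<le> a \<Longrightarrow> z = integral {0..f z} \<phi>"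
    and right: "\<And>z. 0 \<le> z \<Longrightarrow> z \<le> 1 \<Longrightarrow> a < z \<Longrightarrow> 1 - z = integral {f z..1} (\<lambda>t. 1 - \<phi> t)"
    using assms(3) unfolding class_C_def assms(4) by auto
  have p: "0 < x 0" "x 0 < a" "a < y 0" "y 0 < 1" "f (x 0) = y 0" "f (y 0) = x 0"
    using assms(7) by (auto simp: partition_points_def)
  have xy: "0 < y 0" "y 0 < 1" "0 < 1 - x 0" "1 - x 0 < 1" using p by auto
  obtain c B \<beta> c' B' where
    cont: "continuous_on {0..1} \<phi>" and anti: "\<And>s t. 0 \<le> s \<Longrightarrow> s \<le> t \<Longrightarrow> t \<le> 1 \<Longrightarrow> \<phi> t \<le> \<phi> s"
    and r\<phi>: "\<And>t. 0 \<le> t \<Longrightarrow> t \<le> 1 \<Longrightarrow> 0 \<le> \<phi> t \<and> \<phi> t \<le> 1" and \<phi>0: "\<phi> 0 = 1" and \<phi>1: "\<phi> 1 = 0"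
    and c: "0 < c" "0 \<le> B" "\<And>t. 0 < t \<Longrightarrow> t \<le> y 0 \<Longrightarrow> c * t powr \<alpha> \<le> 1 - \<phi> t"
    "\<And>t. 0 < t \<Longrightarrow> t \<le> y 0 \<Longrightarrow> 1 - \<phi> t \<le> B * t powr \<alpha>"
    "\<And>s t. 0 < s \<Longrightarrow> s \<le> t \<Longrightarrow> t \<le> y 0 \<Longrightarrow> \<phi> s - \<phi> t \<le> B * s powr (\<alpha> - 1) * (t - s)"
    and \<beta>: "0 < \<beta>" "\<beta> \<le> \<alpha>"
    and c': "0 < c'" "0 \<le> B'" "\<And>t. 0 < t \<Longrightarrow> t \<le> 1 - x 0 \<Longrightarrow> c' * t powr \<beta> \<le> \<phi> (1 - t)"
    "\<And>t. 0 < t \<Longrightarrow> t \<le> 1 - x 0 \<Longrightarrow> \<phi> (1 - t) \<le> B' * t powr \<beta>"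
    "\<And>s t. 0 < s \<Longrightarrow> s \<le> t \<Longrightarrow> t \<le> 1 - x 0 \<Longrightarrow> \<phi> (1 - t) - \<phi> (1 - s) \<le> B' * s powr (\<beta> - 1) * (t - s)"
    by (rule cut_function_ends[OF cut assms(1,2) xy]) (rule that, assumption+)
  have \<phi>_y: "0 < \<phi> (y 0)"
  proof -
    have "0 < c' * (1 - y 0) powr \<beta>" using c' p by simp
    also have "\<dots> \<le> \<phi> (1 - (1 - y 0))" using p by (intro c') auto
    finally show ?thesis by simp
  qed
  have \<phi>_x: "\<phi> (x 0) < 1"
  proof -
    have "0 < c * x 0 powr \<alpha>" using c p by simp
    also have "\<dots> \<le> 1 - \<phi> (x 0)" using p by (intro c) auto
    finally show ?thesis by simp
  qed
  have L: "neutral_branch \<phi> \<alpha> (x 0) (y 0) c B"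
    by unfold_locales (use assms(1,2) p cont anti \<phi>0 \<phi>_y c left[of "x 0"] in auto)
  have R: "neutral_branch (\<lambda>t. 1 - \<phi> (1 - t)) \<beta> (1 - y 0) (1 - x 0) c' B'"
  proof
    show "continuous_on {0..1} (\<lambda>t. 1 - \<phi> (1 - t))"
      by (intro continuous_intros continuous_on_compose2[OF cont]) auto
    show "1 - \<phi> (1 - t) \<le> 1 - \<phi> (1 - s)" if "0 \<le> s" "s \<le> t" "t \<le> 1" for s t
      using anti[of "1 - t" "1 - s"] that by simp
    have "continuous_on {0..1} (\<lambda>t. 1 - \<phi> t)" by (intro continuous_intros cont)
    then have "integral {0..1 - x 0} (\<lambda>t. 1 - \<phi> (1 - t)) = integral {1 - (1 - x 0)..1} (\<lambda>t. 1 - \<phi> t)"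
      using xy by (intro integral_reflect_unit) auto
    then show "integral {0..1 - x 0} (\<lambda>t. 1 - \<phi> (1 - t)) = 1 - y 0"
      using right[of "y 0"] p by simp
  qed (use assms(2) \<beta> p \<phi>1 \<phi>_x c' in auto)
  have "two_branches \<phi> f \<alpha> \<beta> a c B c' B' x y"
    by (intro two_branches.intro L R \<beta> rng left right assms(7)) (simp_all add: assms(4) cut_point_def)
  then interpret two_branches \<phi> f \<alpha> \<beta> a c B c' B' x y .
  show ?thesis
    by (rule hyperbolic_times_and_passage[OF assms(5) drift_imp[OF assms(8)]])
qed

end
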